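(* Let $N\subseteq M$ be a connected unital inclusion of finite dimensional $C^*$-algebras with its Markov trace $tr$ on $M$, let $N\subseteq M\subseteq M_1\subseteq M_2\subseteq\cdots$ be its Jones tower with Jones projections $e_1,e_2,\dots$, and let $R$ be the hyperfinite $II_1$ factor arising from this tower. Let $\alpha_0$ be an automorphism of $M$ such that $\alpha_0(N)=N$. Then there is a unique automorphism $\alpha$ of $R$ such that $\alpha(e_i)=e_i$ and $\alpha(M_i)=M_i$ for all $i\ge 1$, and $\alpha|_M=\alpha_0$; moreover this $\alpha$ is trace preserving.
   Context: An automorphism means a $*$-automorphism. Connected means that the Bratteli diagram of the inclusion is connected. For an inclusion $A\subseteq B$ with faithful tracial state $tr$ on $B$, Jones' basic construction $\langle B,e_A\rangle$ is generated on $L^2(B,tr)$ by $B$ and the orthogonal projection $e_A$ onto $L^2(A,tr)$ (the Jones projection). The faithful tracial state $tr$ on $B$ is a Markov trace of modulus $\tau$ if it extends to a positive trace $Tr$ on $\langle B,e_A\rangle$ with $Tr(xe_A)=\tau\,tr(x)$ for $x\in B$. For a connected inclusion of finite dimensional $C^*$-algebras with inclusion matrix $G$ there is a unique normalized Markov trace, with modulus $\tau=\|G\|^{-2}$. Jones tower: with $M_{-1}=N$, $M_0=M$, set $M_{n+1}=\langle M_n,e_{n+1}\rangle$, the basic construction of $M_{n-1}\subseteq M_n$, for $n\ge0$; $e_{n+1}$ implements the trace-preserving conditional expectation of $M_n$ onto $M_{n-1}$. The Markov trace extends consistently to a faithful tracial state $tr$ on $\bigcup_n M_n$. $R$ (also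 written $M_\infty$) is the von Neumann algebra generated by $\bigcup_n M_n$ in the GNS representation of $tr$, equipped with the extension of $tr$. *)

theory Defs
  imports "HOL-Analysis.Analysis"
begin

class scaleC =
  fixes scaleC :: "complex \<Rightarrow> 'a \<Rightarrow> 'a"  (infixr \<open>*\<^sub>C\<close> 75)

class complex_vector = real_vector + scaleC +
  assumes scaleC_add_right: "c *\<^sub>C (x + y) = c *\<^sub>C x + c *\<^sub>C y"
    and scaleC_add_left: "(c + d) *\<^sub>C x = c *\<^sub>C x + d *\<^sub>C x"
    and scaleC_scaleC: "c *\<^sub>C d *\<^sub>C x = (c * d) *\<^sub>C x"
    and scaleC_of_real: "complex_of_real r *\<^sub>C x = r *\<^sub>R x"

global_interpretation complex_vector:
  vector_space "scaleC :: complex \<Rightarrow> 'a \<Rightarrow> 'a::complex_vector"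
proof
  show "1 *\<^sub>C x = x" for x :: 'a
    using scaleC_of_real[of 1 x] by simp
qed (simp_all add: scaleC_add_right scaleC_add_left scaleC_scaleC)

class complex_normed_vector = complex_vector + real_normed_vector +
  assumes norm_scaleC: "norm (c *\<^sub>C x) = cmod c * norm x"

class cstar_algebra = complex_normed_vector + real_normed_algebra_1 + banach +
  fixes star :: "'a \<Rightarrow> 'a"
  assumes mult_scaleC_left: "(c *\<^sub>C x) * y = c *\<^sub>C (x * y)"
    and mult_scaleC_right: "x * (c *\<^sub>C y) = c *\<^sub>C (x * y)"
    and star_star: "star (star x) = x"
    and star_add: "star (x + y) = star x + star y"
    and star_scaleC: "star (c *\<^sub>C x) = cnj c *\<^sub>C star x"
    and star_mult: "star (x * y) = star y * star x"
    and cstar_identity: "norm (star x * x) = (norm x)\<^sup>2"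

class complex_hilbert_space = complex_normed_vector + banach +
  fixes cinner :: "'a \<Rightarrow> 'a \<Rightarrow> complex"
  assumes cinner_commute: "cinner x y = cnj (cinner y x)"
    and cinner_add_right: "cinner x (y + z) = cinner x y + cinner x z"
    and cinner_scaleC_right: "cinner x (c *\<^sub>C y) = c * cinner x y"
    and cinner_self: "cinner x x = complex_of_real ((norm x)\<^sup>2)"

text \<open>All finite dimensional C*-algebras are unital *-subalgebras of one ambient unital
  C*-algebra and share its unit; inclusions are therefore unital. Norm closedness is automatic
  in finite dimension.\<close>

definition unital_star_subalgebra :: "'a::cstar_algebra set \<Rightarrow> bool" where
  "unital_star_subalgebra A \<longleftrightarrow>
     complex_vector.subspace A \<and> 1 \<in> A \<and>
     (\<forall>x\<in>A. \<forall>y\<in>A. x * y \<in> A) \<and> (\<forall>x\<in>A. star x \<in> A)"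

definition fd_cstar_algebra :: "'a::cstar_algebra set \<Rightarrow> bool" where
  "fd_cstar_algebra A \<longleftrightarrow>
     unital_star_subalgebra A \<and> (\<exists>S. finite S \<and> A \<subseteq> complex_vector.span S)"

definition star_automorphism :: "'a::cstar_algebra set \<Rightarrow> ('a \<Rightarrow> 'a) \<Rightarrow> bool" where
  "star_automorphism A \<alpha> \<longleftrightarrow>
     bij_betw \<alpha> A A \<and>
     (\<forall>x\<in>A. \<forall>y\<in>A. \<alpha> (x + y) = \<alpha> x + \<alpha> y) \<and>
     (\<forall>c. \<forall>x\<in>A. \<alpha> (c *\<^sub>C x) = c *\<^sub>C \<alpha> x) \<and>
     (\<forall>x\<in>A. \<forall>y\<in>A. \<alpha> (x * y) = \<alpha> x * \<alpha> y) \<and>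
     (\<forall>x\<in>A. \<alpha> (star x) = star (\<alpha> x))"

definition center :: "'a::cstar_algebra set \<Rightarrow> 'a set" where
  "center A = {z \<in> A. \<forall>x\<in>A. z * x = x * z}"

definition is_projection :: "'a::cstar_algebra \<Rightarrow> bool" where
  "is_projection p \<longleftrightarrow> p * p = p \<and> star p = p"

definition minimal_central_projections :: "'a::cstar_algebra set \<Rightarrow> 'a set" where
  "minimal_central_projections A =
     {p \<in> center A. is_projection p \<and> p \<noteq> 0 \<and>
        (\<forall>q\<in>center A. is_projection q \<and> q * p = q \<longrightarrow> q = 0 \<or> q = p)}"

definition compression :: "'a::cstar_algebra \<Rightarrow> 'a set \<Rightarrow> 'a set" where
  "compression p A = (\<lambda>x. p * x * p) ` A"

text \<open>If \<open>p q \<noteq> 0\<close>, then \<open>N\<^bsub>pq\<^esub> \<subseteq> M\<^bsub>pq\<^esub>\<close> is an inclusion of full matrix algebras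
  \<open>Mat\<^bsub>n\<^esub> \<subseteq> Mat\<^bsub>gn\<^esub>\<close>, and the entry of the inclusion matrix is the multiplicity
  \<open>g = (dim M\<^bsub>pq\<^esub> / dim N\<^bsub>pq\<^esub>)\<^bsup>1/2\<^esup>\<close>.\<close>

definition inclusion_matrix :: "'a::cstar_algebra set \<Rightarrow> 'a set \<Rightarrow> 'a \<Rightarrow> 'a \<Rightarrow> real" where
  "inclusion_matrix N M p q =
     (if p * q = 0 then 0
      else sqrt (real (complex_vector.dim (compression (p * q) M)) /
                 real (complex_vector.dim (compression (p * q) N))))"

text \<open>The Bratteli diagram is bipartite, hence the disjoint sum: a projection may be minimal
  central in both \<open>N\<close> and \<open>M\<close>. Only the presence of edges, not their multiplicity, is recorded.\<close>

definition bratteli_vertices :: "'a::cstar_algebra set \<Rightarrow> 'a set \<Rightarrow> ('a + 'a) set" where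
  "bratteli_vertices N M = minimal_central_projections N <+> minimal_central_projections M"

definition bratteli_edges :: "'a::cstar_algebra set \<Rightarrow> 'a set \<Rightarrow> ('a + 'a) rel" where
  "bratteli_edges N M =
     {(Inl p, Inr q) |p q.
        p \<in> minimal_central_projections N \<and> q \<in> minimal_central_projections M \<and>
        inclusion_matrix N M p q \<noteq> 0}"

definition connected_inclusion :: "'a::cstar_algebra set \<Rightarrow> 'a set \<Rightarrow> bool" where
  "connected_inclusion N M \<longleftrightarrow>
     (\<forall>u\<in>bratteli_vertices N M. \<forall>v\<in>bratteli_vertices N M.
        (u, v) \<in> (bratteli_edges N M \<union> (bratteli_edges N M)\<inverse>)\<^sup>*)"

definition faithful_tracial_state :: "'a::cstar_algebra set \<Rightarrow> ('a \<Rightarrow> complex) \<Rightarrow> bool" where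
  "faithful_tracial_state B tr \<longleftrightarrow>
     (\<forall>x\<in>B. \<forall>y\<in>B. tr (x + y) = tr x + tr y) \<and>
     (\<forall>c. \<forall>x\<in>B. tr (c *\<^sub>C x) = c * tr x) \<and>
     (\<forall>x\<in>B. tr (star x * x) \<in> \<real>\<^sub>\<ge>\<^sub>0) \<and>
     tr 1 = 1 \<and>
     (\<forall>x\<in>B. \<forall>y\<in>B. tr (x * y) = tr (y * x)) \<and>
     (\<forall>x\<in>B. tr (star x * x) = 0 \<longrightarrow> x = 0)"

text \<open>For finite dimensional \<open>B\<close> and faithful \<open>tr\<close>, the space \<open>L\<^sup>2(B,tr)\<close> is \<open>B\<close> itself with the
  inner product below, and \<open>L\<^sup>2(A,tr)\<close> is its subspace \<open>A\<close>. Operators on \<open>L\<^sup>2(B,tr)\<close> are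
  represented by functions that are \<open>undefined\<close> outside \<open>B\<close>.\<close>

definition tr_inner :: "('a::cstar_algebra \<Rightarrow> complex) \<Rightarrow> 'a \<Rightarrow> 'a \<Rightarrow> complex" where
  "tr_inner tr a b = tr (star a * b)"

definition left_mult :: "'a::cstar_algebra set \<Rightarrow> 'a \<Rightarrow> 'a \<Rightarrow> 'a" where
  "left_mult B x = (\<lambda>b\<in>B. x * b)"

definition jones_projection ::
  "'a::cstar_algebra set \<Rightarrow> 'a set \<Rightarrow> ('a \<Rightarrow> complex) \<Rightarrow> 'a \<Rightarrow> 'a" where
  "jones_projection A B tr =
     (\<lambda>b\<in>B. THE a. a \<in> A \<and> (\<forall>c\<in>A. tr_inner tr c (b - a) = 0))"

text \<open>The algebra generated by \<open>B\<close> and \<open>e\<^sub>A\<close> on \<open>L\<^sup>2(B,tr)\<close>. The set of generators is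
  self-adjoint and the space is finite dimensional, so this is also the C*-algebra (and the
  von Neumann algebra) they generate.\<close>

inductive_set basic_construction ::
  "'a::cstar_algebra set \<Rightarrow> 'a set \<Rightarrow> ('a \<Rightarrow> complex) \<Rightarrow> ('a \<Rightarrow> 'a) set"
  for A B tr where
  left_mult: "x \<in> B \<Longrightarrow> left_mult B x \<in> basic_construction A B tr"
| jones_projection: "jones_projection A B tr \<in> basic_construction A B tr"
| add: "S \<in> basic_construction A B tr \<Longrightarrow> T \<in> basic_construction A B tr \<Longrightarrow>
     (\<lambda>b\<in>B. S b + T b) \<in> basic_construction A B tr"
| scale: "T \<in> basic_construction A B tr \<Longrightarrow>
     (\<lambda>b\<in>B. c *\<^sub>C T b) \<in> basic_construction A B tr"
| compose: "S \<in> basic_construction A B tr \<Longrightarrow> T \<in> basic_construction A B tr \<Longrightarrow>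
     compose B S T \<in> basic_construction A B tr"

definition positive_trace ::
  "'a::cstar_algebra set \<Rightarrow> 'a set \<Rightarrow> ('a \<Rightarrow> complex) \<Rightarrow> (('a \<Rightarrow> 'a) \<Rightarrow> complex) \<Rightarrow> bool" where
  "positive_trace A B tr Tr \<longleftrightarrow>
     (\<forall>S\<in>basic_construction A B tr. \<forall>T\<in>basic_construction A B tr.
        Tr (\<lambda>b\<in>B. S b + T b) = Tr S + Tr T) \<and>
     (\<forall>c. \<forall>T\<in>basic_construction A B tr. Tr (\<lambda>b\<in>B. c *\<^sub>C T b) = c * Tr T) \<and>
     (\<forall>S\<in>basic_construction A B tr. \<forall>T\<in>basic_construction A B tr.
        Tr (compose B S T) = Tr (compose B T S)) \<and>
     (\<forall>T\<in>basic_construction A B tr.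
        (\<forall>b\<in>B. tr_inner tr b (T b) \<in> \<real>\<^sub>\<ge>\<^sub>0) \<longrightarrow> Tr T \<in> \<real>\<^sub>\<ge>\<^sub>0)"

definition markov_trace ::
  "'a::cstar_algebra set \<Rightarrow> 'a set \<Rightarrow> ('a \<Rightarrow> complex) \<Rightarrow> real \<Rightarrow> bool" where
  "markov_trace A B tr \<tau> \<longleftrightarrow>
     faithful_tracial_state B tr \<and>
     (\<exists>Tr. positive_trace A B tr Tr \<and>
        (\<forall>x\<in>B. Tr (left_mult B x) = tr x) \<and>
        (\<forall>x\<in>B. Tr (compose B (left_mult B x) (jones_projection A B tr)) =
                 complex_of_real \<tau> * tr x))"

text \<open>\<open>C\<close> is a copy of \<open>\<langle>B, e\<^sub>A\<rangle>\<close> inside the ambient algebra: there is a *-isomorphism onto the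
  concrete basic construction that is left multiplication on \<open>B \<subseteq> C\<close> and maps \<open>e\<close> to \<open>e\<^sub>A\<close>.\<close>

definition is_basic_construction ::
  "'a::cstar_algebra set \<Rightarrow> 'a set \<Rightarrow> ('a \<Rightarrow> complex) \<Rightarrow> 'a \<Rightarrow> 'a set \<Rightarrow> bool" where
  "is_basic_construction A B tr e C \<longleftrightarrow>
     B \<subseteq> C \<and> e \<in> C \<and>
     (\<exists>\<phi>. bij_betw \<phi> C (basic_construction A B tr) \<and>
        (\<forall>x\<in>C. \<forall>y\<in>C. \<phi> (x + y) = (\<lambda>b\<in>B. \<phi> x b + \<phi> y b)) \<and>
        (\<forall>c. \<forall>x\<in>C. \<phi> (c *\<^sub>C x) = (\<lambda>b\<in>B. c *\<^sub>C \<phi> x b)) \<and>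
        (\<forall>x\<in>C. \<forall>y\<in>C. \<phi> (x * y) = compose B (\<phi> x) (\<phi> y)) \<and>
        (\<forall>x\<in>C. \<forall>a\<in>B. \<forall>b\<in>B. tr_inner tr (\<phi> x a) b = tr_inner tr a (\<phi> (star x) b)) \<and>
        (\<forall>x\<in>B. \<phi> x = left_mult B x) \<and>
        \<phi> e = jones_projection A B tr)"

text \<open>\<open>Ms n\<close> is \<open>M\<^sub>n\<close> for \<open>n \<ge> 0\<close>, and \<open>below N Ms n\<close> is \<open>M\<^bsub>n-1\<^esub>\<close>, where \<open>M\<^bsub>-1\<^esub> = N\<close>.
  The value \<open>e 0\<close> is not used.\<close>

definition below :: "'a set \<Rightarrow> (nat \<Rightarrow> 'a set) \<Rightarrow> nat \<Rightarrow> 'a set" where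
  "below N Ms n = (case n of 0 \<Rightarrow> N | Suc k \<Rightarrow> Ms k)"

text \<open>The trace on the union of the tower is determined by its restriction to \<open>M\<^sub>0\<close>: on
  \<open>M\<^bsub>n+1\<^esub> = \<langle>M\<^sub>n, e\<^bsub>n+1\<^esub>\<rangle>\<close> it is the Markov extension of its restriction to \<open>M\<^sub>n\<close>, which
  is the content of the last conjunct.\<close>

definition jones_tower ::
  "'a::cstar_algebra set \<Rightarrow> 'a set \<Rightarrow> ('a \<Rightarrow> complex) \<Rightarrow> real \<Rightarrow>
   (nat \<Rightarrow> 'a) \<Rightarrow> (nat \<Rightarrow> 'a set) \<Rightarrow> bool" where
  "jones_tower N M tr \<tau> e Ms \<longleftrightarrow>
     Ms 0 = M \<and>
     (\<forall>n. fd_cstar_algebra (Ms n)) \<and>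
     (\<forall>n. is_basic_construction (below N Ms n) (Ms n) tr (e (Suc n)) (Ms (Suc n))) \<and>
     faithful_tracial_state (\<Union>n. Ms n) tr \<and>
     (\<forall>n. \<forall>x\<in>Ms n. tr (x * e (Suc n)) = complex_of_real \<tau> * tr x)"

definition bounded_operators :: "('h::complex_hilbert_space \<Rightarrow> 'h) set" where
  "bounded_operators = {T. bounded_linear T \<and> (\<forall>c \<xi>. T (c *\<^sub>C \<xi>) = c *\<^sub>C T \<xi>)}"

definition adjoint_op :: "('h::complex_hilbert_space \<Rightarrow> 'h) \<Rightarrow> 'h \<Rightarrow> 'h" where
  "adjoint_op T = (THE S. \<forall>\<xi> \<eta>. cinner (T \<xi>) \<eta> = cinner \<xi> (S \<eta>))"

definition commutant :: "('h::complex_hilbert_space \<Rightarrow> 'h) set \<Rightarrow> ('h \<Rightarrow> 'h) set" where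
  "commutant X = {T \<in> bounded_operators. \<forall>S\<in>X. T \<circ> S = S \<circ> T}"

definition von_neumann_algebra :: "('h::complex_hilbert_space \<Rightarrow> 'h) set \<Rightarrow> bool" where
  "von_neumann_algebra X \<longleftrightarrow>
     X \<subseteq> bounded_operators \<and> (\<forall>T\<in>X. adjoint_op T \<in> X) \<and> commutant (commutant X) = X"

definition generated_von_neumann_algebra ::
  "('h::complex_hilbert_space \<Rightarrow> 'h) set \<Rightarrow> ('h \<Rightarrow> 'h) set" where
  "generated_von_neumann_algebra X = \<Inter>{Y. von_neumann_algebra Y \<and> X \<subseteq> Y}"

definition vn_automorphism ::
  "('h::complex_hilbert_space \<Rightarrow> 'h) set \<Rightarrow> (('h \<Rightarrow> 'h) \<Rightarrow> ('h \<Rightarrow> 'h)) \<Rightarrow> bool" where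
  "vn_automorphism X \<alpha> \<longleftrightarrow>
     bij_betw \<alpha> X X \<and>
     (\<forall>S\<in>X. \<forall>T\<in>X. \<alpha> (\<lambda>\<xi>. S \<xi> + T \<xi>) = (\<lambda>\<xi>. \<alpha> S \<xi> + \<alpha> T \<xi>)) \<and>
     (\<forall>c. \<forall>T\<in>X. \<alpha> (\<lambda>\<xi>. c *\<^sub>C T \<xi>) = (\<lambda>\<xi>. c *\<^sub>C \<alpha> T \<xi>)) \<and>
     (\<forall>S\<in>X. \<forall>T\<in>X. \<alpha> (S \<circ> T) = \<alpha> S \<circ> \<alpha> T) \<and>
     (\<forall>T\<in>X. \<alpha> (adjoint_op T) = adjoint_op (\<alpha> T))"

text \<open>These properties determine the GNS pair \<open>(\<pi>, \<Omega>)\<close> of \<open>tr\<close> up to unitary equivalence.\<close>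

definition gns_representation ::
  "'a::cstar_algebra set \<Rightarrow> ('a \<Rightarrow> complex) \<Rightarrow>
   ('a \<Rightarrow> 'h::complex_hilbert_space \<Rightarrow> 'h) \<Rightarrow> 'h \<Rightarrow> bool" where
  "gns_representation A tr \<pi> \<Omega> \<longleftrightarrow>
     (\<forall>x\<in>A. \<pi> x \<in> bounded_operators) \<and>
     (\<forall>x\<in>A. \<forall>y\<in>A. \<pi> (x + y) = (\<lambda>\<xi>. \<pi> x \<xi> + \<pi> y \<xi>)) \<and>
     (\<forall>c. \<forall>x\<in>A. \<pi> (c *\<^sub>C x) = (\<lambda>\<xi>. c *\<^sub>C \<pi> x \<xi>)) \<and>
     (\<forall>x\<in>A. \<forall>y\<in>A. \<pi> (x * y) = \<pi> x \<circ> \<pi> y) \<and>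
     (\<forall>x\<in>A. \<pi> (star x) = adjoint_op (\<pi> x)) \<and>
     \<pi> 1 = id \<and>
     closure ((\<lambda>x. \<pi> x \<Omega>) ` A) = UNIV \<and>
     (\<forall>x\<in>A. tr x = cinner \<Omega> (\<pi> x \<Omega>))"

definition vector_trace ::
  "'h::complex_hilbert_space \<Rightarrow> ('h \<Rightarrow> 'h) \<Rightarrow> complex" where
  "vector_trace \<Omega> T = cinner \<Omega> (T \<Omega>)"

text \<open>Here \<open>M\<^sub>i\<close> and \<open>e\<^sub>i\<close> are identified with their images under \<open>\<pi>\<close>. Automorphisms of \<open>R\<close> are
  not assumed to be normal.\<close>

definition extends_along_tower ::
  "('h::complex_hilbert_space \<Rightarrow> 'h) set \<Rightarrow> ('a::cstar_algebra \<Rightarrow> 'h \<Rightarrow> 'h) \<Rightarrow>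
   'a set \<Rightarrow> (nat \<Rightarrow> 'a) \<Rightarrow> (nat \<Rightarrow> 'a set) \<Rightarrow> ('a \<Rightarrow> 'a) \<Rightarrow>
   (('h \<Rightarrow> 'h) \<Rightarrow> ('h \<Rightarrow> 'h)) \<Rightarrow> bool" where
  "extends_along_tower R \<pi> M e Ms \<alpha>\<^sub>0 \<alpha> \<longleftrightarrow>
     vn_automorphism R \<alpha> \<and>
     (\<forall>i\<ge>1. \<alpha> (\<pi> (e i)) = \<pi> (e i)) \<and>
     (\<forall>i\<ge>1. \<alpha> ` (\<pi> ` Ms i) = \<pi> ` Ms i) \<and>
     (\<forall>x\<in>M. \<alpha> (\<pi> x) = \<pi> (\<alpha>\<^sub>0 x))"

end

theory Submission
  imports Defs "HOL-Computational_Algebra.Fundamental_Theorem_Algebra"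
begin

text \<open>Suppose that an automorphism of \<open>M\<^sub>n\<close> preserves the trace and the subalgebra \<open>M\<^sub>n\<^sub>-\<^sub>1\<close>. It is then a unitary on
  \<open>L\<^sup>2(M\<^sub>n, tr)\<close> that commutes with the Jones projection, and conjugation by it restricts to an automorphism of
  \<open>M\<^sub>n\<^sub>+\<^sub>1\<close> that extends the given one and fixes \<open>e\<^sub>n\<^sub>+\<^sub>1\<close> (\<open>automorphism_extends\<close>). The extension preserves the trace,
  because the elements \<open>a e\<^sub>n\<^sub>+\<^sub>1 b\<close> with \<open>a, b \<in> M\<^sub>n\<close> span \<open>M\<^sub>n\<^sub>+\<^sub>1\<close> and have trace \<open>\<tau> tr(b a)\<close>. So the extension continues along
  the tower. The resulting trace preserving automorphism of the union is implemented by a unitary on the GNS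
  space, and conjugation by this unitary is the required automorphism of \<open>R\<close>.

  The induction starts because \<open>\<alpha>\<^sub>0\<close> preserves the Markov trace (\<open>markov_trace_invariant\<close>). The trace
  \<open>\<phi> = tr \<circ> \<alpha>\<^sub>0\<close> has constant density with respect to \<open>tr\<close> at each vertex of the Bratteli diagram. At a vertex of \<open>N\<close>
  the density is a weighted mean of the densities at the adjacent vertices of \<open>M\<close>. At a vertex of \<open>M\<close> the same
  holds with \<open>N\<close> and \<open>M\<close> exchanged: the Markov property expresses \<open>tr\<close> on \<open>M\<close> through its restriction to \<open>N\<close> by a
  formula in dual bases of the \<open>N\<close>-module \<open>M\<close>, this formula does not depend on the dual bases, and so it holds for
  \<open>\<phi>\<close> as well. By the maximum principle the density is constant on the connected diagram.

  For uniqueness, two such automorphisms agree on the union of the tower, which is generated by \<open>M\<close> and the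
  Jones projections. Let \<open>\<gamma>\<close> be the inverse of one composed with the other. It fixes a dense subalgebra, and it
  is an order isomorphism, because positivity of a self-adjoint operator is an algebraic condition on its
  resolvents. An order isomorphism respects bounded monotone limits, and together with the trace this
  suffices to conclude \<open>\<gamma> = 1\<close> (\<open>automorphism_fixing_dense_is_identity\<close>).\<close>

section \<open>Unital *-subalgebras with a faithful tracial state\<close>

lemmas scaleC_simps = complex_vector.scale_right_distrib complex_vector.scale_left_distrib
  complex_vector.scale_right_diff_distrib complex_vector.scale_left_diff_distrib
  mult_scaleC_left mult_scaleC_right

lemma star_0 [simp]: "star (0::'a::cstar_algebra) = 0"
  using star_scaleC[of 0 "0::'a"] by simp

lemma star_diff [simp]: "star (x - y) = star x - star (y::'a::cstar_algebra)"
  using star_add[of "x - y" y] by (simp add: algebra_simps)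

lemma star_1 [simp]: "star (1::'a::cstar_algebra) = 1"
  by (metis mult_1 mult.right_neutral star_mult star_star)

lemma star_sum: "star (sum f S) = (\<Sum>i\<in>S. star (f i :: 'a::cstar_algebra))"
  by (induction S rule: infinite_finite_induct) (auto simp: star_add)

lemma unital_star_subalgebra_closed:
  assumes "unital_star_subalgebra A"
  shows "complex_vector.subspace A" "0 \<in> A" "1 \<in> A"
    "x \<in> A \<Longrightarrow> y \<in> A \<Longrightarrow> x * y \<in> A" "x \<in> A \<Longrightarrow> star x \<in> A"
    "x \<in> A \<Longrightarrow> y \<in> A \<Longrightarrow> x + y \<in> A" "x \<in> A \<Longrightarrow> y \<in> A \<Longrightarrow> x - y \<in> A"
    "x \<in> A \<Longrightarrow> c *\<^sub>C x \<in> A" "(\<And>i. i \<in> S \<Longrightarrow> f i \<in> A) \<Longrightarrow> sum f S \<in> A"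
  using assms unfolding unital_star_subalgebra_def
  by (auto simp: complex_vector.subspace_0 complex_vector.subspace_add
      complex_vector.subspace_diff complex_vector.subspace_scale complex_vector.subspace_sum)

lemma finite_dimensional_basis:
  fixes V S :: "'a::complex_vector set"
  assumes "finite S" "V \<subseteq> complex_vector.span S" "complex_vector.subspace V"
  obtains F where "finite F" "F \<subseteq> V" "complex_vector.span F = V"
proof -
  obtain F where F: "F \<subseteq> V" "complex_vector.independent F" "V \<subseteq> complex_vector.span F"
    using complex_vector.maximal_independent_subset by blast
  have "finite F"
    using complex_vector.independent_span_bound[OF assms(1) F(2)] F(1) assms(2) by blast
  moreover have "complex_vector.span F = V"
    using F assms(3) complex_vector.span_minimal by blast
  ultimately show thesis using that F by blast
qed

text \<open>In a finite dimensional subspace some nontrivial polynomial in \<open>k\<close> annihilates a given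
  vector; splitting off its linear factors one by one, which is possible over \<open>\<complex>\<close>, produces an
  eigenvector. The polynomial is applied to the vector through the orbit \<open>w\<close>.\<close>

lemma finite_dimensional_eigenvector:
  fixes k v :: "'a::cstar_algebra"
  assumes V: "complex_vector.subspace V" "finite S" "V \<subseteq> complex_vector.span S"
    and kV: "\<And>x. x \<in> V \<Longrightarrow> k * x \<in> V" and v: "v \<in> V" "v \<noteq> 0"
  obtains c u where "u \<in> V" "u \<noteq> 0" "k * u = c *\<^sub>C u"
proof -
  define w where "w = (\<lambda>i. k ^ i * v)"
  define ev where "ev = (\<lambda>p. \<Sum>i\<le>degree p. coeff p i *\<^sub>C w i)"
  have wV: "w i \<in> V" for i
    by (induction i) (auto simp: w_def v mult.assoc intro: kV)
  have ev_n: "ev p = (\<Sum>i\<le>n. coeff p i *\<^sub>C w i)" if "degree p \<le> n" for p n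
    unfolding ev_def using that
    by (intro sum.mono_neutral_left) (auto simp: coeff_eq_0)
  have evV: "ev p \<in> V" for p
    unfolding ev_def by (intro complex_vector.subspace_sum V complex_vector.subspace_scale wV)
  have ev_lin: "ev ([:- c, 1:] * r) = k * ev r - c *\<^sub>C ev r" for c r
  proof -
    define n where "n = degree r"
    have p: "[:- c, 1:] * r = pCons 0 r - smult c r" by simp
    have "degree ([:- c, 1:] * r) \<le> Suc n"
      unfolding n_def using degree_mult_le[of "[:- c, 1:]" r] by simp
    then have "ev ([:- c, 1:] * r) = (\<Sum>i\<le>Suc n. coeff (pCons 0 r - smult c r) i *\<^sub>C w i)"
      using ev_n p by metis
    also have "\<dots> = (\<Sum>i\<le>Suc n. coeff (pCons 0 r) i *\<^sub>C w i) - (\<Sum>i\<le>Suc n. (c * coeff r i) *\<^sub>C w i)"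
      by (simp add: scaleC_simps sum_subtractf del: sum.atMost_Suc)
    also have "(\<Sum>i\<le>Suc n. coeff (pCons 0 r) i *\<^sub>C w i) = (\<Sum>i\<le>n. coeff r i *\<^sub>C w (Suc i))"
      by (simp add: sum.atMost_Suc_shift del: sum.atMost_Suc)
    also have "\<dots> = k * ev r"
      by (simp add: ev_n[of r n] n_def sum_distrib_left w_def mult_scaleC_right mult.assoc)
    also have "(\<Sum>i\<le>Suc n. (c * coeff r i) *\<^sub>C w i) = c *\<^sub>C ev r"
      by (simp add: ev_n[of r "Suc n"] n_def complex_vector.scale_sum_right
          scaleC_simps del: sum.atMost_Suc)
    finally show ?thesis .
  qed
  have "\<exists>p. p \<noteq> 0 \<and> ev p = 0"
  proof (cases "inj_on w {..card S}")
    case True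
    have "\<not> card (w ` {..card S}) \<le> card S"
      using True by (simp add: card_image)
    then have "complex_vector.dependent (w ` {..card S})"
      using complex_vector.independent_span_bound[OF V(2)] V(3) wV by blast
    then obtain u where u: "\<exists>x\<in>w ` {..card S}. u x \<noteq> 0" "(\<Sum>x\<in>w ` {..card S}. u x *\<^sub>C x) = 0"
      by (subst (asm) complex_vector.dependent_finite) auto
    define p where "p = (\<Sum>i\<le>card S. monom (u (w i)) i)"
    have cp: "coeff p i = (if i \<le> card S then u (w i) else 0)" for i
      unfolding p_def by (simp add: coeff_sum)
    have "degree p \<le> card S" by (rule degree_le) (simp add: cp)
    then have "ev p = (\<Sum>i\<le>card S. u (w i) *\<^sub>C w i)"
      using ev_n by (simp add: cp)
    also have "\<dots> = 0"
      using u(2) True by (simp add: sum.reindex)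
    finally have "ev p = 0" .
    moreover have "p \<noteq> 0" using u(1) cp by (auto simp: poly_eq_iff)
    ultimately show ?thesis by blast
  next
    case False
    then obtain i j where ij: "i \<noteq> j" "w i = w j" by (auto simp: inj_on_def)
    define p :: "complex poly" where "p = monom 1 i - monom 1 j"
    have cp: "coeff p l = (if l = i then 1 else if l = j then -1 else 0)" for l
      using ij by (auto simp: p_def)
    have "degree p \<le> max i j" by (rule degree_le) (auto simp: cp)
    then have "ev p = (\<Sum>l\<le>max i j. (if l = i then w i else 0) - (if l = j then w j else 0))"
      using ev_n ij by (auto simp: cp intro!: sum.cong)
    also have "\<dots> = 0" using ij by (simp add: sum_subtractf)
    finally have "ev p = 0" .
    moreover have "p \<noteq> 0" using cp[of i] by auto
    ultimately show ?thesis by blast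
  qed
  then obtain p where p: "p \<noteq> 0" "ev p = 0" by blast
  have "\<exists>c u. u \<in> V \<and> u \<noteq> 0 \<and> k * u = c *\<^sub>C u"
    using p
  proof (induction "degree p" arbitrary: p rule: less_induct)
    case less
    have "degree p \<noteq> 0"
    proof
      assume d: "degree p = 0"
      then have "ev p = coeff p 0 *\<^sub>C v" by (simp add: ev_def w_def)
      moreover have "coeff p 0 \<noteq> 0" using d less.prems(1) by (metis leading_coeff_0_iff)
      ultimately show False using v less.prems(2) by simp
    qed
    then have "\<not> constant (poly p)" by (simp add: constant_degree)
    then obtain c where "poly p c = 0" using fundamental_theorem_of_algebra by blast
    then obtain r where r: "p = [:- c, 1:] * r" by (metis poly_eq_0_iff_dvd dvdE)
    have r0: "r \<noteq> 0" using r less.prems by auto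
    have "degree p = degree [:- c, 1:] + degree r"
      unfolding r using r0 by (intro degree_mult_eq) auto
    then have d: "degree r < degree p" by simp
    show ?case
    proof (cases "ev r = 0")
      case True
      then show ?thesis using less.hyps d r0 by blast
    next
      case False
      have "k * ev r = c *\<^sub>C ev r" using ev_lin[of c r] r less.prems by simp
      then show ?thesis using False evV by blast
    qed
  qed
  then show thesis using that by blast
qed

locale tracial_algebra =
  fixes A :: "'a::cstar_algebra set" and tr :: "'a \<Rightarrow> complex"
  assumes subalgebra: "unital_star_subalgebra A"
    and trace: "faithful_tracial_state A tr"
begin

lemmas closed = unital_star_subalgebra_closed[OF subalgebra]

lemma tr_add: "x \<in> A \<Longrightarrow> y \<in> A \<Longrightarrow> tr (x + y) = tr x + tr y"
  and tr_scale: "x \<in> A \<Longrightarrow> tr (c *\<^sub>C x) = c * tr x"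
  and tr_pos: "x \<in> A \<Longrightarrow> tr (star x * x) \<in> \<real>\<^sub>\<ge>\<^sub>0"
  and tr_1: "tr 1 = 1"
  and tr_comm: "x \<in> A \<Longrightarrow> y \<in> A \<Longrightarrow> tr (x * y) = tr (y * x)"
  and tr_faithful: "x \<in> A \<Longrightarrow> tr (star x * x) = 0 \<Longrightarrow> x = 0"
  using trace unfolding faithful_tracial_state_def by auto

lemma tr_0 [simp]: "tr 0 = 0"
  using tr_scale[of 0 0] closed by simp

lemma tr_diff: "x \<in> A \<Longrightarrow> y \<in> A \<Longrightarrow> tr (x - y) = tr x - tr y"
  using tr_add[of "x - y" y] closed by simp

lemma tr_sum: "(\<And>i. i \<in> S \<Longrightarrow> f i \<in> A) \<Longrightarrow> tr (sum f S) = (\<Sum>i\<in>S. tr (f i))"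
  by (induction S rule: infinite_finite_induct) (auto simp: tr_add closed)

text \<open>Polarization: \<open>tr\<close> is real on \<open>(1 + x)\<^sup>* (1 + x)\<close> and on \<open>(1 + i x)\<^sup>* (1 + i x)\<close>.\<close>

lemma tr_star:
  assumes x: "x \<in> A"
  shows "tr (star x) = cnj (tr x)"
proof -
  have real: "Im (tr (star y * y)) = 0" if "y \<in> A" for y
    using tr_pos[OF that] by (auto simp: complex_nonneg_Reals_iff)
  have exp: "star (1 + c *\<^sub>C x) * (1 + c *\<^sub>C x)
      = 1 + c *\<^sub>C x + (cnj c *\<^sub>C star x + (cnj c * c) *\<^sub>C (star x * x))" for c
    by (simp add: star_add star_scaleC scaleC_simps algebra_simps)
  have "tr (star (1 + c *\<^sub>C x) * (1 + c *\<^sub>C x))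
      = 1 + c * tr x + (cnj c * tr (star x) + (cnj c * c) * tr (star x * x))" for c
    unfolding exp by (simp add: tr_add tr_scale closed(3-6,8) x tr_1)
  then have *: "Im (1 + c * tr x + (cnj c * tr (star x) + (cnj c * c) * tr (star x * x))) = 0" for c
    using real[OF closed(6)[OF closed(3) closed(8)[OF x]], of c] by simp
  show ?thesis
    using *[of 1] *[of \<i>] real[OF x] by (auto simp: complex_eq_iff)
qed

lemma nondegenerate:
  assumes "x \<in> A" "\<And>y. y \<in> A \<Longrightarrow> tr (y * x) = 0"
  shows "x = 0"
  using assms(2)[OF closed(5)[OF assms(1)]] assms(1) tr_faithful by blast

lemma tracial_algebra_subset:
  assumes "unital_star_subalgebra B" "B \<subseteq> A"
  shows "tracial_algebra B tr"
  using assms trace unfolding tracial_algebra_def faithful_tracial_state_def subset_iff by simp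

lemma orthogonal_projection:
  assumes V: "complex_vector.subspace V" "finite S" "V \<subseteq> complex_vector.span S" "V \<subseteq> A"
    and x: "x \<in> A"
  obtains v where "v \<in> V" "\<And>c. c \<in> V \<Longrightarrow> tr (star c * (x - v)) = 0"
proof -
  obtain F where F: "finite F" "F \<subseteq> V" "complex_vector.span F = V"
    using finite_dimensional_basis V by metis
  have "\<forall>x\<in>A. \<exists>v\<in>complex_vector.span F. \<forall>c\<in>complex_vector.span F. tr (star c * (x - v)) = 0"
    if "finite F" "F \<subseteq> A" for F
    using that
  proof (induction F)
    case empty
    then show ?case by simp
  next
    case (insert f F)
    have sub: "complex_vector.span F \<subseteq> A"
      using insert.prems complex_vector.span_minimal closed(1) by blast
    obtain g where g: "g \<in> complex_vector.span F"
        "\<forall>c\<in>complex_vector.span F. tr (star c * (f - g)) = 0"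
      using insert by blast
    define h where "h = f - g"
    have hA: "h \<in> A" unfolding h_def using insert.prems g(1) sub by (intro closed(7)) auto
    have h_perp: "tr (star c * h) = 0" if "c \<in> complex_vector.span F" for c
      using g(2) that h_def by simp
    have span: "\<exists>c k. y = c + k *\<^sub>C h \<and> c \<in> complex_vector.span F"
      if "y \<in> complex_vector.span (insert f F)" for y
    proof -
      obtain k where "y - k *\<^sub>C f \<in> complex_vector.span F"
        using \<open>y \<in> _\<close> complex_vector.span_breakdown_eq by blast
      then have "y - k *\<^sub>C f + k *\<^sub>C g \<in> complex_vector.span F"
        using g by (intro complex_vector.span_add complex_vector.span_scale)
      moreover have "y = (y - k *\<^sub>C f + k *\<^sub>C g) + k *\<^sub>C h"
        by (simp add: h_def scaleC_simps)
      ultimately show ?thesis by blast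
    qed
    have h_in: "h \<in> complex_vector.span (insert f F)"
      unfolding h_def using g(1)
      by (meson complex_vector.span_base complex_vector.span_diff complex_vector.span_mono
          insertI1 subset_insertI subsetD)
    show ?case
    proof
      fix x assume x: "x \<in> A"
      obtain v where v: "v \<in> complex_vector.span F"
          "\<forall>c\<in>complex_vector.span F. tr (star c * (x - v)) = 0"
        using insert x by blast
      \<comment> \<open>If \<open>f\<close> already lies in the span of \<open>F\<close>, then \<open>h = 0\<close> and the quotient is \<open>0 / 0 = 0\<close>.\<close>
      define k where "k = tr (star h * (x - v)) / tr (star h * h)"
      have vA: "v \<in> A" using v sub by blast
      have kh: "k * tr (star h * h) = tr (star h * (x - v))"
      proof (cases "tr (star h * h) = 0")
        case True
        then have "h = 0" using hA tr_faithful by blast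
        then show ?thesis by simp
      qed (simp add: k_def)
      have "tr (star (c + l *\<^sub>C h) * (x - (v + k *\<^sub>C h))) = 0" if c: "c \<in> complex_vector.span F" for c l
      proof -
        have cA: "c \<in> A" using c sub by blast
        have "star (c + l *\<^sub>C h) * (x - (v + k *\<^sub>C h)) =
            (star c * (x - v) - k *\<^sub>C (star c * h))
            + cnj l *\<^sub>C (star h * (x - v) - k *\<^sub>C (star h * h))"
          by (simp add: star_add star_scaleC scaleC_simps ring_distribs)
        moreover have "star c * (x - v) \<in> A" "star c * h \<in> A" "star h * (x - v) \<in> A" "star h * h \<in> A"
          using cA hA x vA by (simp_all add: closed(4,5,7))
        ultimately show ?thesis
          using v(2) c h_perp kh by (simp add: tr_add tr_diff tr_scale closed)
      qed
      then have "\<forall>y\<in>complex_vector.span (insert f F). tr (star y * (x - (v + k *\<^sub>C h))) = 0"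
        using span by metis
      moreover have "v + k *\<^sub>C h \<in> complex_vector.span (insert f F)"
        using v(1) h_in by (meson complex_vector.span_add complex_vector.span_mono
            complex_vector.span_scale subset_insertI subsetD)
      ultimately show "\<exists>v\<in>complex_vector.span (insert f F).
          \<forall>c\<in>complex_vector.span (insert f F). tr (star c * (x - v)) = 0" by blast
    qed
  qed
  from this[OF F(1)] F V(4) x obtain v
    where "v \<in> V" "\<forall>c\<in>V. tr (star c * (x - v)) = 0" by blast
  then show thesis using that by blast
qed

text \<open>The unit of an ideal is the orthogonal projection \<open>u\<close> of \<open>1\<close> onto it: for \<open>a\<close> in the ideal,
  \<open>a (1 - u)\<close> is again in the ideal and is orthogonal to it, hence zero.\<close>

lemma ideal_has_unit:
  assumes I: "complex_vector.subspace I" "finite S" "I \<subseteq> complex_vector.span S" "I \<subseteq> A"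
    and ideal: "\<And>x a. x \<in> A \<Longrightarrow> a \<in> I \<Longrightarrow> x * a \<in> I" and star: "\<And>a. a \<in> I \<Longrightarrow> star a \<in> I"
  obtains u where "u \<in> I" "is_projection u" "\<And>a. a \<in> I \<Longrightarrow> a * u = a" "\<And>a. a \<in> I \<Longrightarrow> u * a = a"
proof -
  obtain u where u: "u \<in> I" "\<And>c. c \<in> I \<Longrightarrow> tr (star c * (1 - u)) = 0"
    using orthogonal_projection[OF I] closed by metis
  have uA: "u \<in> A" using u I by blast
  have right: "a * u = a" if a: "a \<in> I" for a
  proof -
    define b where "b = a * (1 - u)"
    have aA: "a \<in> A" using a I by blast
    have bA: "b \<in> A" unfolding b_def using aA uA by (simp add: closed(3,4,7))
    have "star (star a * b) \<in> I"
      using ideal[OF closed(5)[OF bA] a] by (simp add: star_mult star_star)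
    then have "star a * b \<in> I" using star[of "star (star a * b)"] by (simp add: star_star)
    then have "tr (star (star a * b) * (1 - u)) = 0" by (rule u(2))
    then have "tr (star b * b) = 0" by (simp add: b_def star_mult star_star mult.assoc)
    then have "b = 0" using tr_faithful bA by blast
    then show ?thesis by (simp add: b_def algebra_simps)
  qed
  have left: "star u * a = a" if "a \<in> I" for a
    using arg_cong[OF right[OF star[OF that]], of star] by (simp add: star_mult star_star)
  have "star u * u = star u" using right star u(1) by blast
  then have su: "star u = u" using left[OF u(1)] by metis
  show thesis
  proof (rule that[of u])
    show "is_projection u" using right[OF u(1)] su by (simp add: is_projection_def)
    show "u \<in> I" by (rule u(1))
    show "a * u = a" if "a \<in> I" for a using right[OF that] .
    show "u * a = a" if "a \<in> I" for a using left[OF that] unfolding su .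
  qed
qed

end

section \<open>Minimal central projections\<close>

lemma center_iff: "z \<in> center A \<longleftrightarrow> z \<in> A \<and> (\<forall>x\<in>A. z * x = x * z)"
  by (simp add: center_def)

lemma unital_star_subalgebra_center:
  assumes "unital_star_subalgebra A"
  shows "unital_star_subalgebra (center A)"
proof -
  note A = unital_star_subalgebra_closed[OF assms]
  have comm: "z * x = x * z" if "z \<in> center A" "x \<in> A" for z x
    using that by (simp add: center_iff)
  have sub: "z \<in> A" if "z \<in> center A" for z
    using that by (simp add: center_iff)
  have "star z \<in> center A" if z: "z \<in> center A" for z
    unfolding center_iff
  proof (intro conjI ballI)
    show "star z \<in> A" using A(5) sub z by blast
    fix x assume "x \<in> A"
    then have "star (z * star x) = star (star x * z)" using comm[OF z A(5)] by simp
    then show "star z * x = x * star z" by (simp add: star_mult star_star)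
  qed
  moreover have "x * y \<in> center A" if xy: "x \<in> center A" "y \<in> center A" for x y
    unfolding center_iff
  proof (intro conjI ballI)
    show "x * y \<in> A" using A(4) sub xy by blast
    fix z assume "z \<in> A"
    then have "y * z = z * y" "x * z = z * x" using comm xy by auto
    then show "x * y * z = z * (x * y)" by (metis (no_types) mult.assoc)
  qed
  moreover have "x + y \<in> center A" if xy: "x \<in> center A" "y \<in> center A" for x y
    unfolding center_iff
  proof (intro conjI ballI)
    show "x + y \<in> A" using A(6) sub xy by blast
    show "(x + y) * z = z * (x + y)" if "z \<in> A" for z
      unfolding ring_distribs comm[OF xy(1) that] comm[OF xy(2) that] ..
  qed
  moreover have "c *\<^sub>C x \<in> center A" if x: "x \<in> center A" for c x
    unfolding center_iff
  proof (intro conjI ballI)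
    show "c *\<^sub>C x \<in> A" using A(8) sub x by blast
    show "(c *\<^sub>C x) * z = z * (c *\<^sub>C x)" if "z \<in> A" for z
      unfolding scaleC_simps comm[OF x that] ..
  qed
  moreover have "0 \<in> center A" "1 \<in> center A" using A(2,3) by (simp_all add: center_iff)
  ultimately show ?thesis
    unfolding unital_star_subalgebra_def complex_vector.subspace_def by (intro conjI ballI allI)
qed

lemma dim_strict_mono:
  fixes V W :: "'a::complex_vector set"
  assumes "finite S" "W \<subseteq> complex_vector.span S"
    and "complex_vector.subspace V" "V \<subseteq> W" "x \<in> W" "x \<notin> V"
  shows "complex_vector.dim V < complex_vector.dim W"
proof -
  obtain F where F: "F \<subseteq> V" "complex_vector.independent F" "V \<subseteq> complex_vector.span F"
      "card F = complex_vector.dim V"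
    using complex_vector.basis_exists by blast
  obtain G where G: "G \<subseteq> W" "complex_vector.independent G" "W \<subseteq> complex_vector.span G"
      "card G = complex_vector.dim W"
    using complex_vector.basis_exists by blast
  have fin: "finite F" "finite G"
    using complex_vector.independent_span_bound[OF assms(1) F(2)]
      complex_vector.independent_span_bound[OF assms(1) G(2)] F(1) G(1) assms(2,4) by blast+
  have "x \<notin> complex_vector.span F"
    using complex_vector.span_minimal[OF F(1) assms(3)] assms(6) by blast
  then have "complex_vector.independent (insert x F)"
    using F(2) by (simp add: complex_vector.independent_insertI)
  then have "card (insert x F) \<le> card G"
    using complex_vector.independent_span_bound[OF fin(2)] F(1) assms(4,5) G(3) by blast
  moreover have "x \<notin> F" using F(1) assms(6) by blast
  ultimately show ?thesis using F(4) G(4) fin(1) by simp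
qed

locale fd_tracial_algebra = tracial_algebra +
  assumes fd: "fd_cstar_algebra A"
begin

lemma fd_spanning: obtains S where "finite S" "A \<subseteq> complex_vector.span S"
  using fd unfolding fd_cstar_algebra_def by blast

lemma center_sub: "center A \<subseteq> A"
  by (auto simp: center_def)

lemma center_comm: "z \<in> center A \<Longrightarrow> x \<in> A \<Longrightarrow> z * x = x * z"
  by (auto simp: center_def)

sublocale Z: tracial_algebra "center A" tr
  by (rule tracial_algebra_subset[OF unital_star_subalgebra_center[OF subalgebra] center_sub])

lemma central_ideal_has_unit:
  assumes "complex_vector.subspace I" "I \<subseteq> center A"
    and "\<And>x a. x \<in> center A \<Longrightarrow> a \<in> I \<Longrightarrow> x * a \<in> I" and "\<And>a. a \<in> I \<Longrightarrow> star a \<in> I"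
  obtains u where "u \<in> I" "is_projection u" "\<And>a. a \<in> I \<Longrightarrow> a * u = a"
proof -
  obtain S where S: "finite S" "A \<subseteq> complex_vector.span S" by (rule fd_spanning)
  have "I \<subseteq> complex_vector.span S" using S(2) assms(2) center_sub by blast
  from Z.ideal_has_unit[OF assms(1) S(1) this assms(2-4)] show thesis using that by metis
qed

abbreviation mcp where "mcp \<equiv> minimal_central_projections A"

lemma mcpD:
  assumes "q \<in> mcp"
  shows "q \<in> center A" "q \<in> A" "q * q = q" "star q = q" "q \<noteq> 0" "is_projection q"
    "p \<in> center A \<Longrightarrow> is_projection p \<Longrightarrow> p * q = p \<Longrightarrow> p = 0 \<or> p = q"
  using assms center_sub unfolding minimal_central_projections_def is_projection_def by auto

lemma central_projection_mult:
  assumes "p \<in> center A" "q \<in> center A" "is_projection p" "is_projection q"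
  shows "is_projection (p * q)"
proof -
  have pq: "p * q = q * p" using center_comm assms(1,2) center_sub by blast
  have "p * q * (p * q) = p * (q * p) * q" by (simp add: mult.assoc)
  also have "\<dots> = (p * p) * (q * q)" by (simp add: pq[symmetric] mult.assoc)
  also have "\<dots> = p * q" using assms by (simp add: is_projection_def)
  finally show ?thesis using assms pq by (simp add: is_projection_def star_mult)
qed

lemma mcp_orthogonal:
  assumes "p \<in> mcp" "q \<in> mcp" "p \<noteq> q"
  shows "p * q = 0"
proof -
  note p = mcpD[OF assms(1)] and q = mcpD[OF assms(2)]
  have pq: "p * q \<in> center A" "is_projection (p * q)" "p * q = q * p"
    using Z.closed(4) central_projection_mult center_comm p q by auto
  have "p * q * q = p * q" using q by (simp add: mult.assoc)
  then have "p * q = 0 \<or> p * q = q" using q(7) pq by simp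
  moreover have "q * p * p = q * p" using p by (simp add: mult.assoc)
  then have "p * q * p = p * q" unfolding pq(3) .
  then have "p * q = 0 \<or> p * q = p" using p(7) pq by simp
  ultimately show ?thesis using assms(3) by auto
qed

text \<open>Descent on the dimension of the corner \<open>Z(A) z\<close>: a nonminimal \<open>z\<close> dominates a central projection
  with a strictly smaller corner.\<close>

lemma mcp_below:
  assumes "z \<in> center A" "is_projection z" "z \<noteq> 0"
  shows "\<exists>q\<in>mcp. q * z = q"
  using assms
proof (induction "complex_vector.dim ((\<lambda>x. x * z) ` center A)" arbitrary: z rule: less_induct)
  case less
  show ?case
  proof (cases "z \<in> mcp")
    case True
    then show ?thesis using mcpD by blast
  next
    case False
    then obtain q where q: "q \<in> center A" "is_projection q" "q * z = q" "q \<noteq> 0" "q \<noteq> z"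
      using less.prems unfolding minimal_central_projections_def by blast
    obtain S where S: "finite S" "A \<subseteq> complex_vector.span S" by (rule fd_spanning)
    have zq: "z * q = q" using q(1,3) less.prems(1) center_comm center_sub by auto
    have sub: "complex_vector.subspace ((\<lambda>x. x * q) ` center A)"
    proof (rule complex_vector.subspaceI)
      show "0 \<in> (\<lambda>x. x * q) ` center A" using Z.closed(2) by force
      show "x + y \<in> (\<lambda>x. x * q) ` center A"
        if "x \<in> (\<lambda>x. x * q) ` center A" "y \<in> (\<lambda>x. x * q) ` center A" for x y
        using that Z.closed(6) by (auto simp: ring_distribs[symmetric])
      show "c *\<^sub>C x \<in> (\<lambda>x. x * q) ` center A" if "x \<in> (\<lambda>x. x * q) ` center A" for c x
        using that Z.closed(8) by (auto simp: mult_scaleC_left[symmetric])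
    qed
    have "complex_vector.dim ((\<lambda>x. x * q) ` center A) < complex_vector.dim ((\<lambda>x. x * z) ` center A)"
    proof (rule dim_strict_mono[OF S(1) _ sub])
      show "(\<lambda>x. x * z) ` center A \<subseteq> complex_vector.span S"
        using Z.closed(4) less.prems(1) S(2) center_sub by blast
      show "(\<lambda>x. x * q) ` center A \<subseteq> (\<lambda>x. x * z) ` center A"
      proof
        fix y assume "y \<in> (\<lambda>x. x * q) ` center A"
        then obtain x where "x \<in> center A" "y = x * q" by blast
        then have "y = (x * q) * z" "x * q \<in> center A"
          using q(1,3) Z.closed(4) by (auto simp: mult.assoc)
        then show "y \<in> (\<lambda>x. x * z) ` center A" by blast
      qed
      show "z \<in> (\<lambda>x. x * z) ` center A" using Z.closed(3) by force
      show "z \<notin> (\<lambda>x. x * q) ` center A"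
      proof
        assume "z \<in> (\<lambda>x. x * q) ` center A"
        then obtain x where "z = x * q" by blast
        then have "z * q = z" using q(2) by (simp add: is_projection_def mult.assoc)
        then show False using zq q(5) by simp
      qed
    qed
    then obtain r where "r \<in> mcp" "r * q = r" using less.hyps q by blast
    moreover have "r * z = r"
      using \<open>r * q = r\<close> q(3) by (metis (no_types) mult.assoc)
    ultimately show ?thesis by blast
  qed
qed

text \<open>Nonzero orthogonal projections are linearly independent.\<close>

lemma finite_mcp: "finite mcp"
proof -
  obtain S where S: "finite S" "A \<subseteq> complex_vector.span S" by (rule fd_spanning)
  have "complex_vector.independent mcp"
    unfolding complex_vector.independent_explicit_finite_subsets
  proof (intro allI impI ballI)
    fix F u q assume F: "F \<subseteq> mcp" "finite F" "(\<Sum>v\<in>F. u v *\<^sub>C v) = 0" and q: "q \<in> F"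
    have "0 = (\<Sum>v\<in>F. u v *\<^sub>C v) * q" using F(3) by simp
    also have "\<dots> = (\<Sum>v\<in>F. if v = q then u q *\<^sub>C q else 0)"
      unfolding sum_distrib_right mult_scaleC_left
    proof (intro sum.cong refl)
      fix v assume "v \<in> F"
      then show "u v *\<^sub>C (v * q) = (if v = q then u q *\<^sub>C q else 0)"
        using F(1) q mcp_orthogonal[of v q] mcpD(3)[of q] by auto
    qed
    also have "\<dots> = u q *\<^sub>C q" using q F(2) by simp
    finally show "u q = 0" using mcpD(5) F(1) q by auto
  qed
  then show ?thesis
    using complex_vector.independent_span_bound[OF S(1)] S(2) mcpD(2) by blast
qed

text \<open>Otherwise the complement of the sum would dominate one more minimal central projection.\<close>

lemma sum_mcp: "\<Sum>mcp = 1"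
proof (rule ccontr)
  assume ne: "\<Sum>mcp \<noteq> 1"
  define z where "z = 1 - \<Sum>mcp"
  have sum_q: "\<Sum>mcp * q = q" if "q \<in> mcp" for q
  proof -
    have "\<Sum>mcp * q = (\<Sum>p\<in>mcp. if p = q then q else 0)"
      unfolding sum_distrib_right using that mcp_orthogonal mcpD(3) by (intro sum.cong) auto
    then show ?thesis using that finite_mcp by simp
  qed
  then have zq: "z * q = 0" if "q \<in> mcp" for q
    using that by (simp add: z_def ring_distribs)
  have zA: "z \<in> center A"
    unfolding z_def using mcpD(1) by (intro Z.closed(7,3,9)) auto
  have "\<Sum>mcp * \<Sum>mcp = \<Sum>mcp"
    using sum_q by (simp add: sum_distrib_left)
  moreover have "star (\<Sum>mcp) = \<Sum>mcp" using mcpD(4) by (simp add: star_sum)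
  ultimately have "is_projection z"
    by (simp add: is_projection_def z_def ring_distribs)
  then obtain q where q: "q \<in> mcp" "q * z = q"
    using mcp_below[OF zA] ne z_def by auto
  then have "q = 0" using zq center_comm[OF zA mcpD(2)] by metis
  then show False using mcpD(5) q by blast
qed

text \<open>The eigenspace of \<open>k\<close> in \<open>Z(A) q\<close> is an ideal of \<open>Z(A)\<close>; by minimality its unit is \<open>q\<close>.\<close>

lemma central_mult_mcp:
  assumes k: "k \<in> center A" and q: "q \<in> mcp"
  obtains c where "k * q = c *\<^sub>C q"
proof -
  note qD = mcpD[OF q]
  obtain S where S: "finite S" "A \<subseteq> complex_vector.span S" by (rule fd_spanning)
  define V where "V = {x \<in> center A. x * q = x}"
  have V: "complex_vector.subspace V"
    unfolding V_def complex_vector.subspace_def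
    by (auto simp: Z.closed(2,6,8) ring_distribs scaleC_simps)
  have kV: "k * x \<in> V" if "x \<in> V" for x
    using that k Z.closed(4) by (auto simp: V_def mult.assoc)
  have "q \<in> V" using qD by (simp add: V_def)
  then obtain c v where v: "v \<in> V" "v \<noteq> 0" "k * v = c *\<^sub>C v"
    using finite_dimensional_eigenvector[OF V S(1) _ kV] S(2) center_sub qD(5)
    unfolding V_def by (metis (no_types, lifting) mem_Collect_eq subset_iff)
  define I where "I = {x \<in> V. k * x = c *\<^sub>C x}"
  have I_sub: "I \<subseteq> center A" unfolding I_def V_def by auto
  have I: "complex_vector.subspace I"
    using V unfolding I_def complex_vector.subspace_def
    by (auto simp: scaleC_simps ring_distribs complex_vector.scale_left_commute)
  have I_ideal: "x * a \<in> I" if x: "x \<in> center A" and a: "a \<in> I" for x a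
  proof -
    have kx: "k * x = x * k" using center_comm k x center_sub by blast
    have "k * (x * a) = x * (k * a)" by (simp add: kx mult.assoc[symmetric])
    then show ?thesis
      using a x Z.closed(4) unfolding I_def V_def by (auto simp: mult.assoc scaleC_simps)
  qed
  have "star a \<in> I" if a: "a \<in> I" for a
  proof -
    \<comment> \<open>The eigenvalue of \<open>a\<^sup>*\<close> is again \<open>c\<close>: the difference \<open>b\<close> satisfies \<open>b a = 0\<close>, hence \<open>b\<^sup>* b = 0\<close>.\<close>
    have aD: "a \<in> center A" "a * q = a" "k * a = c *\<^sub>C a" using a by (auto simp: I_def V_def)
    have sa: "star a \<in> center A" using aD Z.closed(5) by blast
    define b where "b = k * star a - c *\<^sub>C star a"
    have b: "b \<in> center A" unfolding b_def using sa k by (intro Z.closed(4,7,8))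
    have "b * a = 0"
    proof -
      have "star a * a = a * star a" using center_comm sa aD(1) center_sub by blast
      then have "b * a = k * a * star a - c *\<^sub>C (a * star a)"
        unfolding b_def by (simp add: ring_distribs scaleC_simps mult.assoc)
      then show ?thesis by (simp add: aD(3) scaleC_simps)
    qed
    moreover have "star b * b = star k * (b * a) - cnj c *\<^sub>C (b * a)"
    proof -
      have "star b = a * star k - cnj c *\<^sub>C a"
        by (simp add: b_def star_mult star_star star_scaleC)
      moreover have "a * star k = star k * a" "a * b = b * a"
        using center_comm aD(1) b center_sub Z.closed(5)[OF k] by blast+
      ultimately show ?thesis by (simp add: ring_distribs scaleC_simps mult.assoc)
    qed
    ultimately have "star b * b = 0" by simp
    then have "b = 0" using Z.tr_faithful[OF b] by simp
    moreover have "star a * q = star a"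
    proof -
      have "star a * q = q * star a" using center_comm[OF sa qD(2)] .
      also have "\<dots> = star (a * q)" by (simp add: star_mult qD(4))
      finally show ?thesis by (simp add: aD(2))
    qed
    ultimately show ?thesis using sa by (simp add: I_def V_def b_def)
  qed
  then obtain u where u: "u \<in> I" "is_projection u" "\<And>a. a \<in> I \<Longrightarrow> a * u = a"
    using central_ideal_has_unit[OF I I_sub I_ideal] by blast
  have "u \<noteq> 0" using u(3)[of v] v by (auto simp: I_def)
  then have "u = q" using qD(7) u unfolding I_def V_def by auto
  then show thesis using u(1) that unfolding I_def by auto
qed

text \<open>The density is a multiple of the adjoint of a vector orthogonal to the kernel of \<open>\<phi>\<close>.\<close>

lemma riesz:
  assumes add: "\<And>x y. x \<in> A \<Longrightarrow> y \<in> A \<Longrightarrow> \<phi> (x + y) = \<phi> x + \<phi> y"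
    and scale: "\<And>c x. x \<in> A \<Longrightarrow> \<phi> (c *\<^sub>C x) = c * \<phi> x"
  obtains h where "h \<in> A" "\<And>x. x \<in> A \<Longrightarrow> \<phi> x = tr (h * x)"
proof (cases "\<forall>x\<in>A. \<phi> x = 0")
  case True
  then show thesis using that[of 0] closed(2) by simp
next
  case False
  then obtain x where x: "x \<in> A" "\<phi> x \<noteq> 0" by blast
  obtain S where S: "finite S" "A \<subseteq> complex_vector.span S" by (rule fd_spanning)
  define V where "V = {x \<in> A. \<phi> x = 0}"
  have "complex_vector.subspace V"
    unfolding V_def complex_vector.subspace_def
    using scale[OF closed(2), of 0] by (auto simp: add scale closed(2,6,8))
  then obtain v where v: "v \<in> V" "\<And>c. c \<in> V \<Longrightarrow> tr (star c * (x - v)) = 0"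
    using orthogonal_projection[OF _ S(1) _ _ x(1), of V] S(2) unfolding V_def
    by (metis (no_types, lifting) mem_Collect_eq subset_iff)
  define w where "w = x - v"
  have w: "w \<in> A" using closed(7) x v(1) by (auto simp: w_def V_def)
  have diff: "\<phi> (a - b) = \<phi> a - \<phi> b" if "a \<in> A" "b \<in> A" for a b
    using add[of "a - b" b] that closed(7) by simp
  have pw: "\<phi> w = \<phi> x" using v(1) x(1) diff by (auto simp: w_def V_def)
  have ww: "tr (star w * w) \<noteq> 0"
  proof
    assume "tr (star w * w) = 0"
    then have "w = 0" using w tr_faithful by blast
    then show False using pw x(2) scale[OF closed(2), of 0] by simp
  qed
  have "\<phi> y = tr (((\<phi> w / tr (star w * w)) *\<^sub>C star w) * y)" if y: "y \<in> A" for y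
  proof -
    define k where "k = \<phi> y / \<phi> w"
    have "y - k *\<^sub>C w \<in> V"
      using y w closed(7,8) x(2) by (simp add: V_def diff scale k_def pw)
    then have "tr (star (y - k *\<^sub>C w) * w) = 0" using v(2) w_def by blast
    then have "tr (star (star (y - k *\<^sub>C w) * w)) = 0"
      using tr_star w y closed(4,5,7,8) by simp
    then have "tr (star w * y - k *\<^sub>C (star w * w)) = 0"
      by (simp add: star_mult star_star star_scaleC scaleC_simps ring_distribs)
    then have "tr (star w * y) = k * tr (star w * w)"
      using w y closed(4,5,8) by (simp add: tr_diff tr_scale)
    then show ?thesis
      using ww w y x(2) closed(4,5) by (simp add: mult_scaleC_left tr_scale k_def pw)
  qed
  then show thesis using that[of "(\<phi> w / tr (star w * w)) *\<^sub>C star w"] w closed(5,8) by blast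
qed

text \<open>The density of a trace with respect to \<open>tr\<close> is central, hence scalar under \<open>q\<close>.\<close>

lemma trace_proportional:
  assumes add: "\<And>x y. x \<in> A \<Longrightarrow> y \<in> A \<Longrightarrow> \<phi> (x + y) = \<phi> x + \<phi> y"
    and scale: "\<And>c x. x \<in> A \<Longrightarrow> \<phi> (c *\<^sub>C x) = c * \<phi> x"
    and comm: "\<And>x y. x \<in> A \<Longrightarrow> y \<in> A \<Longrightarrow> \<phi> (x * y) = \<phi> (y * x)"
    and q: "q \<in> mcp"
  obtains c where "\<And>x. x \<in> A \<Longrightarrow> \<phi> (x * q) = c * tr (x * q)"
proof -
  obtain h where h: "h \<in> A" "\<And>x. x \<in> A \<Longrightarrow> \<phi> x = tr (h * x)"
    using riesz[OF add scale] by blast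
  have "h * x = x * h" if x: "x \<in> A" for x
  proof -
    have "tr (y * (h * x - x * h)) = 0" if y: "y \<in> A" for y
    proof -
      have "tr (y * (h * x)) = tr (h * (x * y))"
        using tr_comm[of y "h * x"] x y h(1) closed(4) by (simp add: mult.assoc)
      also have "\<dots> = tr (h * (y * x))" using comm[OF x y] h(2) x y closed(4) by simp
      also have "\<dots> = tr (y * (x * h))"
        using tr_comm[of h "y * x"] x y h(1) closed(4) by (simp add: mult.assoc)
      finally show ?thesis using x y h(1) closed(4,7) by (simp add: ring_distribs tr_diff)
    qed
    moreover have "h * x - x * h \<in> A" using x h(1) closed(4,7) by simp
    ultimately have "h * x - x * h = 0" using nondegenerate by metis
    then show ?thesis by simp
  qed
  then have "h \<in> center A" using h(1) by (simp add: center_def)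
  then obtain c where c: "h * q = c *\<^sub>C q" using central_mult_mcp q by blast
  have "\<phi> (x * q) = c * tr (x * q)" if x: "x \<in> A" for x
  proof -
    note qD = mcpD[OF q]
    have "h * (x * q) = (h * q) * x"
      using center_comm[OF qD(1) x] by (simp add: mult.assoc)
    also have "\<dots> = c *\<^sub>C (x * q)"
      using center_comm[OF qD(1) x] by (simp add: c scaleC_simps)
    finally show ?thesis using h(2) tr_scale x qD(2) closed(4) by simp
  qed
  then show thesis using that by blast
qed

end

section \<open>The basic construction\<close>

lemma additive_on_sum:
  fixes g :: "'a::complex_vector \<Rightarrow> 'b::ab_group_add"
  assumes "complex_vector.subspace V"
    and add: "\<And>x y. x \<in> V \<Longrightarrow> y \<in> V \<Longrightarrow> g (x + y) = g x + g y"
    and f: "\<And>i. i \<in> S \<Longrightarrow> f i \<in> V"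
  shows "g (sum f S) = (\<Sum>i\<in>S. g (f i))"
proof -
  have 0: "0 \<in> V" using assms(1) complex_vector.subspace_0 by blast
  have g0: "g 0 = 0" using add[OF 0 0] by simp
  have "sum f T \<in> V \<and> g (sum f T) = (\<Sum>i\<in>T. g (f i))" if "T \<subseteq> S" for T
    using that
    by (induction T rule: infinite_finite_induct)
      (auto simp: g0 0 add f complex_vector.subspace_add[OF assms(1)])
  then show ?thesis by blast
qed

lemma star_automorphismD:
  assumes "star_automorphism A \<alpha>"
  shows "bij_betw \<alpha> A A"
    "x \<in> A \<Longrightarrow> \<alpha> x \<in> A"
    "x \<in> A \<Longrightarrow> y \<in> A \<Longrightarrow> \<alpha> (x + y) = \<alpha> x + \<alpha> y"
    "x \<in> A \<Longrightarrow> \<alpha> (c *\<^sub>C x) = c *\<^sub>C \<alpha> x"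
    "x \<in> A \<Longrightarrow> y \<in> A \<Longrightarrow> \<alpha> (x * y) = \<alpha> x * \<alpha> y"
    "x \<in> A \<Longrightarrow> \<alpha> (star x) = star (\<alpha> x)"
  using assms bij_betwE unfolding star_automorphism_def by auto

lemma the_inv_into_image:
  assumes "bij_betw f A A" "B \<subseteq> A" "f ` B = B"
  shows "the_inv_into A f ` B = B"
proof -
  have "the_inv_into A f ` (f ` B) = B"
    using assms the_inv_into_f_f[of f A] unfolding bij_betw_def image_image
    by (smt (verit, best) image_cong image_ident subsetD)
  then show ?thesis using assms(3) by simp
qed

lemma star_automorphism_inverse:
  assumes \<alpha>: "star_automorphism A \<alpha>" and A: "unital_star_subalgebra A"
  shows "star_automorphism A (the_inv_into A \<alpha>)"
proof -
  note D = star_automorphismD[OF \<alpha>] and A = unital_star_subalgebra_closed[OF A]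
  let ?\<beta> = "the_inv_into A \<alpha>"
  have inj: "inj_on \<alpha> A" using D(1) bij_betw_def by blast
  have \<beta>: "?\<beta> x \<in> A" "\<alpha> (?\<beta> x) = x" if "x \<in> A" for x
    using that D(1) by (auto simp: bij_betw_def f_the_inv_into_f the_inv_into_into)
  have eq: "?\<beta> y = x" if "x \<in> A" "\<alpha> x = y" for x y
    using that inj the_inv_into_f_f by metis
  show ?thesis
    unfolding star_automorphism_def
    by (intro conjI ballI allI bij_betw_the_inv_into[OF D(1)] eq)
      (simp_all add: \<beta> A(4,5,6,8) D(3-6))
qed

lemma star_automorphism_the_inv_into:
  assumes "star_automorphism A \<alpha>" "x \<in> A"
  shows "\<alpha> (the_inv_into A \<alpha> x) = x" "the_inv_into A \<alpha> (\<alpha> x) = x"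
  using assms star_automorphismD(1)[OF assms(1)]
  by (auto simp: bij_betw_def f_the_inv_into_f the_inv_into_f_f)

lemma star_automorphism_1:
  assumes \<alpha>: "star_automorphism A \<alpha>" and A: "unital_star_subalgebra A"
  shows "\<alpha> 1 = 1"
proof -
  note D = star_automorphismD[OF \<alpha>] and one = unital_star_subalgebra_closed(3)[OF A]
  obtain y where y: "y \<in> A" "\<alpha> y = 1"
    using D(1) one unfolding bij_betw_def by (metis imageE)
  have "\<alpha> 1 * \<alpha> y = \<alpha> y" using D(5)[OF one y(1)] by simp
  then show ?thesis by (simp add: y(2))
qed

text \<open>One step of the Jones tower: \<open>C\<close> is the basic construction of \<open>A \<subseteq> B\<close>, and the trace of \<open>C\<close> is
  the Markov extension of its restriction to \<open>B\<close>.\<close>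

locale jones_extension =
  fixes A B C :: "'a::cstar_algebra set" and tr :: "'a \<Rightarrow> complex" and e :: 'a and \<tau> :: real
  assumes fdA: "fd_cstar_algebra A" and fdB: "fd_cstar_algebra B" and fdC: "fd_cstar_algebra C"
    and AB: "A \<subseteq> B" and bc: "is_basic_construction A B tr e C"
    and trace_C: "faithful_tracial_state C tr"
    and markov: "\<And>x. x \<in> B \<Longrightarrow> tr (x * e) = complex_of_real \<tau> * tr x"
begin

lemma BC: "B \<subseteq> C" and eC: "e \<in> C"
  using bc unfolding is_basic_construction_def by auto

sublocale C: fd_tracial_algebra C tr
  using fdC trace_C by unfold_locales (auto simp: fd_cstar_algebra_def)

sublocale B: fd_tracial_algebra B tr
proof (intro fd_tracial_algebra.intro)
  show "tracial_algebra B tr"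
    using C.tracial_algebra_subset BC fdB by (auto simp: fd_cstar_algebra_def)
qed (unfold_locales, rule fdB)

sublocale A: fd_tracial_algebra A tr
proof (intro fd_tracial_algebra.intro)
  show "tracial_algebra A tr"
    using C.tracial_algebra_subset BC AB fdA by (auto simp: fd_cstar_algebra_def)
qed (unfold_locales, rule fdA)

lemma inB: "a \<in> A \<Longrightarrow> a \<in> B" and inC: "b \<in> B \<Longrightarrow> b \<in> C"
  using AB BC by auto

definition E where "E = jones_projection A B tr"

lemma E_orth: "b \<in> B \<Longrightarrow> E b \<in> A \<and> (\<forall>c\<in>A. tr_inner tr c (b - E b) = 0)"
proof -
  assume b: "b \<in> B"
  obtain S where S: "finite S" "A \<subseteq> complex_vector.span S" by (rule A.fd_spanning)
  obtain a where a: "a \<in> A" "\<And>c. c \<in> A \<Longrightarrow> tr (star c * (b - a)) = 0"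
    using B.orthogonal_projection[OF A.closed(1) S AB b] by blast
  have "a' = a" if a': "a' \<in> A" "\<forall>c\<in>A. tr_inner tr c (b - a') = 0" for a'
  proof -
    define d where "d = a' - a"
    have d: "d \<in> A" using a a' A.closed(7) d_def by blast
    have "star d * d = star d * (b - a) - star d * (b - a')" by (simp add: d_def ring_distribs)
    moreover have "star d * (b - a) \<in> B" "star d * (b - a') \<in> B"
      using d a a' b inB B.closed(4,5,7) by auto
    ultimately have "tr (star d * d) = tr (star d * (b - a)) - tr (star d * (b - a'))"
      by (simp only: B.tr_diff)
    also have "\<dots> = 0" using a(2) a'(2) d by (simp add: tr_inner_def)
    finally have "d = 0" using A.tr_faithful d by blast
    then show ?thesis by (simp add: d_def)
  qed
  then have "\<exists>!a. a \<in> A \<and> (\<forall>c\<in>A. tr_inner tr c (b - a) = 0)"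
    using a unfolding tr_inner_def by blast
  from theI'[OF this] show ?thesis using b by (simp add: E_def jones_projection_def)
qed

lemma E_in: "b \<in> B \<Longrightarrow> E b \<in> A"
  using E_orth by blast

lemma E_inB: "b \<in> B \<Longrightarrow> E b \<in> B"
  using E_in inB by blast

lemma tr_E_left: "c \<in> A \<Longrightarrow> b \<in> B \<Longrightarrow> tr (c * E b) = tr (c * b)"
proof -
  assume c: "c \<in> A" and b: "b \<in> B"
  have "tr (c * (b - E b)) = 0"
    using E_orth[OF b] A.closed(5)[OF c] star_star[of c] unfolding tr_inner_def by metis
  then show ?thesis
    using c b E_inB inB B.closed(4) by (simp add: ring_distribs B.tr_diff)
qed

lemma tr_E: "b \<in> B \<Longrightarrow> tr (E b) = tr b"
  using tr_E_left[of 1 b] A.closed(3) by simp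

lemma E_eqI:
  assumes "b \<in> B" "a \<in> A" "\<And>c. c \<in> A \<Longrightarrow> tr (c * b) = tr (c * a)"
  shows "E b = a"
proof -
  have "tr (c * (E b - a)) = 0" if "c \<in> A" for c
    using that assms tr_E_left E_in A.closed(4) by (simp add: ring_distribs A.tr_diff)
  then have "E b - a = 0" using A.nondegenerate assms(1,2) E_in A.closed(7) by metis
  then show ?thesis by simp
qed

lemma E_right: "a \<in> A \<Longrightarrow> b \<in> B \<Longrightarrow> E (b * a) = E b * a"
proof (rule E_eqI)
  assume a: "a \<in> A" and b: "b \<in> B"
  show "b * a \<in> B" "E b * a \<in> A" using a b inB E_in B.closed(4) A.closed(4) by auto
  fix c assume c: "c \<in> A"
  have "tr (c * (b * a)) = tr (a * c * b)"
    using B.tr_comm[of "c * b" a] a b c inB B.closed(4) by (simp add: mult.assoc)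
  also have "\<dots> = tr (a * c * E b)"
    using tr_E_left[of "a * c" b] a b c A.closed(4) by simp
  also have "\<dots> = tr (c * (E b * a))"
    using B.tr_comm[of "c * E b" a] a b c inB E_inB B.closed(4) by (simp add: mult.assoc)
  finally show "tr (c * (b * a)) = tr (c * (E b * a))" .
qed

lemma E_id: "a \<in> A \<Longrightarrow> E a = a"
  by (rule E_eqI) (auto simp: inB)

lemma E_add: "x \<in> B \<Longrightarrow> y \<in> B \<Longrightarrow> E (x + y) = E x + E y"
  by (rule E_eqI)
    (auto simp: B.closed(4,6) A.closed(6) E_in E_inB inB ring_distribs B.tr_add tr_E_left)

lemma basic_construction_linear:
  assumes "T \<in> basic_construction A B tr"
  shows "T \<in> extensional B \<and> (\<forall>b\<in>B. T b \<in> B) \<and> (\<forall>b\<in>B. \<forall>a\<in>A. T (b * a) = T b * a)"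
  using assms
proof induction
  case (left_mult x)
  then show ?case using inB B.closed(4) by (auto simp: left_mult_def mult.assoc extensional_def)
next
  case jones_projection
  have "jones_projection A B tr \<in> extensional B" by (simp add: jones_projection_def)
  then show ?case using E_inB E_right by (auto simp: E_def[symmetric])
next
  case (add S T)
  then show ?case using inB B.closed(4,6) by (auto simp: ring_distribs extensional_def)
next
  case (scale T c)
  then show ?case using inB B.closed(4,8) by (auto simp: scaleC_simps extensional_def)
next
  case (compose S T)
  then show ?case using inB B.closed(4) by (auto simp: compose_def extensional_def)
qed

text \<open>An identification of \<open>C\<close> with operators on \<open>L\<^sup>2(B, tr)\<close>. Identities in \<open>C\<close> are verified by applying both
  sides to the vectors \<open>b \<in> B\<close>.\<close>

definition \<theta> where
  "\<theta> = (SOME \<phi>. bij_betw \<phi> C (basic_construction A B tr) \<and>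
        (\<forall>x\<in>C. \<forall>y\<in>C. \<phi> (x + y) = (\<lambda>b\<in>B. \<phi> x b + \<phi> y b)) \<and>
        (\<forall>c. \<forall>x\<in>C. \<phi> (c *\<^sub>C x) = (\<lambda>b\<in>B. c *\<^sub>C \<phi> x b)) \<and>
        (\<forall>x\<in>C. \<forall>y\<in>C. \<phi> (x * y) = compose B (\<phi> x) (\<phi> y)) \<and>
        (\<forall>x\<in>C. \<forall>a\<in>B. \<forall>b\<in>B. tr_inner tr (\<phi> x a) b = tr_inner tr a (\<phi> (star x) b)) \<and>
        (\<forall>x\<in>B. \<phi> x = left_mult B x) \<and>
        \<phi> e = jones_projection A B tr)"

lemma \<theta>: "bij_betw \<theta> C (basic_construction A B tr)"
        "x \<in> C \<Longrightarrow> y \<in> C \<Longrightarrow> \<theta> (x + y) = (\<lambda>b\<in>B. \<theta> x b + \<theta> y b)"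
        "x \<in> C \<Longrightarrow> \<theta> (c *\<^sub>C x) = (\<lambda>b\<in>B. c *\<^sub>C \<theta> x b)"
        "x \<in> C \<Longrightarrow> y \<in> C \<Longrightarrow> \<theta> (x * y) = compose B (\<theta> x) (\<theta> y)"
        "x \<in> C \<Longrightarrow> a \<in> B \<Longrightarrow> b \<in> B \<Longrightarrow> tr_inner tr (\<theta> x a) b = tr_inner tr a (\<theta> (star x) b)"
        "x \<in> B \<Longrightarrow> \<theta> x = left_mult B x"
        "\<theta> e = E"
proof -
  note ex = bc[unfolded is_basic_construction_def, THEN conjunct2, THEN conjunct2]
  from someI_ex[OF ex] show "bij_betw \<theta> C (basic_construction A B tr)"
        "x \<in> C \<Longrightarrow> y \<in> C \<Longrightarrow> \<theta> (x + y) = (\<lambda>b\<in>B. \<theta> x b + \<theta> y b)"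
        "x \<in> C \<Longrightarrow> \<theta> (c *\<^sub>C x) = (\<lambda>b\<in>B. c *\<^sub>C \<theta> x b)"
        "x \<in> C \<Longrightarrow> y \<in> C \<Longrightarrow> \<theta> (x * y) = compose B (\<theta> x) (\<theta> y)"
        "x \<in> C \<Longrightarrow> a \<in> B \<Longrightarrow> b \<in> B \<Longrightarrow> tr_inner tr (\<theta> x a) b = tr_inner tr a (\<theta> (star x) b)"
        "x \<in> B \<Longrightarrow> \<theta> x = left_mult B x"
        "\<theta> e = E"
    unfolding \<theta>_def[symmetric] E_def by auto
qed

lemma \<theta>_bc: "x \<in> C \<Longrightarrow> \<theta> x \<in> basic_construction A B tr"
  using \<theta>(1) bij_betwE by blast

lemma \<theta>_in: "x \<in> C \<Longrightarrow> b \<in> B \<Longrightarrow> \<theta> x b \<in> B"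
  and \<theta>_right: "x \<in> C \<Longrightarrow> b \<in> B \<Longrightarrow> a \<in> A \<Longrightarrow> \<theta> x (b * a) = \<theta> x b * a"
  and \<theta>_ext: "x \<in> C \<Longrightarrow> \<theta> x \<in> extensional B"
  using basic_construction_linear[OF \<theta>_bc] by auto

lemma \<theta>_app:
  "x \<in> C \<Longrightarrow> y \<in> C \<Longrightarrow> b \<in> B \<Longrightarrow> \<theta> (x + y) b = \<theta> x b + \<theta> y b"
  "x \<in> C \<Longrightarrow> b \<in> B \<Longrightarrow> \<theta> (c *\<^sub>C x) b = c *\<^sub>C \<theta> x b"
  "x \<in> C \<Longrightarrow> y \<in> C \<Longrightarrow> b \<in> B \<Longrightarrow> \<theta> (x * y) b = \<theta> x (\<theta> y b)"
  "x \<in> B \<Longrightarrow> b \<in> B \<Longrightarrow> \<theta> x b = x * b"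
  "\<theta> e b = E b"
  using \<theta>(2-4,6,7) by (auto simp: left_mult_def compose_def)

lemma \<theta>_inj:
  assumes "x \<in> C" "y \<in> C" "\<And>b. b \<in> B \<Longrightarrow> \<theta> x b = \<theta> y b"
  shows "x = y"
proof -
  have "\<theta> x = \<theta> y" using extensionalityI[OF \<theta>_ext \<theta>_ext] assms by blast
  then show ?thesis using \<theta>(1) assms by (auto simp: bij_betw_def inj_on_def)
qed

lemma \<theta>_sum: "(\<And>i. i \<in> S \<Longrightarrow> f i \<in> C) \<Longrightarrow> b \<in> B \<Longrightarrow> \<theta> (sum f S) b = (\<Sum>i\<in>S. \<theta> (f i) b)"
  using additive_on_sum[OF C.closed(1), of "\<lambda>x. \<theta> x b" S f] \<theta>_app(1) by blast

lemma \<theta>_star_eqI: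
  assumes "x \<in> C" "b \<in> B" "c \<in> B" "\<And>a. a \<in> B \<Longrightarrow> tr (star (\<theta> x a) * b) = tr (star a * c)"
  shows "\<theta> (star x) b = c"
proof -
  have xb: "\<theta> (star x) b \<in> B" using assms C.closed(5) \<theta>_in by blast
  have "tr (y * (\<theta> (star x) b - c)) = 0" if y: "y \<in> B" for y
  proof -
    have "tr (y * \<theta> (star x) b) = tr (y * c)"
      using \<theta>(5)[OF assms(1) B.closed(5)[OF y] assms(2)] assms(4)[OF B.closed(5)[OF y]]
      by (simp add: tr_inner_def star_star)
    then show ?thesis using y xb assms(3) B.closed(4) by (simp add: ring_distribs B.tr_diff)
  qed
  then have "\<theta> (star x) b - c = 0"
    using B.nondegenerate B.closed(7) xb assms(3) by metis
  then show ?thesis by simp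
qed

lemma star_e: "star e = e"
proof (rule \<theta>_inj)
  show "star e \<in> C" "e \<in> C" using eC C.closed(5) by auto
  fix b assume b: "b \<in> B"
  have "tr (star (\<theta> e a) * b) = tr (star a * \<theta> e b)" if a: "a \<in> B" for a
  proof -
    have Ea: "star (E a) \<in> A" "E b \<in> A" using a b E_in A.closed(5) by auto
    have "tr (star (E a) * b) = tr (star (E a) * E b)" using tr_E_left Ea b by simp
    also have "\<dots> = tr (star (star (E b) * E a))" by (simp add: star_mult star_star)
    also have "\<dots> = cnj (tr (star (E b) * E a))"
      using B.tr_star B.closed(4,5) E_inB a b by simp
    also have "tr (star (E b) * E a) = tr (star (E b) * a)"
      using tr_E_left A.closed(5) Ea(2) a by simp
    also have "cnj \<dots> = tr (star (star (E b) * a))"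
      using B.tr_star B.closed(4,5) E_inB a b by simp
    finally show ?thesis by (simp add: \<theta>_app star_mult star_star)
  qed
  then show "\<theta> (star e) b = \<theta> e b" using \<theta>_star_eqI eC b \<theta>_in by blast
qed

text \<open>Both sides act on \<open>B\<close> by \<open>b \<mapsto> x(a E(b)) = x(a) E(b)\<close>, because \<open>x\<close> is right \<open>A\<close>-linear.\<close>

lemma mult_e: "x \<in> C \<Longrightarrow> a \<in> B \<Longrightarrow> x * a * e = \<theta> x a * e"
  by (rule \<theta>_inj)
    (auto simp: C.closed(4) inC eC \<theta>_in \<theta>_app E_inB B.closed(4) E_in \<theta>_right)

definition ideal_e where "ideal_e = complex_vector.span {a * e * b | a b. a \<in> B \<and> b \<in> B}"

lemma ideal_e_base: "a \<in> B \<Longrightarrow> b \<in> B \<Longrightarrow> a * e * b \<in> ideal_e"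
  unfolding ideal_e_def by (intro complex_vector.span_base) blast

lemma ideal_e_induct [consumes 1, case_names zero step]:
  assumes "x \<in> ideal_e" "P 0"
    and "\<And>c a b y. a \<in> B \<Longrightarrow> b \<in> B \<Longrightarrow> y \<in> ideal_e \<Longrightarrow> P y \<Longrightarrow> P (c *\<^sub>C (a * e * b) + y)"
  shows "P x"
proof -
  have "x \<in> ideal_e \<and> P x"
    using assms(1)[unfolded ideal_e_def]
  proof (induction rule: complex_vector.span_induct_alt)
    case base
    then show ?case using assms(2) complex_vector.span_zero by (simp add: ideal_e_def)
  next
    case (step c x y)
    then obtain a b where ab: "x = a * e * b" "a \<in> B" "b \<in> B" by blast
    then show ?case
      using step ideal_e_base[of a b] assms(3)[of a b y c] complex_vector.span_add complex_vector.span_scale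
      unfolding ideal_e_def by blast
  qed
  then show ?thesis by blast
qed

lemma ideal_e_closed:
  "0 \<in> ideal_e" "x \<in> ideal_e \<Longrightarrow> y \<in> ideal_e \<Longrightarrow> x + y \<in> ideal_e" "x \<in> ideal_e \<Longrightarrow> c *\<^sub>C x \<in> ideal_e"
  unfolding ideal_e_def
  by (simp_all add: complex_vector.span_zero complex_vector.span_add complex_vector.span_scale)

lemma ideal_e_sub: "ideal_e \<subseteq> C"
proof
  show "x \<in> C" if "x \<in> ideal_e" for x
    using that by (induction rule: ideal_e_induct) (auto simp: C.closed(2,4,6,8) inC eC)
qed

text \<open>\<open>B e B\<close> spans an ideal of \<open>C\<close>. Let \<open>u\<close> be its unit. Then \<open>1 - u\<close> annihilates \<open>b e\<close> for every
  \<open>b \<in> B\<close>, and evaluating the operator \<open>(1 - u) b e\<close> at the vector \<open>1\<close> shows that the operator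
  \<open>1 - u\<close> annihilates \<open>b\<close>.\<close>

lemma one_in_ideal_e: "1 \<in> ideal_e"
proof -
  obtain S where S: "finite S" "C \<subseteq> complex_vector.span S" by (rule C.fd_spanning)
  have sub: "complex_vector.subspace ideal_e" unfolding ideal_e_def by simp
  have ideal: "x * w \<in> ideal_e" if x: "x \<in> C" and w: "w \<in> ideal_e" for x w
    using w
  proof (induction rule: ideal_e_induct)
    case (step c a b y)
    have "x * (c *\<^sub>C (a * e * b) + y) = c *\<^sub>C (\<theta> x a * e * b) + x * y"
      using mult_e[OF x step(1)] by (simp add: ring_distribs scaleC_simps mult.assoc[symmetric])
    then show ?case using step x \<theta>_in ideal_e_closed ideal_e_base by simp
  qed (simp add: ideal_e_closed)
  have star: "star w \<in> ideal_e" if "w \<in> ideal_e" for w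
    using that
  proof (induction rule: ideal_e_induct)
    case (step c a b y)
    have "star (c *\<^sub>C (a * e * b) + y) = cnj c *\<^sub>C (star b * e * star a) + star y"
      by (simp add: star_add star_scaleC star_mult star_e mult.assoc)
    then show ?case using step ideal_e_closed ideal_e_base B.closed(5) by simp
  qed (simp add: ideal_e_closed)
  have fd: "ideal_e \<subseteq> complex_vector.span S" using ideal_e_sub S(2) by blast
  obtain u where u: "u \<in> ideal_e" "\<And>a. a \<in> ideal_e \<Longrightarrow> u * a = a"
    using C.ideal_has_unit[OF sub S(1) fd ideal_e_sub ideal star] by metis
  have uC: "u \<in> C" using u ideal_e_sub by blast
  have "1 = u"
  proof (rule \<theta>_inj[OF C.closed(3) uC])
    fix b assume b: "b \<in> B"
    have "b * e * 1 \<in> ideal_e" by (rule ideal_e_base[OF b B.closed(3)])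
    then have "u * (b * e) = b * e" using u(2)[of "b * e"] by simp
    then have "\<theta> u (\<theta> b (\<theta> e 1)) = \<theta> b (\<theta> e 1)"
      using \<theta>_app(3)[of u "b * e" 1] \<theta>_app(3)[of b e 1] uC b inC eC B.closed(3) C.closed(4) by simp
    then have "\<theta> u b = b" using \<theta>_app(4,5) b B.closed(3) E_id[OF A.closed(3)] by simp
    then show "\<theta> 1 b = \<theta> u b" using \<theta>_app(4) B.closed(3) b by simp
  qed
  then show ?thesis using u by simp
qed

text \<open>As an identity of operators on \<open>B\<close> this is \<open>b = \<Sum> m E(n b)\<close>, so \<open>m\<close> and \<open>n\<close> are dual bases of the
  right \<open>A\<close>-module \<open>B\<close> with respect to the conditional expectation.\<close>

lemma quasi_basis:
  obtains S :: "'a set" and m n where "finite S" "\<And>s. s \<in> S \<Longrightarrow> m s \<in> B" "\<And>s. s \<in> S \<Longrightarrow> n s \<in> B"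
    "1 = (\<Sum>s\<in>S. m s * e * n s)"
proof -
  obtain S r where S: "finite S" "S \<subseteq> {a * e * b | a b. a \<in> B \<and> b \<in> B}" "1 = (\<Sum>a\<in>S. r a *\<^sub>C a)"
    using one_in_ideal_e unfolding ideal_e_def complex_vector.span_explicit by blast
  have "\<forall>s\<in>S. \<exists>m n. m \<in> B \<and> n \<in> B \<and> s = m * e * n" using S(2) by blast
  then obtain m n where mn: "\<forall>s\<in>S. m s \<in> B \<and> n s \<in> B \<and> s = m s * e * n s" by metis
  have "1 = (\<Sum>s\<in>S. (r s *\<^sub>C m s) * e * n s)"
    unfolding S(3) mult_scaleC_left using mn by (intro sum.cong) auto
  then show thesis
    using mn B.closed(8) S(1) by (intro that[of S "\<lambda>s. r s *\<^sub>C m s" n]) auto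
qed

lemma generated: "C = ideal_e"
proof -
  obtain S :: "'a set" and m n where S: "finite S" "\<And>s. s \<in> S \<Longrightarrow> m s \<in> B" "\<And>s. s \<in> S \<Longrightarrow> n s \<in> B"
    "1 = (\<Sum>s\<in>S. m s * e * n s)" by (rule quasi_basis) blast
  have "x \<in> ideal_e" if x: "x \<in> C" for x
  proof -
    have "x = x * (\<Sum>s\<in>S. m s * e * n s)" using S(4) by simp
    also have "\<dots> = (\<Sum>s\<in>S. \<theta> x (m s) * e * n s)"
      unfolding sum_distrib_left using mult_e[OF x] S(2)
      by (intro sum.cong) (auto simp: mult.assoc[symmetric])
    also have "\<dots> \<in> ideal_e"
      using S(2,3) ideal_e_base \<theta>_in[OF x] unfolding ideal_e_def
      by (intro complex_vector.span_sum) auto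
    finally show ?thesis .
  qed
  then show ?thesis using ideal_e_sub by blast
qed

lemma tr_mult_e_mult: "a \<in> B \<Longrightarrow> b \<in> B \<Longrightarrow> tr (a * e * b) = complex_of_real \<tau> * tr (b * a)"
  using C.tr_comm[of "a * e" b] markov[of "b * a"] B.closed(4) C.closed(4) inC eC
  by (simp add: mult.assoc)

end

section \<open>Uniqueness of the Markov trace\<close>

text \<open>Maximum principle: where the real or the imaginary part of a harmonic function attains its
  maximum, it attains it at all neighbours as well.\<close>

lemma harmonic_constant:
  fixes f :: "'v \<Rightarrow> complex" and W :: "'v \<Rightarrow> 'v \<Rightarrow> real"
  assumes fin: "finite V" and G: "G \<subseteq> V \<times> V"
    and connected: "\<forall>u\<in>V. \<forall>v\<in>V. (u, v) \<in> G\<^sup>*"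
    and nonneg: "\<And>u v. u \<in> V \<Longrightarrow> v \<in> V \<Longrightarrow> W u v \<ge> 0" and pos: "\<And>u v. (u, v) \<in> G \<Longrightarrow> W u v > 0"
    and harmonic: "\<And>v. v \<in> V \<Longrightarrow> (\<Sum>u\<in>V. complex_of_real (W v u) * (f u - f v)) = 0"
    and uv: "u \<in> V" "v \<in> V"
  shows "f u = f v"
proof -
  have real: "g u = g v" if harm: "\<And>v. v \<in> V \<Longrightarrow> (\<Sum>u\<in>V. W v u * (g u - g v)) = 0"
    for g :: "'v \<Rightarrow> real"
  proof -
    define M where "M = Max (g ` V)"
    have le: "g w \<le> M" if "w \<in> V" for w using that fin by (simp add: M_def)
    have "M \<in> g ` V" unfolding M_def using fin uv by (intro Max_in) auto
    then obtain v0 where v0: "v0 \<in> V" "g v0 = M" by blast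
    have "w \<in> V \<and> g w = M" if "(v0, w) \<in> G\<^sup>*" for w
      using that
    proof (induction rule: rtrancl_induct)
      case base
      then show ?case using v0 by simp
    next
      case (step y z)
      then have z: "z \<in> V" "W y z > 0" using G pos by auto
      have "(\<Sum>u\<in>V. W y u * (M - g u)) = 0"
        using harm[of y] step sum_negf[of "\<lambda>u. W y u * (g u - M)" V] by (simp add: algebra_simps)
      then have "W y z * (M - g z) = 0"
        using fin z(1) nonneg[of y] step(3) le by (subst (asm) sum_nonneg_eq_0_iff) auto
      then show ?case using z by simp
    qed
    then have "g w = M" if "w \<in> V" for w using connected v0(1) that by blast
    then show ?thesis using uv by simp
  qed
  have Re: "(\<Sum>u\<in>V. W v u * (Re (f u) - Re (f v))) = 0" if "v \<in> V" for v
    using arg_cong[OF harmonic[OF that], of Re] by simp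
  have Im: "(\<Sum>u\<in>V. W v u * (Im (f u) - Im (f v))) = 0" if "v \<in> V" for v
    using arg_cong[OF harmonic[OF that], of Im] by simp
  show ?thesis using real[of "\<lambda>v. Re (f v)", OF Re] real[of "\<lambda>v. Im (f v)", OF Im]
    by (simp add: complex_eq_iff)
qed

context jones_extension
begin

context
  fixes S :: "'a set" and m n :: "'a \<Rightarrow> 'a"
  assumes finS: "finite S" and m: "\<And>s. s \<in> S \<Longrightarrow> m s \<in> B" and n: "\<And>s. s \<in> S \<Longrightarrow> n s \<in> B"
    and one: "1 = (\<Sum>s\<in>S. m s * e * n s)"
begin

lemma tr_quasi_basis:
  assumes x: "x \<in> B"
  shows "tr x = complex_of_real \<tau> * (\<Sum>s\<in>S. tr (n s * x * m s))"
proof -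
  have "x = (\<Sum>s\<in>S. (x * m s) * e * n s)"
    using arg_cong[OF one, of "(*) x"] by (simp add: sum_distrib_left mult.assoc)
  then have "tr x = tr (\<Sum>s\<in>S. (x * m s) * e * n s)" by simp
  also have "\<dots> = (\<Sum>s\<in>S. tr ((x * m s) * e * n s))"
    by (intro C.tr_sum C.closed(4) eC inC x m n)
  also have "\<dots> = (\<Sum>s\<in>S. complex_of_real \<tau> * tr (n s * x * m s))"
    by (intro sum.cong refl, subst tr_mult_e_mult) (auto simp: m n x B.closed(4) mult.assoc)
  finally show ?thesis by (simp add: sum_distrib_left)
qed

lemma dual_basis_expansion:
  assumes b: "b \<in> B"
  shows "b = (\<Sum>s\<in>S. m s * E (n s * b))"
proof -
  have "\<theta> 1 b = (\<Sum>s\<in>S. \<theta> (m s * e * n s) b)"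
    unfolding one using C.closed(4) inC eC m n b by (intro \<theta>_sum) auto
  also have "\<dots> = (\<Sum>s\<in>S. m s * E (n s * b))"
    using C.closed(4) B.closed(4) inC eC m n b E_inB by (intro sum.cong) (auto simp: \<theta>_app)
  finally show ?thesis using \<theta>_app(4)[of 1 b] B.closed(3) b by simp
qed

text \<open>This is the independence of the Hattori-Stallings trace of the right \<open>A\<close>-module \<open>B\<close> from the
  choice of a dual basis: expand the dual basis \<open>m\<close> in the dual basis \<open>\<alpha> m\<close>, then sum back.\<close>

lemma automorphism_tr_quasi_basis:
  assumes \<alpha>: "star_automorphism B \<alpha>" and \<alpha>A: "\<alpha> ` A = A" and x: "x \<in> B"
  shows "tr (\<alpha> x) = complex_of_real \<tau> * (\<Sum>t\<in>S. tr (\<alpha> (E (n t * x * m t))))"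
proof -
  define \<beta> where "\<beta> = the_inv_into B \<alpha>"
  note \<alpha>D = star_automorphismD[OF \<alpha>]
  have \<beta>: "star_automorphism B \<beta>"
    unfolding \<beta>_def by (rule star_automorphism_inverse[OF \<alpha> B.subalgebra])
  note \<beta>D = star_automorphismD[OF \<beta>]
  have \<beta>A: "\<beta> a \<in> A" if "a \<in> A" for a
    using the_inv_into_image[OF \<alpha>D(1) AB \<alpha>A] that \<beta>_def by blast
  have \<alpha>A': "\<alpha> a \<in> A" if "a \<in> A" for a using \<alpha>A that by blast
  have \<alpha>\<beta>: "\<alpha> (\<beta> y) = y" if "y \<in> B" for y
    unfolding \<beta>_def using star_automorphism_the_inv_into(1)[OF \<alpha> that] .
  have \<beta>\<alpha>: "\<beta> (\<alpha> y) = y" if "y \<in> B" for y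
    unfolding \<beta>_def using star_automorphism_the_inv_into(2)[OF \<alpha> that] .
  define g where "g = (\<lambda>t y. tr (\<alpha> (E (n t * \<beta> y))))"
  have g_add: "g t (y + z) = g t y + g t z" if "t \<in> S" "y \<in> B" "z \<in> B" for t y z
    using that n \<beta>D \<alpha>D E_add E_inB B.closed(4) by (simp add: g_def ring_distribs B.tr_add)
  have step: "tr (n s * \<alpha> x * m s) = (\<Sum>t\<in>S. g t (m s * E (n s * \<alpha> (x * m t))))" if s: "s \<in> S" for s
  proof -
    define a where "a = (\<lambda>t. \<alpha> (E (n t * \<beta> (m s))))"
    have a: "a t \<in> A" if "t \<in> S" for t
      unfolding a_def using that n m s \<beta>D(2) B.closed(4) E_in by (intro \<alpha>A') auto
    have "m s = \<alpha> (\<Sum>t\<in>S. m t * E (n t * \<beta> (m s)))"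
      using dual_basis_expansion[OF \<beta>D(2)[OF m[OF s]]] \<alpha>\<beta>[OF m[OF s]] by simp
    also have "\<dots> = (\<Sum>t\<in>S. \<alpha> (m t * E (n t * \<beta> (m s))))"
      using \<alpha>D(3) m n s \<beta>D(2) E_inB B.closed(4) by (intro additive_on_sum[OF B.closed(1)]) auto
    also have "\<dots> = (\<Sum>t\<in>S. \<alpha> (m t) * a t)"
      unfolding a_def using \<alpha>D(5) m n s \<beta>D(2) E_inB B.closed(4) by (intro sum.cong) auto
    finally have ms: "m s = (\<Sum>t\<in>S. \<alpha> (m t) * a t)" .
    have "n s * \<alpha> x * m s = (\<Sum>t\<in>S. n s * \<alpha> (x * m t) * a t)"
      by (subst ms, unfold sum_distrib_left) (intro sum.cong, auto simp: \<alpha>D(5) x m mult.assoc)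
    then have "tr (n s * \<alpha> x * m s) = (\<Sum>t\<in>S. tr (n s * \<alpha> (x * m t) * a t))"
      using B.tr_sum[of S "\<lambda>t. n s * \<alpha> (x * m t) * a t"] n s \<alpha>D(2) x m a inB B.closed(4) by simp
    also have "\<dots> = (\<Sum>t\<in>S. g t (m s * E (n s * \<alpha> (x * m t))))"
    proof (intro sum.cong refl)
      fix t assume t: "t \<in> S"
      define y where "y = n s * \<alpha> (x * m t)"
      have y: "y \<in> B" unfolding y_def using n s \<alpha>D(2) x m t B.closed(4) by simp
      have "tr (y * a t) = tr (a t * E y)"
        using B.tr_comm[OF y inB[OF a[OF t]]] tr_E_left[OF a[OF t] y] by simp
      also have "a t * E y = \<alpha> (E (n t * \<beta> (m s)) * \<beta> (E y))"
        unfolding a_def using \<alpha>D(5) \<alpha>\<beta> y n m s t \<beta>D(2) E_inB B.closed(4) by simp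
      also have "E (n t * \<beta> (m s)) * \<beta> (E y) = E (n t * \<beta> (m s) * \<beta> (E y))"
        using E_right[OF \<beta>A[OF E_in[OF y]]] n m s t \<beta>D(2) B.closed(4) by simp
      also have "n t * \<beta> (m s) * \<beta> (E y) = n t * \<beta> (m s * E y)"
        using \<beta>D(5) m s y E_inB by (simp add: mult.assoc)
      finally show "tr (n s * \<alpha> (x * m t) * a t) = g t (m s * E (n s * \<alpha> (x * m t)))"
        by (simp add: g_def y_def)
    qed
    finally show ?thesis .
  qed
  have "tr (\<alpha> x) = complex_of_real \<tau> * (\<Sum>s\<in>S. tr (n s * \<alpha> x * m s))"
    by (rule tr_quasi_basis) (rule \<alpha>D(2)[OF x])
  also have "(\<Sum>s\<in>S. tr (n s * \<alpha> x * m s)) = (\<Sum>s\<in>S. \<Sum>t\<in>S. g t (m s * E (n s * \<alpha> (x * m t))))"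
    using step by simp
  also have "\<dots> = (\<Sum>t\<in>S. \<Sum>s\<in>S. g t (m s * E (n s * \<alpha> (x * m t))))"
    by (rule sum.swap)
  also have "\<dots> = (\<Sum>t\<in>S. g t (\<alpha> (x * m t)))"
  proof (intro sum.cong refl)
    fix t assume t: "t \<in> S"
    have b: "\<alpha> (x * m t) \<in> B" using \<alpha>D(2) x m t B.closed(4) by simp
    have "g t (\<Sum>s\<in>S. m s * E (n s * \<alpha> (x * m t))) = (\<Sum>s\<in>S. g t (m s * E (n s * \<alpha> (x * m t))))"
      using g_add[OF t] m n b E_inB B.closed(4) by (intro additive_on_sum[OF B.closed(1)]) auto
    then show "(\<Sum>s\<in>S. g t (m s * E (n s * \<alpha> (x * m t)))) = g t (\<alpha> (x * m t))"
      using dual_basis_expansion[OF b] by simp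
  qed
  also have "\<dots> = (\<Sum>t\<in>S. tr (\<alpha> (E (n t * x * m t))))"
    unfolding g_def using \<beta>\<alpha> x m B.closed(4) by (intro sum.cong) (auto simp: mult.assoc)
  finally show ?thesis .
qed

text \<open>The weight is the trace of the projection \<open>b \<mapsto> q b p\<close>, which lies in \<open>C\<close>.\<close>

lemma projection_weight:
  assumes q: "q \<in> B" "is_projection q" and p: "p \<in> center A" "is_projection p"
  defines "w \<equiv> complex_of_real \<tau> * (\<Sum>s\<in>S. tr (n s * q * m s * p))"
  shows "w \<in> \<real>\<^sub>\<ge>\<^sub>0" "w = 0 \<Longrightarrow> q * p = 0"
proof -
  have pA: "p \<in> A" using p A.center_sub by blast
  have pB: "p \<in> B" using pA inB by blast
  have pp: "p * p = p" "star p = p" and qq: "q * q = q" "star q = q"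
    using p q by (auto simp: is_projection_def)
  define r where "r = (\<Sum>s\<in>S. m s * p * e * n s)"
  define v where "v = q * r"
  have rC: "r \<in> C"
    unfolding r_def using C.closed(4) inC eC m n pB by (intro C.closed(9)) auto
  have vC: "v \<in> C" unfolding v_def using rC q inC C.closed(4) by simp
  have r_app: "\<theta> r b = b * p" if b: "b \<in> B" for b
  proof -
    have "\<theta> r b = (\<Sum>s\<in>S. \<theta> (m s * p * e * n s) b)"
      unfolding r_def using C.closed(4) inC eC m n b pB by (intro \<theta>_sum) auto
    also have "\<dots> = (\<Sum>s\<in>S. m s * (p * E (n s * b)))"
      using C.closed(4) B.closed(4) inC eC m n b pB E_inB
      by (intro sum.cong) (auto simp: \<theta>_app mult.assoc)
    also have "\<dots> = (\<Sum>s\<in>S. m s * E (n s * b) * p)"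
      using A.center_comm[OF p(1)] E_in n b B.closed(4) by (intro sum.cong) (auto simp: mult.assoc)
    also have "\<dots> = (\<Sum>s\<in>S. m s * E (n s * b)) * p" by (simp add: sum_distrib_right)
    finally show ?thesis using dual_basis_expansion[OF b] by simp
  qed
  have v_app: "\<theta> v b = q * b * p" if b: "b \<in> B" for b
    unfolding v_def using that q(1) rC inC pB B.closed(4) r_app by (simp add: \<theta>_app mult.assoc)
  have sv_app: "\<theta> (star v) b = q * b * p" if b: "b \<in> B" for b
  proof (rule \<theta>_star_eqI[OF vC b])
    show "q * b * p \<in> B" using q pB b B.closed(4) by simp
    fix a assume a: "a \<in> B"
    have "tr (star (\<theta> v a) * b) = tr (p * (star a * q * b))"
      using v_app[OF a] by (simp add: star_mult pp qq mult.assoc)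
    also have "\<dots> = tr (star a * q * b * p)"
      using pB a q b B.closed(4,5) by (intro B.tr_comm) auto
    finally show "tr (star (\<theta> v a) * b) = tr (star a * (q * b * p))" by (simp add: mult.assoc)
  qed
  have "star v * v = v"
  proof (rule \<theta>_inj)
    show "star v * v \<in> C" "v \<in> C" using vC C.closed(4,5) by auto
    fix b assume b: "b \<in> B"
    have "\<theta> (star v * v) b = q * (q * b * p) * p"
      using sv_app[of "q * b * p"] v_app[OF b] vC b q(1) pB B.closed(4) C.closed(5)
      by (simp add: \<theta>_app)
    also have "\<dots> = (q * q) * b * (p * p)" by (simp only: mult.assoc)
    finally show "\<theta> (star v * v) b = \<theta> v b" using v_app[OF b] pp qq by simp
  qed
  moreover have "tr v = w"
  proof -
    have "v = (\<Sum>s\<in>S. (q * m s * p) * e * n s)"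
      by (simp add: v_def r_def sum_distrib_left mult.assoc)
    then have "tr v = tr (\<Sum>s\<in>S. (q * m s * p) * e * n s)" by simp
    also have "\<dots> = (\<Sum>s\<in>S. tr ((q * m s * p) * e * n s))"
      by (intro C.tr_sum C.closed(4) eC inC q m n pB)
    also have "\<dots> = (\<Sum>s\<in>S. complex_of_real \<tau> * tr (n s * q * m s * p))"
      by (intro sum.cong refl, subst tr_mult_e_mult) (auto simp: m n q(1) pB B.closed(4) mult.assoc)
    finally show ?thesis by (simp add: sum_distrib_left w_def)
  qed
  ultimately show "w \<in> \<real>\<^sub>\<ge>\<^sub>0" using C.tr_pos[OF vC] by simp
  assume "w = 0"
  then have "v = 0" using C.tr_faithful[OF vC] \<open>star v * v = v\<close> \<open>tr v = w\<close> by simp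
  then have "\<theta> v 1 = 0" using \<theta>_app(2)[of v 1 0] vC B.closed(3) by simp
  then show "q * p = 0" using v_app[of 1] B.closed(3) by simp
qed

end

lemma Re_nonneg_Reals: "z \<in> \<real>\<^sub>\<ge>\<^sub>0 \<Longrightarrow> complex_of_real (Re z) = z \<and> Re z \<ge> 0"
  by (auto simp: complex_nonneg_Reals_iff complex_eq_iff)

text \<open>On the Bratteli diagram, \<open>\<phi> = tr \<circ> \<alpha>\<close> has a density with respect to \<open>tr\<close> that is constant at
  each vertex. The value at a vertex of \<open>A\<close> is the mean of the neighbouring values with weights
  \<open>tr (p q)\<close>; the value at a vertex of \<open>B\<close> is a mean by the dual basis formula, which holds for
  \<open>\<phi>\<close> as well as for \<open>tr\<close>. So the density is harmonic.\<close>

theorem markov_trace_invariant: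
  assumes connected: "connected_inclusion A B"
    and \<alpha>: "star_automorphism B \<alpha>" and \<alpha>A: "\<alpha> ` A = A" and x: "x \<in> B"
  shows "tr (\<alpha> x) = tr x"
proof -
  note \<alpha>D = star_automorphismD[OF \<alpha>]
  define \<phi> where "\<phi> = (\<lambda>x. tr (\<alpha> x))"
  have \<phi>_add: "\<phi> (x + y) = \<phi> x + \<phi> y" if "x \<in> B" "y \<in> B" for x y
    using that \<alpha>D by (simp add: \<phi>_def B.tr_add)
  have \<phi>_scale: "\<phi> (c *\<^sub>C x) = c * \<phi> x" if "x \<in> B" for x c
    using that \<alpha>D by (simp add: \<phi>_def B.tr_scale)
  have \<phi>_comm: "\<phi> (x * y) = \<phi> (y * x)" if "x \<in> B" "y \<in> B" for x y
    using that \<alpha>D B.tr_comm[of "\<alpha> x" "\<alpha> y"] by (simp add: \<phi>_def)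
  have \<phi>_sum: "\<phi> (sum f T) = (\<Sum>i\<in>T. \<phi> (f i))" if "\<And>i. i \<in> T \<Longrightarrow> f i \<in> B" for f and T :: "'a set"
    by (rule additive_on_sum[OF B.closed(1) \<phi>_add]) (use that in auto)
  have "\<exists>c. \<forall>x\<in>A. \<phi> (x * p) = c * tr (x * p)" if "p \<in> A.mcp" for p
    using A.trace_proportional[of \<phi> p] \<phi>_add \<phi>_scale \<phi>_comm inB that by metis
  then obtain l where l: "\<And>p x. p \<in> A.mcp \<Longrightarrow> x \<in> A \<Longrightarrow> \<phi> (x * p) = l p * tr (x * p)" by metis
  have "\<exists>c. \<forall>x\<in>B. \<phi> (x * q) = c * tr (x * q)" if "q \<in> B.mcp" for q
    using B.trace_proportional[of \<phi> q] \<phi>_add \<phi>_scale \<phi>_comm that by metis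
  then obtain k where k: "\<And>q x. q \<in> B.mcp \<Longrightarrow> x \<in> B \<Longrightarrow> \<phi> (x * q) = k q * tr (x * q)" by metis
  obtain S :: "'a set" and m n where S: "finite S" "\<And>s. s \<in> S \<Longrightarrow> m s \<in> B" "\<And>s. s \<in> S \<Longrightarrow> n s \<in> B"
    "1 = (\<Sum>s\<in>S. m s * e * n s)" by (rule quasi_basis) blast
  define w where "w = (\<lambda>q p. complex_of_real \<tau> * (\<Sum>s\<in>S. tr (n s * q * m s * p)))"
  have w: "w q p \<in> \<real>\<^sub>\<ge>\<^sub>0" "w q p = 0 \<Longrightarrow> q * p = 0" if "p \<in> A.mcp" "q \<in> B.mcp" for p q
    unfolding w_def using projection_weight[OF S, of q p] A.mcpD(1,6)[OF that(1)] B.mcpD(2,6)[OF that(2)] by blast+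
  have pq_comm: "p * q = q * p" if "p \<in> A.mcp" "q \<in> B.mcp" for p q
    using B.center_comm[OF B.mcpD(1)[OF that(2)] inB[OF A.mcpD(2)[OF that(1)]]] by simp
  have pq: "tr (p * q) \<in> \<real>\<^sub>\<ge>\<^sub>0" "tr (p * q) = 0 \<Longrightarrow> p * q = 0" if "p \<in> A.mcp" "q \<in> B.mcp" for p q
  proof -
    note pD = A.mcpD[OF that(1)] and qD = B.mcpD[OF that(2)]
    have "star (p * q) * (p * q) = (p * q) * (p * q)"
      using pq_comm[OF that] pD qD by (simp add: star_mult)
    also have "\<dots> = p * (q * p) * q" by (simp add: mult.assoc)
    also have "\<dots> = (p * p) * (q * q)" by (simp add: pq_comm[OF that, symmetric] mult.assoc)
    finally have "star (p * q) * (p * q) = p * q" using pD(3) qD(3) by simp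
    moreover have "p * q \<in> B" using pD qD inB B.closed(4) by simp
    ultimately show "tr (p * q) \<in> \<real>\<^sub>\<ge>\<^sub>0" "tr (p * q) = 0 \<Longrightarrow> p * q = 0"
      using B.tr_pos[of "p * q"] B.tr_faithful[of "p * q"] by auto
  qed
  have mean_A: "(\<Sum>q\<in>B.mcp. tr (p * q) * (k q - l p)) = 0" if p: "p \<in> A.mcp" for p
  proof -
    have pB: "p \<in> B" using A.mcpD(2) p inB by blast
    have p_sum: "p = (\<Sum>q\<in>B.mcp. p * q)"
      using arg_cong[OF B.sum_mcp, of "(*) p"] by (simp add: sum_distrib_left)
    have in_B: "p * q \<in> B" if "q \<in> B.mcp" for q using pB B.mcpD(2) that B.closed(4) by simp
    have "\<phi> p = (\<Sum>q\<in>B.mcp. \<phi> (p * q))" using p_sum \<phi>_sum[of B.mcp "\<lambda>q. p * q"] in_B by simp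
    also have "\<dots> = (\<Sum>q\<in>B.mcp. k q * tr (p * q))" using k pB by (intro sum.cong) auto
    finally have 1: "\<phi> p = (\<Sum>q\<in>B.mcp. k q * tr (p * q))" .
    have 2: "tr p = (\<Sum>q\<in>B.mcp. tr (p * q))" using p_sum B.tr_sum[of B.mcp "\<lambda>q. p * q"] in_B by simp
    have "\<phi> p = l p * tr p" using l[OF p A.closed(3)] by simp
    then show ?thesis using 1 2 by (simp add: algebra_simps sum_subtractf sum_distrib_left)
  qed
  have mean_B: "(\<Sum>p\<in>A.mcp. w q p * (l p - k q)) = 0" if q: "q \<in> B.mcp" for q
  proof -
    have qB: "q \<in> B" using B.mcpD(2) q by blast
    have id: "star_automorphism B (\<lambda>x. x)" by (auto simp: star_automorphism_def bij_betw_def)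
    define y where "y = (\<lambda>s. E (n s * q * m s))"
    have y: "y s \<in> A" if "s \<in> S" for s
      unfolding y_def using that S(2,3) qB B.closed(4) E_in by simp
    have y_sum: "y s = (\<Sum>p\<in>A.mcp. y s * p)" for s
      using arg_cong[OF A.sum_mcp, of "(*) (y s)"] by (simp add: sum_distrib_left)
    have in_A: "y s * p \<in> A" if "s \<in> S" "p \<in> A.mcp" for s p
      using that y A.mcpD(2) A.closed(4) by simp
    have tr_y: "tr (y s * p) = tr (n s * q * m s * p)" if "s \<in> S" "p \<in> A.mcp" for s p
    proof -
      have z: "n s * q * m s \<in> B" using that S(2,3) qB B.closed(4) by simp
      show ?thesis unfolding y_def
        using E_right[OF A.mcpD(2)[OF that(2)] z] tr_E B.closed(4)[OF z inB[OF A.mcpD(2)[OF that(2)]]]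
        by metis
    qed
    have "\<phi> q = complex_of_real \<tau> * (\<Sum>s\<in>S. \<phi> (y s))"
      unfolding \<phi>_def y_def by (rule automorphism_tr_quasi_basis[OF S \<alpha> \<alpha>A qB])
    also have "(\<Sum>s\<in>S. \<phi> (y s)) = (\<Sum>s\<in>S. \<Sum>p\<in>A.mcp. \<phi> (y s * p))"
      using y_sum \<phi>_sum[of A.mcp "\<lambda>p. y _ * p"] in_A inB by (intro sum.cong) metis+
    also have "\<dots> = (\<Sum>s\<in>S. \<Sum>p\<in>A.mcp. l p * tr (n s * q * m s * p))"
      using l y tr_y by (intro sum.cong) auto
    also have "\<dots> = (\<Sum>p\<in>A.mcp. \<Sum>s\<in>S. l p * tr (n s * q * m s * p))" by (rule sum.swap)
    finally have 1: "\<phi> q = (\<Sum>p\<in>A.mcp. l p * w q p)"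
      by (simp add: w_def sum_distrib_left mult.left_commute)
    have "tr q = complex_of_real \<tau> * (\<Sum>s\<in>S. tr (y s))"
      unfolding y_def using automorphism_tr_quasi_basis[OF S id _ qB] by simp
    also have "(\<Sum>s\<in>S. tr (y s)) = (\<Sum>s\<in>S. \<Sum>p\<in>A.mcp. tr (y s * p))"
      using y_sum A.tr_sum[of A.mcp "\<lambda>p. y _ * p"] in_A by (intro sum.cong) metis+
    also have "\<dots> = (\<Sum>s\<in>S. \<Sum>p\<in>A.mcp. tr (n s * q * m s * p))"
      using tr_y by (intro sum.cong) auto
    also have "\<dots> = (\<Sum>p\<in>A.mcp. \<Sum>s\<in>S. tr (n s * q * m s * p))" by (rule sum.swap)
    finally have 2: "tr q = (\<Sum>p\<in>A.mcp. w q p)" by (simp add: w_def sum_distrib_left)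
    have "\<phi> q = k q * tr q" using k[OF q B.closed(3)] by simp
    then show ?thesis using 1 2 by (simp add: algebra_simps sum_subtractf sum_distrib_left)
  qed
  define V where "V = bratteli_vertices A B"
  define G where "G = bratteli_edges A B \<union> (bratteli_edges A B)\<inverse>"
  define f where "f = case_sum l k"
  define W where "W = (\<lambda>u v. case u of
      Inl p \<Rightarrow> (case v of Inl _ \<Rightarrow> 0 | Inr q \<Rightarrow> Re (tr (p * q)))
    | Inr q \<Rightarrow> (case v of Inl p \<Rightarrow> Re (w q p) | Inr _ \<Rightarrow> 0))"
  have fV: "finite V" unfolding V_def bratteli_vertices_def using A.finite_mcp B.finite_mcp by simp
  have sumV: "(\<Sum>u\<in>V. h u) = (\<Sum>p\<in>A.mcp. h (Inl p)) + (\<Sum>q\<in>B.mcp. h (Inr q))"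
    for h :: "'a + 'a \<Rightarrow> complex"
    unfolding V_def bratteli_vertices_def using A.finite_mcp B.finite_mcp by (simp add: sum.Plus)
  have edge: "p \<in> A.mcp \<and> q \<in> B.mcp \<and> Re (tr (p * q)) > 0 \<and> Re (w q p) > 0"
    if "(Inl p, Inr q) \<in> bratteli_edges A B" for p q
  proof -
    have mcp: "p \<in> A.mcp" "q \<in> B.mcp" and ne: "p * q \<noteq> 0"
      using that by (auto simp: bratteli_edges_def inclusion_matrix_def split: if_splits)
    have "tr (p * q) \<noteq> 0" "w q p \<noteq> 0" using pq(2)[OF mcp] w(2)[OF mcp] pq_comm[OF mcp] ne by auto
    then show ?thesis using mcp Re_nonneg_Reals[OF pq(1)[OF mcp]] Re_nonneg_Reals[OF w(1)[OF mcp]]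
      by (metis less_eq_real_def of_real_0)
  qed
  have const: "f u = f v" if "u \<in> V" "v \<in> V" for u v
  proof (rule harmonic_constant[where V = V and G = G and W = W and f = f])
    show "finite V" by (rule fV)
    show "G \<subseteq> V \<times> V"
      unfolding G_def V_def bratteli_edges_def bratteli_vertices_def by auto
    show "\<forall>u\<in>V. \<forall>v\<in>V. (u, v) \<in> G\<^sup>*"
      using connected unfolding connected_inclusion_def G_def V_def by simp
    show "W u v \<ge> 0" if "u \<in> V" "v \<in> V" for u v
    proof -
      have "Re (tr (p * q)) \<ge> 0" "Re (w q p) \<ge> 0" if "p \<in> A.mcp" "q \<in> B.mcp" for p q
        using Re_nonneg_Reals[OF pq(1)[OF that]] Re_nonneg_Reals[OF w(1)[OF that]] by blast+
      then show ?thesis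
        using that unfolding V_def bratteli_vertices_def W_def by (cases u; cases v) auto
    qed
    show "W u v > 0" if "(u, v) \<in> G" for u v
    proof -
      have "(u, v) \<in> bratteli_edges A B \<or> (v, u) \<in> bratteli_edges A B"
        using that unfolding G_def by blast
      moreover have "\<exists>p q. x = Inl p \<and> y = Inr q" if "(x, y) \<in> bratteli_edges A B" for x y
        using that unfolding bratteli_edges_def mem_Collect_eq prod.inject by metis
      ultimately obtain p q where pq: "(Inl p, Inr q) \<in> bratteli_edges A B"
        and uv: "(u, v) = (Inl p, Inr q) \<or> (u, v) = (Inr q, Inl p)" by metis
      show ?thesis using uv edge[OF pq] by (auto simp: W_def)
    qed
    show "(\<Sum>u\<in>V. complex_of_real (W v u) * (f u - f v)) = 0" if v: "v \<in> V" for v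
    proof (cases v)
      case (Inl p)
      then have p: "p \<in> A.mcp" using v by (auto simp: V_def bratteli_vertices_def)
      have "(\<Sum>q\<in>B.mcp. complex_of_real (Re (tr (p * q))) * (k q - l p)) = 0"
        using mean_A[OF p] Re_nonneg_Reals[OF pq(1)[OF p]] by simp
      then show ?thesis using Inl by (simp add: sumV W_def f_def)
    next
      case (Inr q)
      then have q: "q \<in> B.mcp" using v by (auto simp: V_def bratteli_vertices_def)
      have "(\<Sum>p\<in>A.mcp. complex_of_real (Re (w q p)) * (l p - k q)) = 0"
        using mean_B[OF q] Re_nonneg_Reals[OF w(1)[OF _ q]] by simp
      then show ?thesis using Inr by (simp add: sumV W_def f_def)
    qed
  qed (use that in auto)
  have "\<exists>c. \<forall>q\<in>B.mcp. k q = c"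
  proof (cases "B.mcp = {}")
    case False
    then obtain q0 where "q0 \<in> B.mcp" by blast
    then show ?thesis using const[of "Inr _" "Inr q0"]
      unfolding f_def V_def bratteli_vertices_def by auto
  qed auto
  then obtain c where c: "\<And>q. q \<in> B.mcp \<Longrightarrow> k q = c" by blast
  have proportional: "\<phi> x = c * tr x" if x: "x \<in> B" for x
  proof -
    have x_sum: "x = (\<Sum>q\<in>B.mcp. x * q)"
      using arg_cong[OF B.sum_mcp, of "(*) x"] by (simp add: sum_distrib_left)
    have in_B: "x * q \<in> B" if "q \<in> B.mcp" for q using x B.mcpD(2) that B.closed(4) by simp
    have "\<phi> x = (\<Sum>q\<in>B.mcp. \<phi> (x * q))" using x_sum \<phi>_sum[of B.mcp "\<lambda>q. x * q"] in_B by simp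
    also have "\<dots> = (\<Sum>q\<in>B.mcp. c * tr (x * q))" using k c x by (intro sum.cong) auto
    also have "\<dots> = c * tr x"
      using x_sum B.tr_sum[of B.mcp "\<lambda>q. x * q"] in_B by (simp add: sum_distrib_left)
    finally show ?thesis .
  qed
  have "\<alpha> 1 = 1" by (rule star_automorphism_1[OF \<alpha> B.subalgebra])
  then have "c = 1" using proportional[OF B.closed(3)] B.tr_1 by (simp add: \<phi>_def)
  then show ?thesis using proportional[OF x] by (simp add: \<phi>_def)
qed

section \<open>Extension of automorphisms to the basic construction\<close>

definition conj_op where
  "conj_op \<alpha> \<beta> T = (\<lambda>b\<in>B. \<alpha> (T (\<beta> b)))"

lemma automorphism_commutes_E:
  assumes \<alpha>: "star_automorphism B \<alpha>" and \<alpha>A: "\<alpha> ` A = A"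
    and tr: "\<And>x. x \<in> B \<Longrightarrow> tr (\<alpha> x) = tr x" and b: "b \<in> B"
  shows "\<alpha> (E b) = E (\<alpha> b)"
proof (rule sym, rule E_eqI)
  note D = star_automorphismD[OF \<alpha>]
  show "\<alpha> b \<in> B" using D b by simp
  show "\<alpha> (E b) \<in> A" using \<alpha>A E_in b by blast
  fix c assume "c \<in> A"
  then obtain d where d: "d \<in> A" "c = \<alpha> d" using \<alpha>A by blast
  have "tr (c * \<alpha> b) = tr (d * b)" using D(5) d inB b tr B.closed(4) by metis
  also have "\<dots> = tr (d * E b)" using tr_E_left d b by simp
  also have "\<dots> = tr (c * \<alpha> (E b))" using D(5) d inB b tr B.closed(4) E_inB by metis
  finally show "tr (c * \<alpha> b) = tr (c * \<alpha> (E b))" .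
qed

lemma conj_op_bc:
  assumes \<alpha>: "star_automorphism B \<alpha>" and \<alpha>A: "\<alpha> ` A = A"
    and tr: "\<And>x. x \<in> B \<Longrightarrow> tr (\<alpha> x) = tr x" and \<beta>: "\<And>b. b \<in> B \<Longrightarrow> \<beta> b \<in> B" "\<And>b. b \<in> B \<Longrightarrow> \<alpha> (\<beta> b) = b" "\<And>b. b \<in> B \<Longrightarrow> \<beta> (\<alpha> b) = b"
    and T: "T \<in> basic_construction A B tr"
  shows "conj_op \<alpha> \<beta> T \<in> basic_construction A B tr"
  using T
proof induction
  note D = star_automorphismD[OF \<alpha>]
  {
    case (left_mult x)
    have "conj_op \<alpha> \<beta> (left_mult B x) = left_mult B (\<alpha> x)"
      using \<beta> D left_mult by (auto simp: conj_op_def left_mult_def fun_eq_iff)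
    then show ?case using D(2) left_mult basic_construction.left_mult by metis
  next
    case jones_projection
    have "conj_op \<alpha> \<beta> E = E"
      using \<beta> automorphism_commutes_E[OF \<alpha> \<alpha>A tr]
      by (auto simp: conj_op_def fun_eq_iff E_def jones_projection_def)
    then show ?case using basic_construction.jones_projection by (simp add: E_def)
  next
    case (add S T)
    have "conj_op \<alpha> \<beta> (\<lambda>b\<in>B. S b + T b) = (\<lambda>b\<in>B. conj_op \<alpha> \<beta> S b + conj_op \<alpha> \<beta> T b)"
      using \<beta> D(3) basic_construction_linear add
      by (auto simp: conj_op_def fun_eq_iff)
    then show ?case using add basic_construction.add by metis
  next
    case (scale T c)
    have "conj_op \<alpha> \<beta> (\<lambda>b\<in>B. c *\<^sub>C T b) = (\<lambda>b\<in>B. c *\<^sub>C conj_op \<alpha> \<beta> T b)"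
      using \<beta> D(4) basic_construction_linear scale
      by (auto simp: conj_op_def fun_eq_iff)
    then show ?case using scale basic_construction.scale by metis
  next
    case (compose S T)
    have "conj_op \<alpha> \<beta> (compose B S T) = compose B (conj_op \<alpha> \<beta> S) (conj_op \<alpha> \<beta> T)"
      using \<beta> D(2) basic_construction_linear compose
      by (auto simp: conj_op_def fun_eq_iff compose_def)
    then show ?case using compose basic_construction.compose by metis
  }
qed

lemma \<theta>_surj: "T \<in> basic_construction A B tr \<Longrightarrow> \<exists>x\<in>C. \<theta> x = T"
  using \<theta>(1) unfolding bij_betw_def by (metis imageE)

text \<open>Since \<open>\<alpha>\<close> preserves the trace and \<open>A\<close>, it is a unitary on \<open>L\<^sup>2(B, tr)\<close> that commutes with the
  Jones projection; the extension is conjugation by it.\<close>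

theorem automorphism_extends:
  assumes \<alpha>: "star_automorphism B \<alpha>" and \<alpha>A: "\<alpha> ` A = A"
    and tr: "\<And>x. x \<in> B \<Longrightarrow> tr (\<alpha> x) = tr x"
  obtains \<alpha>' where "star_automorphism C \<alpha>'" "\<And>x. x \<in> B \<Longrightarrow> \<alpha>' x = \<alpha> x" "\<alpha>' e = e"
    "\<And>x. x \<in> C \<Longrightarrow> tr (\<alpha>' x) = tr x"
proof -
  define \<beta> where "\<beta> = the_inv_into B \<alpha>"
  note D = star_automorphismD[OF \<alpha>]
  have \<beta>_aut: "star_automorphism B \<beta>"
    unfolding \<beta>_def by (rule star_automorphism_inverse[OF \<alpha> B.subalgebra])
  note \<beta>D = star_automorphismD[OF \<beta>_aut]
  have \<beta>A: "\<beta> ` A = A"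
    unfolding \<beta>_def by (rule the_inv_into_image[OF D(1) AB \<alpha>A])
  have \<alpha>\<beta>: "\<alpha> (\<beta> y) = y" if "y \<in> B" for y
    unfolding \<beta>_def using star_automorphism_the_inv_into(1)[OF \<alpha> that] .
  have \<beta>\<alpha>: "\<beta> (\<alpha> y) = y" if "y \<in> B" for y
    unfolding \<beta>_def using star_automorphism_the_inv_into(2)[OF \<alpha> that] .
  have tr\<beta>: "tr (\<beta> x) = tr x" if "x \<in> B" for x
    using tr[OF \<beta>D(2)[OF that]] \<alpha>\<beta>[OF that] by simp
  have "\<exists>y\<in>C. \<forall>b\<in>B. \<theta> y b = \<alpha> (\<theta> x (\<beta> b))" if x: "x \<in> C" for x
    using \<theta>_surj[OF conj_op_bc[OF \<alpha> \<alpha>A tr \<beta>D(2) \<alpha>\<beta> \<beta>\<alpha> \<theta>_bc[OF x]]]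
    by (force simp: conj_op_def)
  then obtain \<alpha>' where \<alpha>': "\<And>x. x \<in> C \<Longrightarrow> \<alpha>' x \<in> C" "\<And>x b. x \<in> C \<Longrightarrow> b \<in> B \<Longrightarrow> \<theta> (\<alpha>' x) b = \<alpha> (\<theta> x (\<beta> b))"
    by metis
  have "\<exists>y\<in>C. \<forall>b\<in>B. \<theta> y b = \<beta> (\<theta> x (\<alpha> b))" if x: "x \<in> C" for x
    using \<theta>_surj[OF conj_op_bc[OF \<beta>_aut \<beta>A tr\<beta> D(2) \<beta>\<alpha> \<alpha>\<beta> \<theta>_bc[OF x]]]
    by (force simp: conj_op_def)
  then obtain \<beta>' where \<beta>': "\<And>x. x \<in> C \<Longrightarrow> \<beta>' x \<in> C" "\<And>x b. x \<in> C \<Longrightarrow> b \<in> B \<Longrightarrow> \<theta> (\<beta>' x) b = \<beta> (\<theta> x (\<alpha> b))"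
    by metis
  have "bij_betw \<alpha>' C C"
  proof (rule bij_betw_byWitness[of _ \<beta>'])
    show "\<forall>x\<in>C. \<beta>' (\<alpha>' x) = x"
    proof
      fix x assume x: "x \<in> C"
      show "\<beta>' (\<alpha>' x) = x"
        by (rule \<theta>_inj) (simp_all add: x \<alpha>' \<beta>' \<beta>\<alpha> D(2) \<theta>_in)
    qed
    show "\<forall>x\<in>C. \<alpha>' (\<beta>' x) = x"
    proof
      fix x assume x: "x \<in> C"
      show "\<alpha>' (\<beta>' x) = x"
        by (rule \<theta>_inj) (simp_all add: x \<alpha>' \<beta>' \<alpha>\<beta> \<beta>D(2) \<theta>_in)
    qed
  qed (use \<alpha>' \<beta>' in auto)
  moreover have "\<alpha>' (x + y) = \<alpha>' x + \<alpha>' y" if "x \<in> C" "y \<in> C" for x y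
    by (rule \<theta>_inj) (simp_all add: that \<alpha>' D(2,3) \<beta>D(2) \<theta>_in C.closed(6) \<theta>_app)
  moreover have "\<alpha>' (c *\<^sub>C x) = c *\<^sub>C \<alpha>' x" if "x \<in> C" for c x
    by (rule \<theta>_inj) (simp_all add: that \<alpha>' D(2,4) \<beta>D(2) \<theta>_in C.closed(8) \<theta>_app)
  moreover have mult: "\<alpha>' (x * y) = \<alpha>' x * \<alpha>' y" if "x \<in> C" "y \<in> C" for x y
    by (rule \<theta>_inj) (simp_all add: that \<alpha>' D(2) \<beta>D(2) \<beta>\<alpha> \<theta>_in C.closed(4) \<theta>_app)
  moreover have "\<alpha>' (star x) = star (\<alpha>' x)" if x: "x \<in> C" for x
  proof (rule \<theta>_inj)
    show "\<alpha>' (star x) \<in> C" "star (\<alpha>' x) \<in> C" using x \<alpha>' C.closed(5) by auto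
    fix b assume b: "b \<in> B"
    have sx: "star x \<in> C" using x C.closed(5) by blast
    have "tr (star (\<theta> (\<alpha>' x) a) * b) = tr (star a * \<theta> (\<alpha>' (star x)) b)" if a: "a \<in> B" for a
    proof -
      have "star (\<theta> (\<alpha>' x) a) * b = \<alpha> (star (\<theta> x (\<beta> a)) * \<beta> b)"
        using \<alpha>'(2) x a b D(5,6) \<alpha>\<beta> \<beta>D(2) \<theta>_in B.closed(5) by simp
      then have "tr (star (\<theta> (\<alpha>' x) a) * b) = tr (star (\<theta> x (\<beta> a)) * \<beta> b)"
        using tr x a b \<beta>D(2) \<theta>_in B.closed(4,5) by simp
      also have "\<dots> = tr (star (\<beta> a) * \<theta> (star x) (\<beta> b))"
        using \<theta>(5)[OF x] \<beta>D(2) a b by (simp add: tr_inner_def)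
      also have "\<dots> = tr (\<alpha> (star (\<beta> a) * \<theta> (star x) (\<beta> b)))"
        using tr sx a b \<beta>D(2) \<theta>_in B.closed(4,5) by simp
      also have "\<alpha> (star (\<beta> a) * \<theta> (star x) (\<beta> b)) = star a * \<theta> (\<alpha>' (star x)) b"
        using \<alpha>'(2) sx a b D(5,6) \<alpha>\<beta> \<beta>D(2) \<theta>_in B.closed(5) by simp
      finally show ?thesis .
    qed
    then show "\<theta> (\<alpha>' (star x)) b = \<theta> (star (\<alpha>' x)) b"
      using \<theta>_star_eqI[OF \<alpha>'(1)[OF x] b] \<theta>_in \<alpha>'(1) sx b by metis
  qed
  ultimately have aut: "star_automorphism C \<alpha>'" unfolding star_automorphism_def by blast
  note D' = star_automorphismD[OF aut]
  have ext: "\<alpha>' x = \<alpha> x" if x: "x \<in> B" for x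
    by (rule \<theta>_inj) (simp_all add: x \<alpha>' D(2,5) \<alpha>\<beta> \<beta>D(2) inC \<theta>_app)
  have fix_e: "\<alpha>' e = e"
    by (rule \<theta>_inj)
      (simp_all add: \<alpha>' eC automorphism_commutes_E[OF \<alpha> \<alpha>A tr] \<alpha>\<beta> \<beta>D(2) \<theta>_app)
  have "tr (\<alpha>' x) = tr x" if "x \<in> C" for x
  proof -
    have "x \<in> ideal_e" using that generated by simp
    then show ?thesis
    proof (induction rule: ideal_e_induct)
      case zero
      show ?case using D'(4)[of 0 0] C.closed(2) by simp
    next
      case (step c a b y)
      have y: "y \<in> C" using step ideal_e_sub by blast
      have ab: "a * e * b \<in> C" "a * e \<in> C" using step inC eC C.closed(4) by auto
      have "\<alpha>' (a * e * b) = \<alpha> a * e * \<alpha> b"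
        using step ab(2) inC eC mult fix_e ext by simp
      then have "tr (\<alpha>' (a * e * b)) = complex_of_real \<tau> * tr (\<alpha> (b * a))"
        using tr_mult_e_mult[OF D(2)[OF step(1)] D(2)[OF step(2)]] D(5) step(1,2) by simp
      also have "\<dots> = tr (a * e * b)"
        using tr_mult_e_mult[OF step(1,2)] tr[OF B.closed(4)[OF step(2,1)]] by simp
      finally show ?case
        using D'(2,3,4) y ab(1) step.IH C.closed(8) by (simp add: C.tr_add C.tr_scale)
    qed
  qed
  then show thesis using that aut ext fix_e by blast
qed

end

section \<open>Operators on a complex Hilbert space\<close>

lemma cinner_add_left: "cinner (x + y) z = cinner x z + cinner (y::'h::complex_hilbert_space) z"
  using arg_cong[OF cinner_add_right[of z x y], of cnj] by (simp add: cinner_commute[symmetric])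

lemma cinner_scaleC_left: "cinner (c *\<^sub>C x) y = cnj c * cinner (x::'h::complex_hilbert_space) y"
  using arg_cong[OF cinner_scaleC_right[of y c x], of cnj] by (simp add: cinner_commute[symmetric])

lemma cinner_0_right [simp]: "cinner (x::'h::complex_hilbert_space) 0 = 0"
  using cinner_scaleC_right[of x 0 0] by simp

lemma cinner_0_left [simp]: "cinner 0 (x::'h::complex_hilbert_space) = 0"
  using cinner_scaleC_left[of 0 0 x] by simp

lemma cinner_diff_right: "cinner x (y - z) = cinner x y - cinner (x::'h::complex_hilbert_space) z"
  using cinner_add_right[of x "y - z" z] by simp

lemma cinner_diff_left: "cinner (x - y) z = cinner x z - cinner (y::'h::complex_hilbert_space) z"
  using cinner_add_left[of "x - y" y z] by simp

lemma cinner_scaleR_right: "cinner x (r *\<^sub>R y) = complex_of_real r * cinner (x::'h::complex_hilbert_space) y"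
  using cinner_scaleC_right[of x "complex_of_real r" y] by (simp add: scaleC_of_real)

lemma cinner_scaleR_left: "cinner (r *\<^sub>R x) y = complex_of_real r * cinner (x::'h::complex_hilbert_space) y"
  using cinner_scaleC_left[of "complex_of_real r" x y] by (simp add: scaleC_of_real)

lemmas cinner_simps = cinner_add_left cinner_add_right cinner_diff_left cinner_diff_right
  cinner_scaleC_left cinner_scaleC_right cinner_scaleR_left cinner_scaleR_right

lemma Re_cinner_self: "Re (cinner x x) = (norm (x::'h::complex_hilbert_space))\<^sup>2"
  by (simp add: cinner_self)

lemma Re_cinner_commute: "Re (cinner x y) = Re (cinner (y::'h::complex_hilbert_space) x)"
  by (subst cinner_commute) simp

text \<open>For the identity operator this is the Cauchy-Schwarz inequality of the inner product, on which the
  theory of bounded operators rests; hence the form is given by a merely linear \<open>T\<close>.\<close>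

lemma positive_form_Cauchy_Schwarz:
  fixes T :: "'h::complex_hilbert_space \<Rightarrow> 'h"
  assumes add: "\<And>x y. T (x + y) = T x + T y" and scale: "\<And>c x. T (c *\<^sub>C x) = c *\<^sub>C T x"
    and sa: "\<And>x y. cinner (T x) y = cinner x (T y)"
    and nonneg: "\<And>x. 0 \<le> Re (cinner x (T x))"
  shows "(cmod (cinner x (T y)))\<^sup>2 \<le> Re (cinner x (T x)) * Re (cinner y (T y))"
proof -
  define a where "a = cinner x (T y)"
  have yx: "cinner y (T x) = cnj a" unfolding a_def using sa[of y x] cinner_commute by metis
  have quad: "0 \<le> Re (cinner x (T x)) - 2 * t * (cmod a)\<^sup>2 + t\<^sup>2 * (cmod a)\<^sup>2 * Re (cinner y (T y))" for t
  proof -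
    define c where "c = - complex_of_real t * cnj a"
    have c: "c * a = - complex_of_real (t * (cmod a)\<^sup>2)" "cnj c * c = complex_of_real (t\<^sup>2 * (cmod a)\<^sup>2)"
      by (simp_all add: c_def complex_norm_square[symmetric] power2_eq_square mult_ac)
    have "cinner (x + c *\<^sub>C y) (T (x + c *\<^sub>C y)) =
        cinner x (T x) + c * a + (cnj (c * a) + (cnj c * c) * cinner y (T y))"
      by (simp add: add scale cinner_simps yx a_def algebra_simps)
    then have "Re (cinner (x + c *\<^sub>C y) (T (x + c *\<^sub>C y))) =
        Re (cinner x (T x)) - 2 * t * (cmod a)\<^sup>2 + t\<^sup>2 * (cmod a)\<^sup>2 * Re (cinner y (T y))"
      unfolding c by simp
    then show ?thesis using nonneg by metis
  qed
  define p where "p = Re (cinner y (T y))"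
  define r where "r = Re (cinner x (T x))"
  have quad': "0 \<le> r - 2 * t * (cmod a)\<^sup>2 + t\<^sup>2 * (cmod a)\<^sup>2 * p" for t
    using quad[of t] by (simp add: p_def r_def)
  have "(cmod a)\<^sup>2 \<le> r * p"
  proof (cases "p = 0")
    case True
    have "(cmod a)\<^sup>2 = 0"
    proof (rule ccontr)
      assume ne: "(cmod a)\<^sup>2 \<noteq> 0"
      \<comment> \<open>Without a quadratic term the bound fails for large \<open>t\<close>; this \<open>t\<close> makes it \<open>- r - 2\<close>.\<close>
      then have "0 \<le> r - 2 * ((r + 1) / (cmod a)\<^sup>2) * (cmod a)\<^sup>2"
        using quad'[of "(r + 1) / (cmod a)\<^sup>2"] True by simp
      then have "0 \<le> r - 2 * (r + 1)" using ne by simp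
      moreover have "0 \<le> r" unfolding r_def by (rule nonneg)
      ultimately show False by simp
    qed
    then show ?thesis using True by simp
  next
    case False
    then have p: "p > 0" using nonneg[of y] p_def by linarith
    \<comment> \<open>The minimum of the quadratic polynomial is at \<open>t = 1 / p\<close>.\<close>
    have "0 \<le> r - 2 * (1 / p) * (cmod a)\<^sup>2 + (1 / p)\<^sup>2 * (cmod a)\<^sup>2 * p" by (rule quad')
    also have "\<dots> = r - (cmod a)\<^sup>2 / p" using p by (simp add: field_simps power2_eq_square)
    finally show ?thesis using p by (simp add: field_simps)
  qed
  then show ?thesis by (simp add: a_def p_def r_def)
qed

lemma cinner_Cauchy_Schwarz: "cmod (cinner x y) \<le> norm x * norm (y::'h::complex_hilbert_space)"
proof -
  have "(cmod (cinner x y))\<^sup>2 \<le> Re (cinner x x) * Re (cinner y y)"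
    by (rule positive_form_Cauchy_Schwarz[of "\<lambda>x. x"]) (simp_all add: Re_cinner_self)
  then have "(cmod (cinner x y))\<^sup>2 \<le> (norm x * norm y)\<^sup>2"
    by (simp add: Re_cinner_self power_mult_distrib)
  then show ?thesis by (rule power2_le_imp_le) simp
qed

lemma bounded_bilinear_cinner: "bounded_bilinear (cinner :: 'h::complex_hilbert_space \<Rightarrow> 'h \<Rightarrow> complex)"
proof
  show "\<exists>K. \<forall>a b :: 'h. norm (cinner a b) \<le> norm a * norm b * K"
    by (intro exI[of _ 1] allI) (simp add: cinner_Cauchy_Schwarz)
qed (simp_all add: cinner_simps scaleR_conv_of_real)

lemmas tendsto_cinner = bounded_bilinear.tendsto[OF bounded_bilinear_cinner]

lemma cinner_ext: "(\<And>y. cinner y x = cinner y z) \<Longrightarrow> x = (z::'h::complex_hilbert_space)"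
proof -
  assume "\<And>y. cinner y x = cinner y z"
  then have "cinner (x - z) (x - z) = 0" by (simp add: cinner_diff_right)
  then show ?thesis by (simp add: cinner_self)
qed

lemma norm_add_square:
  "(norm (x + y))\<^sup>2 = (norm x)\<^sup>2 + 2 * Re (cinner x y) + (norm (y::'h::complex_hilbert_space))\<^sup>2"
  unfolding Re_cinner_self[symmetric] using Re_cinner_commute[of x y] by (simp add: cinner_simps)

lemma parallelogram:
  "(norm (x + y))\<^sup>2 + (norm (x - y))\<^sup>2 = 2 * (norm x)\<^sup>2 + 2 * (norm (y::'h::complex_hilbert_space))\<^sup>2"
  unfolding Re_cinner_self[symmetric] by (simp add: cinner_simps)

text \<open>The functional is represented by a multiple of the element of least norm on which it is \<open>1\<close>.\<close>

lemma riesz_representation: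
  fixes f :: "'h::complex_hilbert_space \<Rightarrow> complex"
  assumes add: "\<And>x y. f (x + y) = f x + f y" and scale: "\<And>c x. f (c *\<^sub>C x) = c * f x"
    and bound: "\<And>x. cmod (f x) \<le> K * norm x"
  obtains z where "\<And>x. f x = cinner z x"
proof (cases "\<forall>x. f x = 0")
  case True
  then show thesis using that[of 0] by simp
next
  case False
  then obtain x0 where x0: "f x0 \<noteq> 0" by blast
  have f_scaleR: "f (r *\<^sub>R x) = r *\<^sub>R f x" for r x
    using scale[of "complex_of_real r" x] by (simp add: scaleC_of_real scaleR_conv_of_real)
  have bl: "bounded_linear f"
    by (rule bounded_linear_intro[of _ K]) (auto simp: add f_scaleR bound mult.commute)
  define X where "X = {x. f x = 1}"
  have "(1 / f x0) *\<^sub>C x0 \<in> X" using x0 by (simp add: X_def scale)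
  then have X: "X \<noteq> {}" by blast
  define d where "d = Inf (norm ` X)"
  have bdd: "bdd_below (norm ` X)" by (intro bdd_belowI[of _ 0]) auto
  have d_le: "d \<le> norm x" if "x \<in> X" for x
    unfolding d_def using that bdd by (intro cInf_lower) auto
  have d0: "0 \<le> d" unfolding d_def using X by (intro cInf_greatest) auto
  have "\<exists>x\<in>X. norm x < d + 1 / real (Suc n)" for n
  proof -
    have "d < d + 1 / real (Suc n)" by simp
    moreover have "norm ` X \<noteq> {}" using X by simp
    ultimately show ?thesis unfolding d_def cInf_less_iff[OF \<open>norm ` X \<noteq> {}\<close> bdd] by blast
  qed
  then obtain s where s: "\<And>n. s n \<in> X" "\<And>n. norm (s n) < d + 1 / real (Suc n)" by metis
  have "(\<lambda>n. d + 1 / real (Suc n)) \<longlonglongrightarrow> d + 0"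
    by (intro tendsto_add tendsto_const LIMSEQ_Suc[OF lim_1_over_n])
  then have "(\<lambda>n. (d + 1 / real (Suc n))\<^sup>2) \<longlonglongrightarrow> (d + 0)\<^sup>2"
    by (rule tendsto_power)
  then have lim: "(\<lambda>n. (d + 1 / real (Suc n))\<^sup>2) \<longlonglongrightarrow> d\<^sup>2"
    by simp
  have "Cauchy s"
  proof (rule metric_CauchyI)
    fix \<epsilon> :: real assume \<epsilon>: "\<epsilon> > 0"
    have "\<forall>\<^sub>F n in sequentially. (d + 1 / real (Suc n))\<^sup>2 < d\<^sup>2 + \<epsilon>\<^sup>2 / 4"
      using \<epsilon> by (intro order_tendstoD(2)[OF lim]) simp
    then obtain M where M: "\<And>n. n \<ge> M \<Longrightarrow> (d + 1 / real (Suc n))\<^sup>2 < d\<^sup>2 + \<epsilon>\<^sup>2 / 4"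
      unfolding eventually_sequentially by blast
    have close: "(norm (s n))\<^sup>2 < d\<^sup>2 + \<epsilon>\<^sup>2 / 4" if "n \<ge> M" for n
      using power_mono[of "norm (s n)" "d + 1 / real (Suc n)" 2] s(2)[of n] M[OF that] by simp
    show "\<exists>M. \<forall>m\<ge>M. \<forall>n\<ge>M. dist (s m) (s n) < \<epsilon>"
    proof (intro exI allI impI)
      fix m n assume mn: "m \<ge> M" "n \<ge> M"
      define c where "c = (1/2) *\<^sub>R (s m + s n)"
      have "c \<in> X" using s(1)[of m] s(1)[of n] by (simp add: X_def c_def f_scaleR add scaleR_conv_of_real)
      then have "d\<^sup>2 \<le> (norm c)\<^sup>2" using d_le d0 by (simp add: power_mono)
      moreover have "norm c = norm (s m + s n) / 2" by (simp add: c_def)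
      ultimately have "4 * d\<^sup>2 \<le> (norm (s m + s n))\<^sup>2" by (simp add: power_divide)
      then have "(norm (s m - s n))\<^sup>2 < \<epsilon>\<^sup>2"
        using parallelogram[of "s m" "s n"] close[OF mn(1)] close[OF mn(2)] by linarith
      then show "dist (s m) (s n) < \<epsilon>"
        unfolding dist_norm by (rule power_less_imp_less_base) (use \<epsilon> in simp)
    qed
  qed
  then obtain w where w: "s \<longlonglongrightarrow> w" by (auto simp: Cauchy_convergent_iff convergent_def)
  have fw: "f w = 1"
    using LIMSEQ_unique[OF bounded_linear.tendsto[OF bl w]] s(1) by (simp add: X_def)
  have "(\<lambda>n. (norm (s n))\<^sup>2) \<longlonglongrightarrow> (norm w)\<^sup>2" by (intro tendsto_power tendsto_norm w)
  then have w_le: "(norm w)\<^sup>2 \<le> d\<^sup>2"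
    by (rule LIMSEQ_le[OF _ lim]) (use s(2) less_imp_le in \<open>auto intro!: power_mono exI[of _ 0]\<close>)
  have perp: "cinner w v = 0" if v: "f v = 0" for v
  proof (cases "v = 0")
    case False
    define a where "a = cinner w v"
    \<comment> \<open>The scalar \<open>c\<close> minimizes the norm of \<open>w + c v\<close>.\<close>
    define t where "t = 1 / (norm v)\<^sup>2"
    define c where "c = - complex_of_real t * cnj a"
    have "w + c *\<^sub>C v \<in> X" using fw v by (simp add: X_def add scale)
    then have "d\<^sup>2 \<le> (norm (w + c *\<^sub>C v))\<^sup>2" using d_le d0 by (simp add: power_mono)
    then have "0 \<le> 2 * Re (c * a) + (norm (c *\<^sub>C v))\<^sup>2"
      using w_le unfolding norm_add_square by (simp add: cinner_simps a_def)
    moreover have t: "t > 0" using False by (simp add: t_def)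
    moreover have "c * a = - complex_of_real (t * (cmod a)\<^sup>2)"
      by (simp add: c_def complex_norm_square[symmetric] power2_eq_square mult_ac)
    then have "Re (c * a) = - t * (cmod a)\<^sup>2" by simp
    moreover have "(norm (c *\<^sub>C v))\<^sup>2 = t * (cmod a)\<^sup>2"
    proof -
      have "norm (c *\<^sub>C v) = t * cmod a * norm v"
        using t by (simp add: norm_scaleC c_def norm_mult)
      then have "(norm (c *\<^sub>C v))\<^sup>2 = t * (cmod a)\<^sup>2 * (t * (norm v)\<^sup>2)"
        by (simp add: power2_eq_square)
      then show ?thesis using False by (simp add: t_def)
    qed
    ultimately have "t * (cmod a)\<^sup>2 \<le> 0" "t > 0" by linarith+
    then have "(cmod a)\<^sup>2 \<le> 0" by (simp add: mult_le_0_iff)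
    then show ?thesis by (simp add: a_def)
  qed simp
  have w0: "norm w \<noteq> 0" using fw scale[of 0 0] by auto
  have "f x = cinner ((1 / (norm w)\<^sup>2) *\<^sub>R w) x" for x
  proof -
    have "f (x + (- f x) *\<^sub>C w) = 0" using fw by (simp only: add scale) simp
    then have "cinner w x = f x * cinner w w" using perp[of "x + (- f x) *\<^sub>C w"] by (simp add: cinner_simps)
    then show ?thesis using w0 by (simp add: cinner_simps cinner_self)
  qed
  then show thesis using that by blast
qed

lemma bounded_operatorsD:
  assumes "T \<in> bounded_operators"
  shows "bounded_linear T" "T (x + y) = T x + T y" "T (x - y) = T x - T y"
    "T (c *\<^sub>C x) = c *\<^sub>C T x" "T (r *\<^sub>R x) = r *\<^sub>R T x" "T 0 = 0"
proof -
  show bl: "bounded_linear T" and "T (c *\<^sub>C x) = c *\<^sub>C T x"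
    using assms by (auto simp: bounded_operators_def)
  show "T (x + y) = T x + T y" "T (x - y) = T x - T y" "T (r *\<^sub>R x) = r *\<^sub>R T x" "T 0 = 0"
    using bl by (simp_all add: linear_simps)
qed

lemma bounded_operators_bound:
  assumes "T \<in> bounded_operators"
  obtains K where "K > 0" "\<And>x. norm (T x) \<le> K * norm x"
  using bounded_linear.pos_bounded[OF bounded_operatorsD(1)[OF assms]] that by (auto simp: mult.commute)

lemma bounded_operatorsI:
  assumes "\<And>x y. T (x + y) = T x + T y" "\<And>c x. T (c *\<^sub>C x) = c *\<^sub>C T x"
    "\<And>x. norm (T x) \<le> K * norm x"
  shows "T \<in> bounded_operators"
proof -
  have "bounded_linear T"
    using assms(1,3) assms(2)[of "complex_of_real _"]
    by (intro bounded_linear_intro[of _ K]) (auto simp: scaleC_of_real mult.commute)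
  then show ?thesis using assms(2) by (simp add: bounded_operators_def)
qed

lemma bounded_operators_id: "(\<lambda>x. x) \<in> bounded_operators"
  by (simp add: bounded_operators_def bounded_linear_ident)

lemma bounded_operators_add:
  "S \<in> bounded_operators \<Longrightarrow> T \<in> bounded_operators \<Longrightarrow> (\<lambda>x. S x + T x) \<in> bounded_operators"
  by (simp add: bounded_operators_def bounded_linear_add scaleC_simps)

lemma bounded_operators_diff:
  "S \<in> bounded_operators \<Longrightarrow> T \<in> bounded_operators \<Longrightarrow> (\<lambda>x. S x - T x) \<in> bounded_operators"
  by (simp add: bounded_operators_def bounded_linear_sub scaleC_simps)

lemma bounded_operators_scale:
  assumes "T \<in> bounded_operators" shows "(\<lambda>x. c *\<^sub>C T x) \<in> bounded_operators"
proof -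
  obtain K where K: "\<And>x. norm (T x) \<le> K * norm x" using bounded_operators_bound assms by metis
  show ?thesis
  proof (rule bounded_operatorsI)
    show "norm (c *\<^sub>C T x) \<le> (cmod c * K) * norm x" for x
      using mult_left_mono[OF K[of x], of "cmod c"] by (simp add: norm_scaleC mult.assoc)
  qed (use bounded_operatorsD[OF assms] in \<open>simp_all add: scaleC_simps complex_vector.scale_left_commute\<close>)
qed

lemma bounded_operators_comp:
  "S \<in> bounded_operators \<Longrightarrow> T \<in> bounded_operators \<Longrightarrow> S \<circ> T \<in> bounded_operators"
  by (auto simp: bounded_operators_def o_def intro: bounded_linear_compose)

lemma adjoint_op:
  fixes T :: "'h::complex_hilbert_space \<Rightarrow> 'h"
  assumes T: "T \<in> bounded_operators"
  shows "cinner (T x) y = cinner x (adjoint_op T y)"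
    and "(\<And>x y. cinner (T x) y = cinner x (S y)) \<Longrightarrow> adjoint_op T = S"
    and "adjoint_op T \<in> bounded_operators"
proof -
  note D = bounded_operatorsD[OF T]
  obtain K where K: "K > 0" "\<And>x. norm (T x) \<le> K * norm x" by (rule bounded_operators_bound[OF T]) blast
  have "\<exists>z. \<forall>x. cinner y (T x) = cinner z x" for y
  proof (rule riesz_representation)
    show "cmod (cinner y (T x)) \<le> (norm y * K) * norm x" for x
      using cinner_Cauchy_Schwarz[of y "T x"] mult_left_mono[OF K(2)[of x], of "norm y"]
      by (simp add: mult.assoc)
    show "cinner y (T (x + z)) = cinner y (T x) + cinner y (T z)" for x z
      by (simp add: D cinner_simps)
    show "cinner y (T (c *\<^sub>C x)) = c * cinner y (T x)" for c x
      by (simp add: D cinner_simps)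
  qed blast
  then obtain S where S: "\<And>x y. cinner y (T x) = cinner (S y) x" by metis
  then have S': "cinner (T x) y = cinner x (S y)" for x y using cinner_commute by metis
  have uniq: "S1 = S2" if "\<And>x y. cinner (T x) y = cinner x (S1 y)" "\<And>x y. cinner (T x) y = cinner x (S2 y)"
    for S1 S2
    using that by (metis cinner_ext ext)
  have "\<exists>!S. \<forall>\<xi> \<eta>. cinner (T \<xi>) \<eta> = cinner \<xi> (S \<eta>)" using S' uniq by blast
  from theI'[OF this] have adj: "\<And>x y. cinner (T x) y = cinner x (adjoint_op T y)"
    unfolding adjoint_op_def by blast
  show "cinner (T x) y = cinner x (adjoint_op T y)" by (rule adj)
  show "adjoint_op T = S" if "\<And>x y. cinner (T x) y = cinner x (S y)" for S
    using uniq adj that by blast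
  show "adjoint_op T \<in> bounded_operators"
  proof (rule bounded_operatorsI)
    show "adjoint_op T (x + y) = adjoint_op T x + adjoint_op T y" for x y
      by (rule cinner_ext) (simp add: cinner_simps adj[symmetric])
    show "adjoint_op T (c *\<^sub>C x) = c *\<^sub>C adjoint_op T x" for c x
      by (rule cinner_ext) (simp add: cinner_simps adj[symmetric])
    show "norm (adjoint_op T x) \<le> K * norm x" for x
    proof (cases "adjoint_op T x = 0")
      case False
      have "(norm (adjoint_op T x))\<^sup>2 = Re (cinner (T (adjoint_op T x)) x)"
        by (simp add: adj cinner_self)
      also have "\<dots> \<le> norm (T (adjoint_op T x)) * norm x"
        using cinner_Cauchy_Schwarz complex_Re_le_cmod order_trans by blast
      also have "\<dots> \<le> K * norm (adjoint_op T x) * norm x"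
        using K(2) by (simp add: mult_right_mono)
      finally show ?thesis using False by (simp add: power2_eq_square mult_ac)
    qed (use K in simp)
  qed
qed

lemma adjoint_op_right:
  fixes T :: "'h::complex_hilbert_space \<Rightarrow> 'h"
  assumes "T \<in> bounded_operators" shows "cinner x (T y) = cinner (adjoint_op T x) y"
  using adjoint_op(1)[OF assms, of y x] cinner_commute by metis

lemma adjoint_op_comp:
  assumes "S \<in> bounded_operators" "T \<in> bounded_operators"
  shows "adjoint_op (S \<circ> T) = adjoint_op T \<circ> adjoint_op S"
  by (rule adjoint_op(2)[OF bounded_operators_comp[OF assms]]) (simp add: adjoint_op(1) assms)

subsection \<open>Commutants\<close>

lemma commutantD:
  assumes "T \<in> commutant X"
  shows "T \<in> bounded_operators" "S \<in> X \<Longrightarrow> T (S x) = S (T x)"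
  using assms by (auto simp: commutant_def fun_eq_iff)

lemma commutantI:
  assumes "T \<in> bounded_operators" "\<And>S x. S \<in> X \<Longrightarrow> T (S x) = S (T x)"
  shows "T \<in> commutant X"
  using assms by (auto simp: commutant_def fun_eq_iff)

lemma commutant_antimono: "X \<subseteq> Y \<Longrightarrow> commutant Y \<subseteq> commutant X"
  by (auto simp: commutant_def)

lemma double_commutant_superset: "X \<subseteq> bounded_operators \<Longrightarrow> X \<subseteq> commutant (commutant X)"
  by (fastforce simp: commutant_def fun_eq_iff)

lemma commutant_bounded: "commutant X \<subseteq> bounded_operators"
  by (auto simp: commutant_def)

lemma commutant_closed:
  assumes X: "X \<subseteq> bounded_operators"
  shows "(\<lambda>x. x) \<in> commutant X"
    "S \<in> commutant X \<Longrightarrow> T \<in> commutant X \<Longrightarrow> (\<lambda>x. S x + T x) \<in> commutant X"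
    "S \<in> commutant X \<Longrightarrow> T \<in> commutant X \<Longrightarrow> (\<lambda>x. S x - T x) \<in> commutant X"
    "T \<in> commutant X \<Longrightarrow> (\<lambda>x. c *\<^sub>C T x) \<in> commutant X"
    "S \<in> commutant X \<Longrightarrow> T \<in> commutant X \<Longrightarrow> S \<circ> T \<in> commutant X"
proof -
  have XD: "S \<in> X \<Longrightarrow> S \<in> bounded_operators" for S using X by blast
  show "(\<lambda>x. x) \<in> commutant X" by (rule commutantI) (simp_all add: bounded_operators_id)
  show "(\<lambda>x. S x + T x) \<in> commutant X" if "S \<in> commutant X" "T \<in> commutant X"
    by (rule commutantI)
      (simp_all add: bounded_operators_add commutantD[OF that(1)] commutantD[OF that(2)]
        bounded_operatorsD(2)[OF XD])
  show "(\<lambda>x. S x - T x) \<in> commutant X" if "S \<in> commutant X" "T \<in> commutant X"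
    by (rule commutantI)
      (simp_all add: bounded_operators_diff commutantD[OF that(1)] commutantD[OF that(2)]
        bounded_operatorsD(3)[OF XD])
  show "(\<lambda>x. c *\<^sub>C T x) \<in> commutant X" if "T \<in> commutant X"
    by (rule commutantI)
      (simp_all add: bounded_operators_scale commutantD[OF that] bounded_operatorsD(4)[OF XD])
  show "S \<circ> T \<in> commutant X" if "S \<in> commutant X" "T \<in> commutant X"
    by (rule commutantI)
      (simp_all add: bounded_operators_comp commutantD[OF that(1)] commutantD[OF that(2)])
qed

lemma commutant_strong_limit:
  assumes X: "X \<subseteq> bounded_operators" and F: "\<And>n. F n \<in> commutant X" and T: "T \<in> bounded_operators"
    and lim: "\<And>x. (\<lambda>n. F n x) \<longlonglongrightarrow> T x"
  shows "T \<in> commutant X"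
proof (rule commutantI[OF T])
  fix S x assume S: "S \<in> X"
  have "(\<lambda>n. S (F n x)) \<longlonglongrightarrow> S (T x)"
    using bounded_linear.tendsto[OF bounded_operatorsD(1) lim] S X by blast
  moreover have "(\<lambda>n. F n (S x)) \<longlonglongrightarrow> T (S x)" by (rule lim)
  moreover have "F n (S x) = S (F n x)" for n using commutantD(2)[OF F S] .
  ultimately show "T (S x) = S (T x)" using LIMSEQ_unique by simp
qed

lemma commutant_inverse:
  assumes "B \<in> commutant X" "G \<in> bounded_operators" "\<And>x. B (G x) = x" "\<And>x. G (B x) = x"
  shows "G \<in> commutant X"
proof (rule commutantI[OF assms(2)])
  fix S x assume S: "S \<in> X"
  have "G (S x) = G (S (B (G x)))" by (simp add: assms(3))
  also have "S (B (G x)) = B (S (G x))" using commutantD(2)[OF assms(1) S] by simp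
  finally show "G (S x) = S (G x)" by (simp add: assms(4))
qed

lemma commutant_adjoint:
  assumes X: "X \<subseteq> bounded_operators" "\<And>S. S \<in> X \<Longrightarrow> adjoint_op S \<in> X" and T: "T \<in> commutant X"
  shows "adjoint_op T \<in> commutant X"
proof -
  have TB: "T \<in> bounded_operators" by (rule commutantD(1)[OF T])
  show ?thesis
  proof (rule commutantI[OF adjoint_op(3)[OF TB]])
    fix S x assume S: "S \<in> X"
    then have SB: "S \<in> bounded_operators" using X by blast
    have "cinner y (adjoint_op T (S x)) = cinner y (S (adjoint_op T x))" for y
      using commutantD(2)[OF T X(2)[OF S]] adjoint_op(1)[OF TB] adjoint_op_right[OF SB] by metis
    then show "adjoint_op T (S x) = S (adjoint_op T x)" by (rule cinner_ext)
  qed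
qed

text \<open>A double commutant is its own double commutant, since \<open>X''' = X'\<close>; and every von Neumann algebra that
  contains \<open>X\<close> contains \<open>X''\<close>.\<close>

lemma generated_von_neumann_algebra_eq:
  assumes X: "X \<subseteq> bounded_operators" "\<And>S. S \<in> X \<Longrightarrow> adjoint_op S \<in> X"
  shows "generated_von_neumann_algebra X = commutant (commutant X)"
proof
  have adj: "adjoint_op T \<in> commutant X" if "T \<in> commutant X" for T
    by (rule commutant_adjoint[OF X that])
  have "von_neumann_algebra (commutant (commutant X))"
    unfolding von_neumann_algebra_def
  proof (intro conjI ballI)
    show "commutant (commutant X) \<subseteq> bounded_operators" by (rule commutant_bounded)
    show "adjoint_op T \<in> commutant (commutant X)" if "T \<in> commutant (commutant X)" for T
      by (rule commutant_adjoint[OF commutant_bounded adj that])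
    show "commutant (commutant (commutant (commutant X))) = commutant (commutant X)"
      using double_commutant_superset[OF commutant_bounded]
        commutant_antimono[OF double_commutant_superset[OF commutant_bounded]] by blast
  qed
  moreover have "X \<subseteq> commutant (commutant X)" by (rule double_commutant_superset[OF X(1)])
  ultimately show "generated_von_neumann_algebra X \<subseteq> commutant (commutant X)"
    unfolding generated_von_neumann_algebra_def by blast
  show "commutant (commutant X) \<subseteq> generated_von_neumann_algebra X"
    unfolding generated_von_neumann_algebra_def
  proof (intro Inter_greatest)
    fix Y assume "Y \<in> {Y. von_neumann_algebra Y \<and> X \<subseteq> Y}"
    then have Y: "commutant (commutant Y) = Y" "X \<subseteq> Y" by (auto simp: von_neumann_algebra_def)
    have "commutant (commutant X) \<subseteq> commutant (commutant Y)"
      by (intro commutant_antimono Y(2))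
    then show "commutant (commutant X) \<subseteq> Y" using Y(1) by simp
  qed
qed

subsection \<open>Positive operators\<close>

definition positive_op :: "('h::complex_hilbert_space \<Rightarrow> 'h) \<Rightarrow> bool" where
  "positive_op T \<longleftrightarrow> T \<in> bounded_operators \<and> (\<forall>x y. cinner (T x) y = cinner x (T y)) \<and>
     (\<forall>x. 0 \<le> Re (cinner x (T x)))"

lemma positive_opD:
  assumes "positive_op T"
  shows "T \<in> bounded_operators" "cinner (T x) y = cinner x (T y)" "0 \<le> Re (cinner x (T x))"
  using assms by (auto simp: positive_op_def)

lemma positive_op_Cauchy_Schwarz:
  assumes "positive_op T"
  shows "(cmod (cinner x (T y)))\<^sup>2 \<le> Re (cinner x (T x)) * Re (cinner y (T y))"
  using positive_form_Cauchy_Schwarz bounded_operatorsD(2,4)[OF positive_opD(1)[OF assms]]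
    positive_opD(2,3)[OF assms] by blast

text \<open>The Cauchy-Schwarz inequality for the form of \<open>T\<close> at the vectors \<open>T x\<close> and \<open>x\<close>.\<close>

lemma positive_op_norm_square:
  assumes T: "positive_op T" and c: "\<And>x. Re (cinner x (T x)) \<le> c * (norm x)\<^sup>2"
  shows "(norm (T x))\<^sup>2 \<le> c * Re (cinner x (T x))"
proof (cases "T x = 0")
  case True
  have "0 \<le> c * Re (cinner x (T x))" using True by simp
  then show ?thesis using True by simp
next
  case False
  have "((norm (T x))\<^sup>2)\<^sup>2 = (cmod (cinner (T x) (T x)))\<^sup>2" by (simp add: cinner_self norm_power)
  also have "\<dots> \<le> Re (cinner (T x) (T (T x))) * Re (cinner x (T x))"
    by (rule positive_op_Cauchy_Schwarz[OF T])
  also have "\<dots> \<le> c * (norm (T x))\<^sup>2 * Re (cinner x (T x))"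
    by (intro mult_right_mono c positive_opD(3)[OF T])
  finally have "(norm (T x))\<^sup>2 * (norm (T x))\<^sup>2 \<le> (c * Re (cinner x (T x))) * (norm (T x))\<^sup>2"
    by (simp add: power2_eq_square mult_ac)
  moreover have "(norm (T x))\<^sup>2 > 0" using False by simp
  ultimately show ?thesis by (rule mult_right_le_imp_le)
qed

text \<open>For a large constant \<open>K\<close> the operator \<open>1 - B / K\<close> is a contraction, so that
  \<open>x = y / K + (1 - B / K) x\<close> has a unique solution.\<close>

lemma coercive_inverse:
  fixes B :: "'h::complex_hilbert_space \<Rightarrow> 'h"
  assumes B: "B \<in> bounded_operators" and sa: "\<And>x y. cinner (B x) y = cinner x (B y)"
    and coercive: "\<And>x. \<delta> * (norm x)\<^sup>2 \<le> Re (cinner x (B x))" and \<delta>: "\<delta> > 0"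
  obtains G where "positive_op G" "\<And>x. B (G x) = x" "\<And>x. G (B x) = x"
proof -
  note D = bounded_operatorsD[OF B]
  obtain K0 where K0: "K0 > 0" "\<And>x. norm (B x) \<le> K0 * norm x" by (rule bounded_operators_bound[OF B]) blast
  define K where "K = max K0 \<delta>"
  have K: "K > 0" "\<delta> \<le> K" using K0 by (auto simp: K_def)
  have K_bound: "norm (B x) \<le> K * norm x" for x
    using K0(2)[of x] mult_right_mono[of K0 K "norm x"] by (simp add: K_def)
  define T where "T = (\<lambda>x. x - (1/K) *\<^sub>R B x)"
  have T_form: "Re (cinner x (T x)) = (norm x)\<^sup>2 - Re (cinner x (B x)) / K" for x
    by (simp add: T_def cinner_simps Re_cinner_self)
  have TB: "T \<in> bounded_operators"
    unfolding T_def using bounded_operators_diff[OF bounded_operators_id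
        bounded_operators_scale[OF B, of "complex_of_real (1/K)"]]
    by (simp only: scaleC_of_real)
  have "positive_op T"
    unfolding positive_op_def
  proof (intro conjI allI TB)
    show "cinner (T x) y = cinner x (T y)" for x y by (simp add: T_def cinner_simps sa)
    fix x
    have "Re (cinner x (B x)) \<le> norm x * norm (B x)"
      using cinner_Cauchy_Schwarz[of x "B x"] complex_Re_le_cmod[of "cinner x (B x)"] by linarith
    also have "\<dots> \<le> norm x * (K * norm x)" by (intro mult_left_mono K_bound) simp
    finally have "Re (cinner x (B x)) \<le> K * (norm x)\<^sup>2" by (simp add: power2_eq_square mult_ac)
    then show "0 \<le> Re (cinner x (T x))" unfolding T_form using K by (simp add: field_simps)
  qed
  moreover have T_le: "Re (cinner x (T x)) \<le> (1 - \<delta> / K) * (norm x)\<^sup>2" for x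
    unfolding T_form using coercive[of x] K by (simp add: field_simps)
  ultimately have "(norm (T x))\<^sup>2 \<le> (1 - \<delta> / K) * Re (cinner x (T x))" for x
    by (rule positive_op_norm_square)
  also have "\<And>x. (1 - \<delta> / K) * Re (cinner x (T x)) \<le> ((1 - \<delta> / K) * norm x)\<^sup>2"
    using mult_left_mono[OF T_le, of "1 - \<delta> / K"] K by (simp add: power2_eq_square mult_ac)
  finally have "(norm (T x))\<^sup>2 \<le> ((1 - \<delta> / K) * norm x)\<^sup>2" for x by simp
  then have contr: "norm (T x) \<le> (1 - \<delta> / K) * norm x" for x
    by (rule power2_le_imp_le) (use K in simp)
  have "\<exists>x. B x = y" for y
  proof -
    define f where "f = (\<lambda>x. (1/K) *\<^sub>R y + T x)"
    have "\<exists>!x. f x = x"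
    proof (rule banach_fix_type)
      show "0 \<le> 1 - \<delta> / K" "1 - \<delta> / K < 1" using K \<delta> by auto
      show "\<forall>x z. dist (f x) (f z) \<le> (1 - \<delta> / K) * dist x z"
      proof (intro allI)
        show "dist (f x) (f z) \<le> (1 - \<delta> / K) * dist x z" for x z
          using contr[of "x - z"] by (simp add: f_def dist_norm bounded_operatorsD(3)[OF TB])
      qed
    qed
    then obtain x where "f x = x" by blast
    then have "(1/K) *\<^sub>R (y - B x) = 0" by (simp add: f_def T_def scaleR_diff_right)
    then show ?thesis using K by auto
  qed
  then obtain G where BG: "\<And>y. B (G y) = y" by metis
  have lower: "\<delta> * norm x \<le> norm (B x)" for x
  proof (cases "x = 0")
    case False
    have "\<delta> * (norm x)\<^sup>2 \<le> norm x * norm (B x)"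
      using coercive[of x] cinner_Cauchy_Schwarz[of x "B x"] complex_Re_le_cmod[of "cinner x (B x)"]
      by linarith
    then show ?thesis using False by (simp add: power2_eq_square)
  qed simp
  have inj: "x = z" if "B x = B z" for x z
    using lower[of "x - z"] that \<delta> D(3) by (simp add: mult_le_0_iff)
  have GB: "G (B x) = x" for x by (rule inj) (rule BG)
  have G: "G \<in> bounded_operators"
  proof (rule bounded_operatorsI)
    show "G (x + y) = G x + G y" for x y by (rule inj) (simp add: BG D)
    show "G (c *\<^sub>C x) = c *\<^sub>C G x" for c x by (rule inj) (simp add: BG D)
    show "norm (G x) \<le> (1 / \<delta>) * norm x" for x
      using lower[of "G x"] \<delta> by (simp add: BG field_simps)
  qed
  have "positive_op G"
    unfolding positive_op_def
  proof (intro conjI allI G)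
    show "cinner (G x) y = cinner x (G y)" for x y
      using sa[of "G x" "G y"] by (simp add: BG)
    show "0 \<le> Re (cinner x (G x))" for x
    proof -
      have "Re (cinner x (G x)) = Re (cinner (G x) (B (G x)))"
        using sa[of "G x" "G x"] by (simp add: BG)
      then show ?thesis using coercive[of "G x"] \<delta> by (smt (verit) mult_nonneg_nonneg zero_le_power2)
    qed
  qed
  then show thesis using that BG GB by blast
qed

text \<open>Variational characterization: \<open>\<langle>x, B\<^sup>-\<^sup>1 x\<rangle>\<close> is the maximum of the right hand side over \<open>y\<close>,
  attained at \<open>y = B\<^sup>-\<^sup>1 x\<close>.\<close>

lemma inverse_variational:
  assumes B: "positive_op B" and BG: "\<And>x. B (G x) = x"
  shows "2 * Re (cinner x y) - Re (cinner y (B y)) \<le> Re (cinner x (G x))"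
proof -
  define u where "u = G x"
  have x: "x = B u" by (simp add: u_def BG)
  have "0 \<le> Re (cinner (u - y) (B (u - y)))" by (rule positive_opD(3)[OF B])
  also have "\<dots> = Re (cinner u (B u)) - Re (cinner u (B y)) - Re (cinner y (B u)) + Re (cinner y (B y))"
    by (simp add: bounded_operatorsD(3)[OF positive_opD(1)[OF B]] cinner_simps)
  also have "Re (cinner u (B y)) = Re (cinner (B u) y)" by (simp add: positive_opD(2)[OF B])
  also have "Re (cinner y (B u)) = Re (cinner (B u) y)" by (rule Re_cinner_commute)
  also have "Re (cinner u (B u)) = Re (cinner (B u) u)" by (simp add: positive_opD(2)[OF B])
  finally have "2 * Re (cinner (B u) y) - Re (cinner y (B y)) \<le> Re (cinner (B u) u)" by linarith
  then show ?thesis unfolding x[symmetric] by (simp add: u_def)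
qed

lemma inverse_antimono:
  assumes B1: "positive_op B1" "\<And>x. B1 (G1 x) = x" and B2: "positive_op B2" "\<And>x. B2 (G2 x) = x"
    and le: "\<And>x. Re (cinner x (B1 x)) \<le> Re (cinner x (B2 x))"
  shows "Re (cinner x (G2 x)) \<le> Re (cinner x (G1 x))"
proof -
  have "Re (cinner (G2 x) x) = Re (cinner x (G2 x))" by (rule Re_cinner_commute)
  then have "Re (cinner x (G2 x)) = 2 * Re (cinner x (G2 x)) - Re (cinner (G2 x) (B2 (G2 x)))"
    by (simp add: B2)
  also have "\<dots> \<le> 2 * Re (cinner x (G2 x)) - Re (cinner (G2 x) (B1 (G2 x)))" using le by simp
  also have "\<dots> \<le> Re (cinner x (G1 x))" by (rule inverse_variational[OF B1])
  finally show ?thesis .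
qed

text \<open>With \<open>u = H x\<close>, the Cauchy-Schwarz inequality for the form of \<open>H\<close> gives
  \<open>\<langle>B u, H x\<rangle>\<^sup>2 \<le> \<langle>B u, H B u\<rangle> \<langle>x, H x\<rangle> \<le> \<langle>B u, u\<rangle> \<langle>x, H x\<rangle>\<close>.\<close>

lemma sandwich_le:
  assumes H: "positive_op H" and B: "positive_op B" and G: "\<And>x. G (B x) = x"
    and le: "\<And>x. Re (cinner x (H x)) \<le> Re (cinner x (G x))"
  shows "Re (cinner (H x) (B (H x))) \<le> Re (cinner x (H x))"
proof -
  define u where "u = H x"
  define b where "b = Re (cinner u (B u))"
  have b0: "0 \<le> b" unfolding b_def by (rule positive_opD(3)[OF B])
  have "Re (cinner (B u) (H x)) = b"
    unfolding b_def u_def by (rule Re_cinner_commute)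
  then have "b \<le> cmod (cinner (B u) (H x))" using complex_Re_le_cmod by metis
  then have "b\<^sup>2 \<le> (cmod (cinner (B u) (H x)))\<^sup>2" using b0 by (rule power_mono)
  also have "\<dots> \<le> Re (cinner (B u) (H (B u))) * Re (cinner x (H x))"
    by (rule positive_op_Cauchy_Schwarz[OF H])
  also have "\<dots> \<le> Re (cinner (B u) (G (B u))) * Re (cinner x (H x))"
    by (intro mult_right_mono le positive_opD(3)[OF H])
  also have "\<dots> = b * Re (cinner x (H x))"
    by (simp add: G b_def positive_opD(2)[OF B])
  finally have "b * b \<le> b * Re (cinner x (H x))" by (simp add: power2_eq_square)
  then have "b \<le> Re (cinner x (H x))"
    using b0 positive_opD(3)[OF H, of x] by (cases "b = 0") auto
  then show ?thesis by (simp add: b_def u_def)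
qed

text \<open>If \<open>0 \<le> D \<le> 1\<close>, then the square of the norm of \<open>D x\<close> is at most \<open>\<langle>x, D x\<rangle>\<close>; with \<open>D = F l - F k\<close>,
  convergence of the bounded increasing forms makes the vectors \<open>F n x\<close> a Cauchy sequence.\<close>

lemma increasing_strong_limit:
  fixes F :: "nat \<Rightarrow> 'h::complex_hilbert_space \<Rightarrow> 'h"
  assumes F: "\<And>n. positive_op (F n)"
    and mono: "\<And>n x. Re (cinner x (F n x)) \<le> Re (cinner x (F (Suc n) x))"
    and bound: "\<And>n x. Re (cinner x (F n x)) \<le> (norm x)\<^sup>2"
  obtains T where "positive_op T" "\<And>x. (\<lambda>n. F n x) \<longlonglongrightarrow> T x"
    "\<And>n x. Re (cinner x (F n x)) \<le> Re (cinner x (T x))" "\<And>x. Re (cinner x (T x)) \<le> (norm x)\<^sup>2"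
proof -
  note FB = positive_opD(1)[OF F] and Fsa = positive_opD(2)[OF F] and Fpos = positive_opD(3)[OF F]
  have inc: "incseq (\<lambda>n. Re (cinner x (F n x)))" for x by (rule incseq_SucI) (rule mono)
  have F_norm: "norm (F n x) \<le> norm x" for n x
  proof -
    have "(norm (F n x))\<^sup>2 \<le> 1 * Re (cinner x (F n x))"
      by (rule positive_op_norm_square[OF F]) (simp add: bound)
    then have "(norm (F n x))\<^sup>2 \<le> (norm x)\<^sup>2" using bound[of x n] by linarith
    then show ?thesis by (rule power2_le_imp_le) simp
  qed
  have diff: "(norm (F l x - F k x))\<^sup>2 \<le> Re (cinner x (F l x)) - Re (cinner x (F k x))" if "k \<le> l" for k l x
  proof -
    have "positive_op (\<lambda>x. F l x - F k x)"
      unfolding positive_op_def using incseqD[OF inc that]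
      by (auto intro!: bounded_operators_diff FB simp: cinner_simps Fsa)
    moreover have "Re (cinner y (F l y - F k y)) \<le> 1 * (norm y)\<^sup>2" for y
      using bound[of y l] Fpos[of y k] by (simp add: cinner_simps)
    ultimately have "(norm (F l x - F k x))\<^sup>2 \<le> 1 * Re (cinner x (F l x - F k x))"
      by (rule positive_op_norm_square)
    then show ?thesis by (simp add: cinner_simps)
  qed
  have "Cauchy (\<lambda>n. F n x)" for x
  proof (rule metric_CauchyI)
    fix \<epsilon> :: real assume \<epsilon>: "\<epsilon> > 0"
    have "convergent (\<lambda>n. Re (cinner x (F n x)))"
      using incseq_convergent[OF inc, of x "(norm x)\<^sup>2"] bound unfolding convergent_def by metis
    then have "Cauchy (\<lambda>n. Re (cinner x (F n x)))" by (simp add: Cauchy_convergent_iff)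
    then obtain M where M: "\<And>m n. m \<ge> M \<Longrightarrow> n \<ge> M \<Longrightarrow>
        dist (Re (cinner x (F m x))) (Re (cinner x (F n x))) < \<epsilon>\<^sup>2"
      using metric_CauchyD[of _ "\<epsilon>\<^sup>2"] \<epsilon> by (metis zero_less_power)
    have main: "dist (F l x) (F k x) < \<epsilon>" if "k \<ge> M" "k \<le> l" for k l
    proof -
      have "(norm (F l x - F k x))\<^sup>2 < \<epsilon>\<^sup>2"
        using diff[OF that(2), of x] M[of l k] that by (simp add: dist_real_def abs_less_iff)
      then show ?thesis
        unfolding dist_norm by (rule power_less_imp_less_base) (use \<epsilon> in simp)
    qed
    show "\<exists>M. \<forall>m\<ge>M. \<forall>n\<ge>M. dist (F m x) (F n x) < \<epsilon>"
      using main by (metis dist_commute nat_le_linear)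
  qed
  then have "\<exists>y. (\<lambda>n. F n x) \<longlonglongrightarrow> y" for x by (auto simp: Cauchy_convergent_iff convergent_def)
  then obtain T where T: "\<And>x. (\<lambda>n. F n x) \<longlonglongrightarrow> T x" by metis
  have TB: "T \<in> bounded_operators"
  proof (rule bounded_operatorsI)
    show "T (x + y) = T x + T y" for x y
    proof (rule LIMSEQ_unique[OF T])
      show "(\<lambda>n. F n (x + y)) \<longlonglongrightarrow> T x + T y"
        unfolding bounded_operatorsD(2)[OF FB] by (intro tendsto_add T)
    qed
    show "T (c *\<^sub>C x) = c *\<^sub>C T x" for c x
    proof -
      have "bounded_linear (\<lambda>x::'h. c *\<^sub>C x)"
        using bounded_operatorsD(1)[OF bounded_operators_scale[OF bounded_operators_id]] .
      from bounded_linear.tendsto[OF this T[of x]]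
      have "(\<lambda>n. F n (c *\<^sub>C x)) \<longlonglongrightarrow> c *\<^sub>C T x" unfolding bounded_operatorsD(4)[OF FB] .
      then show ?thesis by (rule LIMSEQ_unique[OF T])
    qed
    show "norm (T x) \<le> 1 * norm x" for x
      using LIMSEQ_le_const2[OF tendsto_norm[OF T[of x]], of "norm x"] F_norm by auto
  qed
  have form: "(\<lambda>n. Re (cinner x (F n x))) \<longlonglongrightarrow> Re (cinner x (T x))" for x
    by (intro tendsto_Re tendsto_cinner T tendsto_const)
  have T_ge: "Re (cinner x (F n x)) \<le> Re (cinner x (T x))" for n x
    by (rule incseq_le[OF inc form])
  have "positive_op T"
    unfolding positive_op_def
  proof (intro conjI allI TB)
    show "cinner (T x) y = cinner x (T y)" for x y
    proof (rule LIMSEQ_unique)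
      show "(\<lambda>n. cinner (F n x) y) \<longlonglongrightarrow> cinner (T x) y" by (intro tendsto_cinner T tendsto_const)
      show "(\<lambda>n. cinner (F n x) y) \<longlonglongrightarrow> cinner x (T y)"
        unfolding Fsa by (intro tendsto_cinner T tendsto_const)
    qed
    show "0 \<le> Re (cinner x (T x))" for x using T_ge[of x 0] Fpos[of x 0] by linarith
  qed
  moreover have "Re (cinner x (T x)) \<le> (norm x)\<^sup>2" for x
    using LIMSEQ_le_const2[OF form] bound by blast
  ultimately show thesis using that T T_ge by blast
qed

text \<open>If the lower bound \<open>m\<close> of the numerical range were negative, then \<open>A - m\<close> would be
  invertible, hence bounded below, and \<open>m\<close> would not be the greatest lower bound.\<close>

lemma positive_if_resolvent:
  fixes A :: "'h::complex_hilbert_space \<Rightarrow> 'h"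
  assumes A: "A \<in> bounded_operators" and sa: "\<And>x y. cinner (A x) y = cinner x (A y)"
    and res: "\<And>\<delta>. \<delta> > 0 \<Longrightarrow> \<exists>G\<in>bounded_operators. \<forall>x. G (A x + \<delta> *\<^sub>R x) = x"
  shows "positive_op A"
proof (rule ccontr)
  assume "\<not> positive_op A"
  then obtain x0 where x0: "Re (cinner x0 (A x0)) < 0"
    using A sa unfolding positive_op_def by (metis linorder_not_le)
  obtain K where K: "K > 0" "\<And>x. norm (A x) \<le> K * norm x" by (rule bounded_operators_bound[OF A]) blast
  have form_bound: "\<bar>Re (cinner x (A x))\<bar> \<le> K * (norm x)\<^sup>2" for x
  proof -
    have "\<bar>Re (cinner x (A x))\<bar> \<le> norm x * norm (A x)"
      using cinner_Cauchy_Schwarz[of x "A x"] abs_Re_le_cmod[of "cinner x (A x)"] by linarith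
    also have "\<dots> \<le> norm x * (K * norm x)" by (intro mult_left_mono K) simp
    finally show ?thesis by (simp add: power2_eq_square mult_ac)
  qed
  define Q where "Q = (\<lambda>x. Re (cinner x (A x))) ` {x. norm x = 1}"
  have bdd: "bdd_below Q"
  proof (rule bdd_belowI)
    show "- K \<le> r" if r: "r \<in> Q" for r
    proof -
      obtain x where "norm x = 1" "r = Re (cinner x (A x))" using r unfolding Q_def by blast
      then show ?thesis using form_bound[of x] by (simp add: abs_le_iff)
    qed
  qed
  define m where "m = Inf Q"
  have unit: "Re (cinner x (A x)) / (norm x)\<^sup>2 \<in> Q" if "x \<noteq> 0" for x
  proof -
    have "Re (cinner ((1 / norm x) *\<^sub>R x) (A ((1 / norm x) *\<^sub>R x))) = Re (cinner x (A x)) / (norm x)\<^sup>2"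
      using bounded_operatorsD(5)[OF A] by (simp add: cinner_simps power2_eq_square)
    moreover have "norm ((1 / norm x) *\<^sub>R x) = 1" using that by simp
    ultimately show ?thesis unfolding Q_def by (metis (mono_tags, lifting) image_eqI mem_Collect_eq)
  qed
  have x0_ne: "x0 \<noteq> 0" using x0 by auto
  have m_le: "m * (norm x)\<^sup>2 \<le> Re (cinner x (A x))" for x
  proof (cases "x = 0")
    case False
    have "m \<le> Re (cinner x (A x)) / (norm x)\<^sup>2" unfolding m_def by (rule cInf_lower[OF unit[OF False] bdd])
    then show ?thesis using False by (simp add: field_simps)
  qed simp
  have "m * (norm x0)\<^sup>2 < 0" using m_le[of x0] x0 by linarith
  then have m: "m < 0" by (simp add: mult_less_0_iff)
  define T where "T = (\<lambda>x. A x + (- m) *\<^sub>R x)"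
  have T_form: "Re (cinner x (T x)) = Re (cinner x (A x)) - m * (norm x)\<^sup>2" for x
    by (simp add: T_def cinner_simps Re_cinner_self)
  have "positive_op T"
    unfolding positive_op_def
  proof (intro conjI allI)
    show "T \<in> bounded_operators"
      unfolding T_def using bounded_operators_add[OF A
          bounded_operators_scale[OF bounded_operators_id, of "complex_of_real (- m)"]]
      by (simp only: scaleC_of_real)
    show "cinner (T x) y = cinner x (T y)" for x y by (simp add: T_def cinner_simps sa)
    show "0 \<le> Re (cinner x (T x))" for x using m_le[of x] by (simp add: T_form)
  qed
  moreover have "Re (cinner x (T x)) \<le> (K - m) * (norm x)\<^sup>2" for x
    using form_bound[of x] by (simp add: T_form abs_le_iff algebra_simps)
  ultimately have T_norm: "(norm (T x))\<^sup>2 \<le> (K - m) * Re (cinner x (T x))" for x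
    by (rule positive_op_norm_square)
  obtain G where G: "G \<in> bounded_operators" "\<And>x. G (T x) = x"
    using res[of "- m"] m unfolding T_def by auto
  obtain L where L: "L > 0" "\<And>x. norm (G x) \<le> L * norm x" by (rule bounded_operators_bound[OF G(1)]) blast
  \<comment> \<open>A unit vector \<open>x\<close> has norm at most \<open>L\<close> times that of \<open>T x\<close>, which keeps the form of \<open>T\<close> at \<open>x\<close> above \<open>\<epsilon>\<close>.\<close>
  define \<epsilon> where "\<epsilon> = 1 / (L\<^sup>2 * (K - m))"
  have pos: "L\<^sup>2 * (K - m) > 0" using L(1) K(1) m by simp
  have "m + \<epsilon> \<le> r" if r: "r \<in> Q" for r
  proof -
    obtain x where x: "norm x = 1" "r = Re (cinner x (A x))" using r unfolding Q_def by blast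
    have "1 \<le> L * norm (T x)" using L(2)[of "T x"] G(2)[of x] x(1) by simp
    then have "1\<^sup>2 \<le> (L * norm (T x))\<^sup>2" by (rule power_mono) simp
    also have "\<dots> \<le> L\<^sup>2 * ((K - m) * Re (cinner x (T x)))"
      unfolding power_mult_distrib by (intro mult_left_mono T_norm) simp
    finally have "1 \<le> (L\<^sup>2 * (K - m)) * (r - m)" using x by (simp add: T_form mult.assoc)
    then have "1 / (L\<^sup>2 * (K - m)) \<le> r - m" using pos by (simp only: pos_divide_le_eq mult.commute)
    then show ?thesis unfolding \<epsilon>_def by linarith
  qed
  then have "m + \<epsilon> \<le> m" unfolding m_def[of] using unit[OF x0_ne] by (metis cInf_greatest empty_iff m_def)
  then show False using pos by (simp add: \<epsilon>_def)
qed

section \<open>Automorphisms of a tracial von Neumann algebra\<close>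

lemma vn_automorphismD:
  assumes "vn_automorphism X \<alpha>"
  shows "bij_betw \<alpha> X X" "T \<in> X \<Longrightarrow> \<alpha> T \<in> X"
    "S \<in> X \<Longrightarrow> T \<in> X \<Longrightarrow> \<alpha> (\<lambda>\<xi>. S \<xi> + T \<xi>) = (\<lambda>\<xi>. \<alpha> S \<xi> + \<alpha> T \<xi>)"
    "T \<in> X \<Longrightarrow> \<alpha> (\<lambda>\<xi>. c *\<^sub>C T \<xi>) = (\<lambda>\<xi>. c *\<^sub>C \<alpha> T \<xi>)"
    "S \<in> X \<Longrightarrow> T \<in> X \<Longrightarrow> \<alpha> (S \<circ> T) = \<alpha> S \<circ> \<alpha> T"
    "T \<in> X \<Longrightarrow> \<alpha> (adjoint_op T) = adjoint_op (\<alpha> T)"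
  using assms bij_betwE unfolding vn_automorphism_def by auto

text \<open>The parameter is the commutant \<open>Z\<close> of the algebra, so that the algebra is visibly closed under strong
  limits and inverses. The vector \<open>\<Omega>\<close> stands for the unit in \<open>L\<^sup>2\<close> of a faithful trace.\<close>

locale tracial_vn =
  fixes Z :: "('h::complex_hilbert_space \<Rightarrow> 'h) set" and \<Omega> :: 'h
  assumes Z: "Z \<subseteq> bounded_operators"
    and adjoint_closed: "T \<in> commutant Z \<Longrightarrow> adjoint_op T \<in> commutant Z"
    and tracial: "T \<in> commutant Z \<Longrightarrow> norm (adjoint_op T \<Omega>) = norm (T \<Omega>)"
    and separating: "T \<in> commutant Z \<Longrightarrow> T \<Omega> = 0 \<Longrightarrow> T x = 0"
begin

abbreviation R where "R \<equiv> commutant Z"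

lemmas R_closed = commutant_closed[OF Z]

lemma R_bounded: "T \<in> R \<Longrightarrow> T \<in> bounded_operators"
  using commutant_bounded by blast

lemma vn_automorphism_inverse:
  assumes \<gamma>: "vn_automorphism R \<gamma>"
  shows "vn_automorphism R (the_inv_into R \<gamma>)"
proof -
  note D = vn_automorphismD[OF \<gamma>]
  let ?\<beta> = "the_inv_into R \<gamma>"
  have inj: "inj_on \<gamma> R" using D(1) bij_betw_def by blast
  have \<beta>: "?\<beta> T \<in> R" "\<gamma> (?\<beta> T) = T" if "T \<in> R" for T
    using that D(1) by (auto simp: bij_betw_def f_the_inv_into_f the_inv_into_into)
  have eq: "?\<beta> y = x" if "x \<in> R" "\<gamma> x = y" for x y
    using that inj the_inv_into_f_f by metis
  show ?thesis
    unfolding vn_automorphism_def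
    by (intro conjI ballI allI bij_betw_the_inv_into[OF D(1)] eq)
      (simp_all add: \<beta> R_closed(2,4,5) adjoint_closed D(3-6))
qed

lemma vn_automorphism_comp:
  assumes "vn_automorphism R \<beta>" "vn_automorphism R \<gamma>"
  shows "vn_automorphism R (\<lambda>T. \<beta> (\<gamma> T))"
proof -
  note b = vn_automorphismD[OF assms(1)] and c = vn_automorphismD[OF assms(2)]
  have "bij_betw (\<lambda>T. \<beta> (\<gamma> T)) R R"
    using bij_betw_trans[OF c(1) b(1)] by (simp add: o_def)
  then show ?thesis
    unfolding vn_automorphism_def by (simp add: b(2-6) c(2-6))
qed

context
  fixes \<gamma> :: "('h \<Rightarrow> 'h) \<Rightarrow> ('h \<Rightarrow> 'h)"
  assumes \<gamma>: "vn_automorphism R \<gamma>"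
begin

lemmas \<gamma>D = vn_automorphismD[OF \<gamma>]

lemma automorphism_id: "\<gamma> (\<lambda>x. x) = (\<lambda>x. x)"
proof -
  obtain T where T: "T \<in> R" "\<gamma> T = (\<lambda>x. x)"
    using \<gamma>D(1) R_closed(1) unfolding bij_betw_def by (metis imageE)
  have "\<gamma> ((\<lambda>x. x) \<circ> T) = \<gamma> (\<lambda>x. x) \<circ> \<gamma> T" by (rule \<gamma>D(5)[OF R_closed(1) T(1)])
  then show ?thesis by (simp add: T(2) o_def)
qed

lemma automorphism_diff:
  assumes "S \<in> R" "T \<in> R"
  shows "\<gamma> (\<lambda>x. S x - T x) = (\<lambda>x. \<gamma> S x - \<gamma> T x)"
proof -
  have neg: "(-1) *\<^sub>C x = - x" for x :: 'h by (simp add: complex_vector.scale_minus_left)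
  have "\<gamma> (\<lambda>x. S x + (-1) *\<^sub>C T x) = (\<lambda>x. \<gamma> S x + (-1) *\<^sub>C \<gamma> T x)"
    by (simp only: \<gamma>D(3)[OF assms(1) R_closed(4)[OF assms(2)]] \<gamma>D(4)[OF assms(2)])
  then show ?thesis unfolding neg by simp
qed

lemma automorphism_adjoint:
  assumes T: "T \<in> R"
  shows "cinner (\<gamma> T x) y = cinner x (\<gamma> (adjoint_op T) y)"
  using adjoint_op(1)[OF R_bounded[OF \<gamma>D(2)[OF T]]] \<gamma>D(6)[OF T] by simp

text \<open>Positivity is preserved because it is the algebraic condition that \<open>T + \<delta>\<close> be invertible for
  all \<open>\<delta> > 0\<close>. This is what makes an automorphism automatically normal.\<close>

lemma automorphism_positive:
  assumes T: "T \<in> R" and pos: "positive_op T"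
  shows "positive_op (\<gamma> T)"
proof (rule positive_if_resolvent)
  have TB: "T \<in> bounded_operators" by (rule R_bounded[OF T])
  show "\<gamma> T \<in> bounded_operators" by (rule R_bounded[OF \<gamma>D(2)[OF T]])
  have "adjoint_op T = T" by (rule adjoint_op(2)[OF TB positive_opD(2)[OF pos]])
  then show "cinner (\<gamma> T x) y = cinner x (\<gamma> T y)" for x y using automorphism_adjoint[OF T] by simp
  fix \<delta> :: real assume \<delta>: "\<delta> > 0"
  define B where "B = (\<lambda>x. T x + complex_of_real \<delta> *\<^sub>C x)"
  have B: "B \<in> R" unfolding B_def by (intro R_closed(2) T R_closed(4) R_closed(1))
  obtain G where G: "positive_op G" "\<And>x. B (G x) = x" "\<And>x. G (B x) = x"
  proof (rule coercive_inverse[OF R_bounded[OF B] _ _ \<delta>])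
    show "cinner (B x) y = cinner x (B y)" for x y
      using positive_opD(2)[OF pos] by (simp add: B_def cinner_simps)
    show "\<delta> * (norm x)\<^sup>2 \<le> Re (cinner x (B x))" for x
      using positive_opD(3)[OF pos] by (simp add: B_def cinner_simps cinner_self)
  qed blast
  have GR: "G \<in> R" by (rule commutant_inverse[OF B positive_opD(1)[OF G(1)] G(2,3)])
  have \<gamma>B: "\<gamma> B = (\<lambda>x. \<gamma> T x + complex_of_real \<delta> *\<^sub>C x)"
    unfolding B_def
    using \<gamma>D(3)[OF T R_closed(4)[OF R_closed(1)]] \<gamma>D(4)[OF R_closed(1)] automorphism_id by simp
  have "\<gamma> (G \<circ> B) = \<gamma> G \<circ> \<gamma> B" by (rule \<gamma>D(5)[OF GR B])
  moreover have "G \<circ> B = (\<lambda>x. x)" by (simp add: o_def G(3))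
  ultimately have inv: "\<gamma> G (\<gamma> B x) = x" for x using automorphism_id by (metis comp_apply)
  have "\<gamma> G (\<gamma> T x + \<delta> *\<^sub>R x) = x" for x using inv[of x] by (simp add: \<gamma>B scaleC_of_real)
  then show "\<exists>G\<in>bounded_operators. \<forall>x. G (\<gamma> T x + \<delta> *\<^sub>R x) = x"
    using R_bounded[OF \<gamma>D(2)[OF GR]] by blast
qed

lemma automorphism_mono:
  assumes S: "S \<in> R" "positive_op S" and T: "T \<in> R" "positive_op T"
    and le: "\<And>x. Re (cinner x (S x)) \<le> Re (cinner x (T x))"
  shows "Re (cinner x (\<gamma> S x)) \<le> Re (cinner x (\<gamma> T x))"
proof -
  have "positive_op (\<lambda>x. T x - S x)"
    unfolding positive_op_def
    using R_bounded[OF R_closed(3)[OF T(1) S(1)]] le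
    by (simp add: cinner_simps positive_opD(2)[OF S(2)] positive_opD(2)[OF T(2)])
  then have "positive_op (\<lambda>x. \<gamma> T x - \<gamma> S x)"
    using automorphism_positive[OF R_closed(3)[OF T(1) S(1)]] automorphism_diff[OF T(1) S(1)] by simp
  from positive_opD(3)[OF this, of x] show ?thesis by (simp add: cinner_simps)
qed

end

lemma positive_op_eq_id:
  assumes T: "positive_op T" and le: "\<And>x. Re (cinner x (T x)) \<le> (norm x)\<^sup>2"
    and eq: "(norm x)\<^sup>2 \<le> Re (cinner x (T x))"
  shows "T x = x"
proof -
  have "positive_op (\<lambda>x. x - T x)"
    unfolding positive_op_def
    using bounded_operators_diff[OF bounded_operators_id positive_opD(1)[OF T]] le
    by (simp add: cinner_simps positive_opD(2)[OF T] Re_cinner_self)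
  moreover have "Re (cinner y (y - T y)) \<le> 1 * (norm y)\<^sup>2" for y
    using positive_opD(3)[OF T, of y] by (simp add: cinner_simps Re_cinner_self)
  ultimately have "(norm (x - T x))\<^sup>2 \<le> 1 * Re (cinner x (x - T x))"
    by (rule positive_op_norm_square)
  also have "\<dots> \<le> 0" using eq by (simp add: cinner_simps Re_cinner_self)
  finally show ?thesis by simp
qed

lemma sum_half_powers_le: "(\<Sum>n=m..<m+k. (1/2::real)^n) \<le> 2 * (1/2)^m"
proof -
  have "(\<Sum>n=m..<m+k. (1/2::real)^n) = 2 * (1/2)^m - 2 * (1/2)^(m+k)"
    by (induction k) simp_all
  then show ?thesis by simp
qed

text \<open>Choose \<open>x n\<close> in the dense set with \<open>x n \<Omega>\<close> rapidly converging to \<open>T \<Omega>\<close> and put \<open>z n = x n - T\<close>. The sum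
  \<open>S\<close> of the \<open>z\<^sup>* z\<close> from index \<open>m\<close> on need not be bounded, but \<open>h = (1 + S)\<^sup>-\<^sup>1\<close> makes sense as a decreasing limit,
  and \<open>h\<close> increases to \<open>1\<close> with \<open>m\<close> because \<open>\<langle>\<Omega>, S \<Omega>\<rangle>\<close> tends to \<open>0\<close> and \<open>\<Omega>\<close> is
  separating. Since \<open>\<gamma>\<close> is an order isomorphism, \<open>H = \<gamma>(h)\<close>
  also increases to \<open>1\<close>. The inequality \<open>H (1 + \<gamma>(S)) H \<le> H\<close> bounds the sum of the squared norms of the vectors
  \<open>\<gamma>(z n) H \<Omega>\<close>, so \<open>x n H \<Omega>\<close> tends to \<open>\<gamma>(T) H \<Omega>\<close>. By the trace property it also tends to \<open>T H \<Omega>\<close>. Let \<open>H\<close>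
  tend to \<open>1\<close>.\<close>

theorem automorphism_fixing_dense_is_identity:
  fixes \<gamma> :: "('h \<Rightarrow> 'h) \<Rightarrow> ('h \<Rightarrow> 'h)"
  assumes \<gamma>: "vn_automorphism R \<gamma>"
    and D: "D \<subseteq> R" "\<And>x. x \<in> D \<Longrightarrow> \<gamma> x = x" and dense: "closure ((\<lambda>x. x \<Omega>) ` D) = UNIV"
    and T: "T \<in> R"
  shows "\<gamma> T = T"
proof -
  note \<gamma>D = vn_automorphismD[OF \<gamma>]
  have "\<exists>x\<in>D. dist (x \<Omega>) (T \<Omega>) < (1/2) ^ n" for n
  proof -
    have "T \<Omega> \<in> closure ((\<lambda>x. x \<Omega>) ` D)" by (simp add: dense)
    then show ?thesis unfolding closure_approachable by (force dest: spec[of _ "(1/2) ^ n"])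
  qed
  then obtain x where x: "\<And>n. x n \<in> D" "\<And>n. dist (x n \<Omega>) (T \<Omega>) < (1/2) ^ n" by metis
  have xR: "x n \<in> R" for n using x D by blast
  define z where "z = (\<lambda>n \<xi>. x n \<xi> - T \<xi>)"
  have z: "z n \<in> R" for n unfolding z_def by (intro R_closed(3) xR T)
  have \<gamma>z: "\<gamma> (z n) \<xi> = x n \<xi> - \<gamma> T \<xi>" for n \<xi>
    unfolding z_def using automorphism_diff[OF \<gamma> xR T] D(2)[OF x(1)] by simp
  have z_small: "norm (z n \<Omega>) < (1/2) ^ n" for n using x(2)[of n] by (simp add: z_def dist_norm)
  have z_small2: "(norm (z n \<Omega>))\<^sup>2 \<le> (1/2) ^ n" for n
  proof -
    have "(norm (z n \<Omega>))\<^sup>2 \<le> ((1/2) ^ n)\<^sup>2" using z_small[of n] by (intro power_mono) auto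
    also have "\<dots> = (1/2) ^ n * (1/2) ^ n" by (simp add: power2_eq_square)
    also have "\<dots> \<le> (1/2) ^ n * 1" by (intro mult_left_mono power_le_one) auto
    finally show ?thesis by simp
  qed
  define y where "y = (\<lambda>n. adjoint_op (z n) \<circ> z n)"
  have y: "y n \<in> R" for n unfolding y_def by (intro R_closed(5) adjoint_closed z)
  have y_inner: "cinner a (y n b) = cinner (z n a) (z n b)" for a b n
    by (simp add: y_def adjoint_op(1)[OF R_bounded[OF z]])
  have \<gamma>y_inner: "cinner a (\<gamma> (y n) b) = cinner (\<gamma> (z n) a) (\<gamma> (z n) b)" for a b n
  proof -
    have "\<gamma> (y n) = \<gamma> (adjoint_op (z n)) \<circ> \<gamma> (z n)"
      unfolding y_def by (rule \<gamma>D(5)[OF adjoint_closed[OF z] z])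
    then show ?thesis by (simp add: automorphism_adjoint[OF \<gamma> z])
  qed
  \<comment> \<open>\<open>B m k\<close> is \<open>1\<close> plus the partial sum of length \<open>k\<close> of the tail of \<open>y\<close> from \<open>m\<close>.\<close>
  define B where "B = (\<lambda>m k \<xi>. \<xi> + (\<Sum>n=m..<m+k. y n \<xi>))"
  have B_Suc: "B m (Suc k) = (\<lambda>\<xi>. B m k \<xi> + y (m + k) \<xi>)" for m k
    by (simp add: B_def add.assoc)
  have B_0: "B m 0 = (\<lambda>\<xi>. \<xi>)" for m by (simp add: B_def)
  have B: "B m k \<in> R" for m k
    by (induction k) (simp_all add: B_0 B_Suc R_closed(1,2) y)
  have B_form: "Re (cinner \<xi> (B m k \<xi>)) = (norm \<xi>)\<^sup>2 + (\<Sum>n=m..<m+k. (norm (z n \<xi>))\<^sup>2)" for m k \<xi>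
    by (induction k) (simp_all add: B_0 B_Suc cinner_simps y_inner Re_cinner_self)
  have B_sa: "cinner (B m k a) b = cinner a (B m k b)" for m k a b
  proof (induction k)
    case (Suc k)
    have "cinner (y (m + k) a) b = cinner a (y (m + k) b)"
      using y_inner[of b "m + k" a] y_inner[of a "m + k" b] cinner_commute by metis
    then show ?case using Suc by (simp add: B_Suc cinner_simps)
  qed (simp add: B_0)
  have B_pos: "positive_op (B m k)" for m k
    unfolding positive_op_def using R_bounded[OF B] B_sa by (auto simp: B_form sum_nonneg)
  have "\<exists>G. positive_op G \<and> (\<forall>\<xi>. B m k (G \<xi>) = \<xi>) \<and> (\<forall>\<xi>. G (B m k \<xi>) = \<xi>)" for m k
    by (rule coercive_inverse[OF R_bounded[OF B] B_sa, of 1 m k]) (auto simp: B_form sum_nonneg)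
  then obtain G where G: "\<And>m k. positive_op (G m k)" "\<And>m k \<xi>. B m k (G m k \<xi>) = \<xi>"
      "\<And>m k \<xi>. G m k (B m k \<xi>) = \<xi>" by metis
  have GR: "G m k \<in> R" for m k by (rule commutant_inverse[OF B positive_opD(1)[OF G(1)] G(2,3)])
  have G_anti: "Re (cinner \<xi> (G m' k' \<xi>)) \<le> Re (cinner \<xi> (G m k \<xi>))"
    if "{m..<m+k} \<subseteq> {m'..<m'+k'}" for m k m' k' \<xi>
    by (rule inverse_antimono[OF B_pos G(2) B_pos G(2)])
      (use that in \<open>auto simp: B_form intro!: sum_mono2\<close>)
  have G_le: "Re (cinner \<xi> (G m k \<xi>)) \<le> (norm \<xi>)\<^sup>2" for m k \<xi>
    using G_anti[where m = m and k = 0 and m' = m and k' = k and \<xi> = \<xi>] G(2)[of m 0 \<xi>]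
    by (simp add: B_0 Re_cinner_self)
  \<comment> \<open>\<open>h m\<close> is the inverse of \<open>1\<close> plus the possibly unbounded infinite tail of \<open>y\<close> from \<open>m\<close>.\<close>
  have "\<exists>h. h \<in> R \<and> positive_op h \<and> (\<forall>k \<xi>. Re (cinner \<xi> (h \<xi>)) \<le> Re (cinner \<xi> (G m k \<xi>)))
      \<and> (\<forall>\<xi>. (\<lambda>k. Re (cinner \<xi> (G m k \<xi>))) \<longlonglongrightarrow> Re (cinner \<xi> (h \<xi>)))" for m
  proof -
    define F where "F = (\<lambda>k \<xi>. \<xi> - G m k \<xi>)"
    have F_form: "Re (cinner \<xi> (F k \<xi>)) = (norm \<xi>)\<^sup>2 - Re (cinner \<xi> (G m k \<xi>))" for k \<xi>
      by (simp add: F_def cinner_simps Re_cinner_self)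
    have FR: "F k \<in> R" for k unfolding F_def by (intro R_closed(3) R_closed(1) GR)
    have F_pos: "positive_op (F k)" for k
      unfolding positive_op_def using R_bounded[OF FR] G_le
      by (simp add: F_form) (simp add: F_def cinner_simps positive_opD(2)[OF G(1)])
    obtain P where P: "positive_op P" "\<And>\<xi>. (\<lambda>k. F k \<xi>) \<longlonglongrightarrow> P \<xi>"
        "\<And>k \<xi>. Re (cinner \<xi> (F k \<xi>)) \<le> Re (cinner \<xi> (P \<xi>))" "\<And>\<xi>. Re (cinner \<xi> (P \<xi>)) \<le> (norm \<xi>)\<^sup>2"
    proof (rule increasing_strong_limit[of F, OF F_pos])
      show "Re (cinner \<xi> (F k \<xi>)) \<le> Re (cinner \<xi> (F (Suc k) \<xi>))" for k \<xi>
        using G_anti[where m = m and k = k and m' = m and k' = "Suc k" and \<xi> = \<xi>] by (simp add: F_form)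
      show "Re (cinner \<xi> (F k \<xi>)) \<le> (norm \<xi>)\<^sup>2" for k \<xi>
        using positive_opD(3)[OF G(1)] by (simp add: F_form)
    qed blast
    have PR: "P \<in> R" by (rule commutant_strong_limit[OF Z FR positive_opD(1)[OF P(1)] P(2)])
    define h where "h = (\<lambda>\<xi>. \<xi> - P \<xi>)"
    have h_form: "Re (cinner \<xi> (h \<xi>)) = (norm \<xi>)\<^sup>2 - Re (cinner \<xi> (P \<xi>))" for \<xi>
      by (simp add: h_def cinner_simps Re_cinner_self)
    have hR: "h \<in> R" unfolding h_def by (intro R_closed(3) R_closed(1) PR)
    have "positive_op h"
      unfolding positive_op_def using R_bounded[OF hR] P(4)
      by (simp add: h_form) (simp add: h_def cinner_simps positive_opD(2)[OF P(1)])
    moreover have "Re (cinner \<xi> (h \<xi>)) \<le> Re (cinner \<xi> (G m k \<xi>))" for k \<xi>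
      using P(3)[of \<xi> k] by (simp add: h_form F_form)
    moreover have "(\<lambda>k. Re (cinner \<xi> (G m k \<xi>))) \<longlonglongrightarrow> Re (cinner \<xi> (h \<xi>))" for \<xi>
    proof -
      have "(\<lambda>k. (norm \<xi>)\<^sup>2 - Re (cinner \<xi> (F k \<xi>))) \<longlonglongrightarrow> (norm \<xi>)\<^sup>2 - Re (cinner \<xi> (P \<xi>))"
        by (intro tendsto_diff tendsto_const tendsto_Re tendsto_cinner P(2))
      then show ?thesis by (simp add: F_form h_form)
    qed
    ultimately show ?thesis using hR by blast
  qed
  then obtain h where h: "\<And>m. h m \<in> R" "\<And>m. positive_op (h m)"
      "\<And>m k \<xi>. Re (cinner \<xi> (h m \<xi>)) \<le> Re (cinner \<xi> (G m k \<xi>))"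
      "\<And>m \<xi>. (\<lambda>k. Re (cinner \<xi> (G m k \<xi>))) \<longlonglongrightarrow> Re (cinner \<xi> (h m \<xi>))" by metis
  have h_le: "Re (cinner \<xi> (h m \<xi>)) \<le> (norm \<xi>)\<^sup>2" for m \<xi>
    using h(3)[of \<xi> m 0] G_le[of \<xi> m 0] by linarith
  have h_mono: "Re (cinner \<xi> (h m \<xi>)) \<le> Re (cinner \<xi> (h (Suc m) \<xi>))" for m \<xi>
  proof (rule LIMSEQ_le_const[OF h(4)])
    have "Re (cinner \<xi> (h m \<xi>)) \<le> Re (cinner \<xi> (G (Suc m) k \<xi>))" for k
      using h(3)[of \<xi> m "Suc k"]
        G_anti[where m = "Suc m" and k = k and m' = m and k' = "Suc k" and \<xi> = \<xi>] by simp
    then show "\<exists>N. \<forall>k\<ge>N. Re (cinner \<xi> (h m \<xi>)) \<le> Re (cinner \<xi> (G (Suc m) k \<xi>))" by blast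
  qed
  have h_\<Omega>: "(norm \<Omega>)\<^sup>2 - 2 * (1/2) ^ m \<le> Re (cinner \<Omega> (h m \<Omega>))" for m
  proof (rule LIMSEQ_le_const[OF h(4)])
    have "(norm \<Omega>)\<^sup>2 - 2 * (1/2) ^ m \<le> Re (cinner \<Omega> (G m k \<Omega>))" for k
    proof -
      have "(\<Sum>n=m..<m+k. (norm (z n \<Omega>))\<^sup>2) \<le> (\<Sum>n=m..<m+k. (1/2)^n)"
        by (intro sum_mono z_small2)
      also have "\<dots> \<le> 2 * (1/2) ^ m" by (rule sum_half_powers_le)
      finally show ?thesis
        using inverse_variational[of "B m k" "G m k" \<Omega> \<Omega>, OF B_pos G(2)]
        by (simp add: B_form Re_cinner_self)
    qed
    then show "\<exists>N. \<forall>k\<ge>N. (norm \<Omega>)\<^sup>2 - 2 * (1/2) ^ m \<le> Re (cinner \<Omega> (G m k \<Omega>))" by blast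
  qed
  \<comment> \<open>The supremum of the \<open>h m\<close> fixes \<open>\<Omega>\<close>, hence is \<open>1\<close>.\<close>
  obtain s where s: "positive_op s" "\<And>\<xi>. (\<lambda>m. h m \<xi>) \<longlonglongrightarrow> s \<xi>"
      "\<And>m \<xi>. Re (cinner \<xi> (h m \<xi>)) \<le> Re (cinner \<xi> (s \<xi>))" "\<And>\<xi>. Re (cinner \<xi> (s \<xi>)) \<le> (norm \<xi>)\<^sup>2"
    by (rule increasing_strong_limit[of h, OF h(2) h_mono h_le]) blast
  have sR: "s \<in> R" by (rule commutant_strong_limit[OF Z h(1) positive_opD(1)[OF s(1)] s(2)])
  have "s \<Omega> = \<Omega>"
  proof (rule positive_op_eq_id[OF s(1,4)])
    have "(\<lambda>m. (norm \<Omega>)\<^sup>2 - 2 * (1/2) ^ m) \<longlonglongrightarrow> (norm \<Omega>)\<^sup>2 - 2 * 0"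
      by (intro tendsto_diff tendsto_mult tendsto_const LIMSEQ_power_zero) simp
    then have "(norm \<Omega>)\<^sup>2 - 2 * 0 \<le> Re (cinner \<Omega> (s \<Omega>))"
    proof (rule LIMSEQ_le_const2, intro exI allI impI)
      show "(norm \<Omega>)\<^sup>2 - 2 * (1/2) ^ m \<le> Re (cinner \<Omega> (s \<Omega>))" for m
        using h_\<Omega>[of m] s(3)[of \<Omega> m] by linarith
    qed
    then show "(norm \<Omega>)\<^sup>2 \<le> Re (cinner \<Omega> (s \<Omega>))" by simp
  qed
  then have s_id: "s \<xi> = \<xi>" for \<xi>
    using separating[OF R_closed(3)[OF sR R_closed(1)], of \<xi>] by simp
  define H where "H = (\<lambda>m. \<gamma> (h m))"
  have HR: "H m \<in> R" for m unfolding H_def by (intro \<gamma>D(2) h)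
  have H_pos: "positive_op (H m)" for m unfolding H_def by (intro automorphism_positive[OF \<gamma>] h)
  have id_pos: "positive_op (\<lambda>\<xi>::'h. \<xi>)"
    by (simp add: positive_op_def bounded_operators_id Re_cinner_self)
  have H_le: "Re (cinner \<xi> (H m \<xi>)) \<le> (norm \<xi>)\<^sup>2" for m \<xi>
    using automorphism_mono[OF \<gamma> h(1)[of m] h(2) R_closed(1) id_pos, of \<xi>] h_le automorphism_id[OF \<gamma>]
    by (simp add: H_def Re_cinner_self)
  obtain P where P: "positive_op P" "\<And>\<xi>. (\<lambda>m. H m \<xi>) \<longlonglongrightarrow> P \<xi>"
      "\<And>m \<xi>. Re (cinner \<xi> (H m \<xi>)) \<le> Re (cinner \<xi> (P \<xi>))" "\<And>\<xi>. Re (cinner \<xi> (P \<xi>)) \<le> (norm \<xi>)\<^sup>2"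
  proof (rule increasing_strong_limit[of H, OF H_pos _ H_le])
    show "Re (cinner \<xi> (H m \<xi>)) \<le> Re (cinner \<xi> (H (Suc m) \<xi>))" for m \<xi>
      unfolding H_def by (intro automorphism_mono[OF \<gamma>] h h_mono)
  qed blast
  have PR: "P \<in> R" by (rule commutant_strong_limit[OF Z HR positive_opD(1)[OF P(1)] P(2)])
  \<comment> \<open>Normality: the preimage \<open>Q\<close> of \<open>P\<close> dominates every \<open>h m\<close>, hence dominates \<open>1\<close>.\<close>
  define Q where "Q = the_inv_into R \<gamma> P"
  have inv: "vn_automorphism R (the_inv_into R \<gamma>)" by (rule vn_automorphism_inverse[OF \<gamma>])
  have Q: "Q \<in> R" "positive_op Q" "\<gamma> Q = P"
    unfolding Q_def using vn_automorphismD(2)[OF inv PR] automorphism_positive[OF inv PR P(1)]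
      \<gamma>D(1) PR by (auto simp: bij_betw_def f_the_inv_into_f)
  have "Re (cinner \<xi> (h m \<xi>)) \<le> Re (cinner \<xi> (Q \<xi>))" for m \<xi>
  proof -
    have "the_inv_into R \<gamma> (H m) = h m"
      unfolding H_def using \<gamma>D(1) h(1) by (auto simp: bij_betw_def the_inv_into_f_f)
    then show ?thesis
      using automorphism_mono[OF inv HR[of m] H_pos PR P(1) P(3), of \<xi>] by (simp add: Q_def)
  qed
  moreover have "(\<lambda>m. Re (cinner \<xi> (h m \<xi>))) \<longlonglongrightarrow> Re (cinner \<xi> (s \<xi>))" for \<xi>
    by (intro tendsto_Re tendsto_cinner s(2) tendsto_const)
  ultimately have "Re (cinner \<xi> (s \<xi>)) \<le> Re (cinner \<xi> (Q \<xi>))" for \<xi>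
    using LIMSEQ_le_const2 by blast
  then have "Re (cinner \<xi> \<xi>) \<le> Re (cinner \<xi> (Q \<xi>))" for \<xi> by (simp add: s_id)
  from automorphism_mono[OF \<gamma> R_closed(1) id_pos Q(1,2) this]
  have "(norm \<xi>)\<^sup>2 \<le> Re (cinner \<xi> (P \<xi>))" for \<xi>
    by (simp add: automorphism_id[OF \<gamma>] Q(3) Re_cinner_self)
  then have P_id: "P \<xi> = \<xi>" for \<xi> by (rule positive_op_eq_id[OF P(1,4)])
  have \<gamma>B_form: "Re (cinner \<xi> (\<gamma> (B m k) \<xi>)) = (norm \<xi>)\<^sup>2 + (\<Sum>n=m..<m+k. (norm (\<gamma> (z n) \<xi>))\<^sup>2)"
    for m k \<xi>
    by (induction k)
      (simp_all add: B_0 B_Suc automorphism_id[OF \<gamma>] \<gamma>D(3)[OF B y] cinner_simps \<gamma>y_inner Re_cinner_self)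
  have "\<gamma> T (H m \<Omega>) = T (H m \<Omega>)" for m
  proof -
    define \<xi> where "\<xi> = H m \<Omega>"
    have partial: "(\<Sum>n=m..<m+k. (norm (\<gamma> (z n) \<xi>))\<^sup>2) \<le> (norm \<Omega>)\<^sup>2" for k
    proof -
      have \<gamma>GB: "\<gamma> (G m k) (\<gamma> (B m k) \<eta>) = \<eta>" for \<eta>
      proof -
        have "G m k \<circ> B m k = (\<lambda>\<eta>. \<eta>)" by (simp add: o_def G(3))
        then show ?thesis
          using \<gamma>D(5)[OF GR B] automorphism_id[OF \<gamma>] by (metis comp_apply)
      qed
      have "Re (cinner \<xi> (\<gamma> (B m k) \<xi>)) \<le> Re (cinner \<Omega> (H m \<Omega>))"
        unfolding \<xi>_def
      proof (rule sandwich_le[OF H_pos automorphism_positive[OF \<gamma> B B_pos] \<gamma>GB])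
        show "Re (cinner \<eta> (H m \<eta>)) \<le> Re (cinner \<eta> (\<gamma> (G m k) \<eta>))" for \<eta>
          unfolding H_def by (intro automorphism_mono[OF \<gamma>] h GR G)
      qed
      then show ?thesis unfolding \<gamma>B_form using H_le[of \<Omega> m] by (smt (verit) zero_le_power2)
    qed
    have "summable (\<lambda>i. (norm (\<gamma> (z (m + i)) \<xi>))\<^sup>2)"
    proof (rule bounded_imp_summable)
      show "(\<Sum>i\<le>k. (norm (\<gamma> (z (m + i)) \<xi>))\<^sup>2) \<le> (norm \<Omega>)\<^sup>2" for k
      proof -
        have "(\<Sum>i\<le>k. (norm (\<gamma> (z (m + i)) \<xi>))\<^sup>2) = (\<Sum>n=m..<m+Suc k. (norm (\<gamma> (z n) \<xi>))\<^sup>2)"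
          using sum.shift_bounds_nat_ivl[of "\<lambda>n. (norm (\<gamma> (z n) \<xi>))\<^sup>2" 0 m "Suc k"]
          by (simp add: lessThan_atLeast0[symmetric] lessThan_Suc_atMost add.commute)
        then show ?thesis using partial[of "Suc k"] by simp
      qed
    qed simp
    then have "(\<lambda>i. (norm (\<gamma> (z (m + i)) \<xi>))\<^sup>2) \<longlonglongrightarrow> 0" by (rule summable_LIMSEQ_zero)
    then have "(\<lambda>i. sqrt ((norm (\<gamma> (z (m + i)) \<xi>))\<^sup>2)) \<longlonglongrightarrow> sqrt 0" by (rule tendsto_real_sqrt)
    then have "(\<lambda>i. \<gamma> (z (m + i)) \<xi>) \<longlonglongrightarrow> 0" by (simp add: tendsto_norm_zero_iff)
    then have "(\<lambda>i. x (m + i) \<xi> - \<gamma> T \<xi>) \<longlonglongrightarrow> 0" by (simp add: \<gamma>z)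
    then have lim1: "(\<lambda>i. x (m + i) \<xi>) \<longlonglongrightarrow> \<gamma> T \<xi>" by (simp add: LIM_zero_iff)
    \<comment> \<open>By the trace property, \<open>z n H \<Omega>\<close> is as small as \<open>z n \<Omega>\<close>.\<close>
    define H' where "H' = adjoint_op (H m)"
    have H'B: "H' \<in> bounded_operators" unfolding H'_def by (intro adjoint_op(3) R_bounded HR)
    obtain K where K: "K > 0" "\<And>\<eta>. norm (H' \<eta>) \<le> K * norm \<eta>"
      by (rule bounded_operators_bound[OF H'B]) blast
    have "norm (z n \<xi>) \<le> K * (1/2) ^ n" for n
    proof -
      have "norm (z n \<xi>) = norm (adjoint_op (z n \<circ> H m) \<Omega>)"
        using tracial[OF R_closed(5)[OF z HR]] by (simp add: \<xi>_def)
      also have "\<dots> = norm (H' (adjoint_op (z n) \<Omega>))"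
        by (simp add: adjoint_op_comp R_bounded z HR H'_def)
      also have "\<dots> \<le> K * norm (adjoint_op (z n) \<Omega>)" by (rule K(2))
      also have "\<dots> \<le> K * (1/2) ^ n"
        using K(1) z_small[of n] tracial[OF z] by (intro mult_left_mono) auto
      finally show ?thesis .
    qed
    moreover have "(\<lambda>n. K * (1/2) ^ n) \<longlonglongrightarrow> K * 0"
      by (intro tendsto_mult tendsto_const LIMSEQ_power_zero) simp
    ultimately have "(\<lambda>n. z n \<xi>) \<longlonglongrightarrow> 0"
      by (intro Lim_null_comparison[of "\<lambda>n. z n \<xi>" "\<lambda>n. K * (1/2) ^ n"]) auto
    then have "(\<lambda>n. x n \<xi>) \<longlonglongrightarrow> T \<xi>" by (simp add: z_def LIM_zero_iff)
    then have "(\<lambda>i. x (m + i) \<xi>) \<longlonglongrightarrow> T \<xi>"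
      using LIMSEQ_ignore_initial_segment[of "\<lambda>n. x n \<xi>" _ m] by (simp add: add.commute)
    then show ?thesis using LIMSEQ_unique[OF lim1] \<xi>_def by simp
  qed
  moreover have "(\<lambda>m. \<gamma> T (H m \<Omega>)) \<longlonglongrightarrow> \<gamma> T (P \<Omega>)"
    by (rule bounded_linear.tendsto[OF bounded_operatorsD(1)[OF R_bounded[OF \<gamma>D(2)[OF T]]] P(2)])
  moreover have "(\<lambda>m. T (H m \<Omega>)) \<longlonglongrightarrow> T (P \<Omega>)"
    by (rule bounded_linear.tendsto[OF bounded_operatorsD(1)[OF R_bounded[OF T]] P(2)])
  ultimately have "\<gamma> T \<Omega> = T \<Omega>" using LIMSEQ_unique by (simp add: P_id)
  then have "\<gamma> T \<xi> - T \<xi> = 0" for \<xi>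
    using separating[OF R_closed(3)[OF \<gamma>D(2)[OF T] T], of \<xi>] by simp
  then show ?thesis by (simp add: fun_eq_iff)
qed

end

section \<open>The GNS representation of a trace\<close>

lemma continuous_eq_on_dense:
  fixes F G :: "'h::metric_space \<Rightarrow> 'b::t2_space"
  assumes "continuous_on UNIV F" "continuous_on UNIV G" "closure D = UNIV"
    and "\<And>x. x \<in> D \<Longrightarrow> F x = G x"
  shows "F x = G x"
proof -
  have "closed {x. F x = G x}" using assms(1,2) by (rule closed_Collect_eq)
  then have "closure D \<subseteq> {x. F x = G x}" using assms(4) by (intro closure_minimal) auto
  then show ?thesis using assms(3) by blast
qed

lemma continuous_eq_on_dense2:
  fixes F G :: "'h::metric_space \<Rightarrow> 'h \<Rightarrow> 'b::t2_space"
  assumes "\<And>x. continuous_on UNIV (F x)" "\<And>x. continuous_on UNIV (G x)"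
    "\<And>y. continuous_on UNIV (\<lambda>x. F x y)" "\<And>y. continuous_on UNIV (\<lambda>x. G x y)"
    and D: "closure D = UNIV" and eq: "\<And>x y. x \<in> D \<Longrightarrow> y \<in> D \<Longrightarrow> F x y = G x y"
  shows "F x y = G x y"
proof -
  have "F x y = G x y" if "x \<in> D" for x
    by (rule continuous_eq_on_dense[OF assms(1,2) D eq[OF that]])
  then show ?thesis by (rule continuous_eq_on_dense[OF assms(3,4) D])
qed

lemma isometric_extension:
  fixes f g :: "'i \<Rightarrow> 'h::complex_hilbert_space"
  assumes dense: "closure (f ` A) = UNIV"
    and iso: "\<And>a b. a \<in> A \<Longrightarrow> b \<in> A \<Longrightarrow> norm (g a - g b) = norm (f a - f b)"
  obtains W where "\<And>a. a \<in> A \<Longrightarrow> W (f a) = g a" "\<And>x y. norm (W x - W y) = norm (x - y)"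
proof -
  have "\<exists>y s. (\<forall>n. s n \<in> A) \<and> (\<lambda>n. f (s n)) \<longlonglongrightarrow> x \<and> (\<lambda>n. g (s n)) \<longlonglongrightarrow> y" for x
  proof -
    have "x \<in> closure (f ` A)" using dense by simp
    then obtain t where t: "\<And>n. t n \<in> f ` A" "t \<longlonglongrightarrow> x" unfolding closure_sequential by blast
    have "\<forall>n. \<exists>a. a \<in> A \<and> t n = f a" using t(1) by blast
    then obtain s where s: "\<And>n. s n \<in> A" "\<And>n. t n = f (s n)" by metis
    have "t = (\<lambda>n. f (s n))" by (rule ext) (rule s(2))
    then have lim: "(\<lambda>n. f (s n)) \<longlonglongrightarrow> x" using t(2) by (simp only:)
    then have "Cauchy (\<lambda>n. f (s n))" by (rule LIMSEQ_imp_Cauchy)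
    then have "Cauchy (\<lambda>n. g (s n))" unfolding Cauchy_def dist_norm using iso s(1) by simp
    then show ?thesis using lim s(1) by (auto simp: Cauchy_convergent_iff convergent_def)
  qed
  then obtain W s where W: "\<And>x n. s x n \<in> A" "\<And>x. (\<lambda>n. f (s x n)) \<longlonglongrightarrow> x" "\<And>x. (\<lambda>n. g (s x n)) \<longlonglongrightarrow> W x"
    by metis
  have "norm (W x - W y) = norm (x - y)" for x y
  proof (rule LIMSEQ_unique)
    show "(\<lambda>n. norm (g (s x n) - g (s y n))) \<longlonglongrightarrow> norm (W x - W y)"
      by (intro tendsto_norm tendsto_diff W)
    show "(\<lambda>n. norm (g (s x n) - g (s y n))) \<longlonglongrightarrow> norm (x - y)"
      unfolding iso[OF W(1) W(1)] by (intro tendsto_norm tendsto_diff W)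
  qed
  moreover have "W (f a) = g a" if a: "a \<in> A" for a
  proof (rule LIMSEQ_unique[OF W(3)])
    have "(\<lambda>n. norm (f (s (f a) n) - f a)) \<longlonglongrightarrow> norm (f a - f a)"
      by (intro tendsto_norm tendsto_diff W tendsto_const)
    then have "(\<lambda>n. norm (g (s (f a) n) - g a)) \<longlonglongrightarrow> 0" using iso W(1) a by simp
    then show "(\<lambda>n. g (s (f a) n)) \<longlonglongrightarrow> g a" by (simp add: tendsto_norm_zero_iff LIM_zero_iff)
  qed
  ultimately show thesis using that by blast
qed

lemma continuous_on_isometry:
  fixes W :: "'h::real_normed_vector \<Rightarrow> 'h"
  assumes "\<And>x y. norm (W x - W y) = norm (x - y)"
  shows "continuous_on S W"
  unfolding continuous_on_iff dist_norm assms by blast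

lemma continuous_on_cinner [continuous_intros]:
  fixes f g :: "'b::topological_space \<Rightarrow> 'h::complex_hilbert_space"
  shows "continuous_on S f \<Longrightarrow> continuous_on S g \<Longrightarrow> continuous_on S (\<lambda>x. cinner (f x) (g x))"
  by (rule bounded_bilinear.continuous_on[OF bounded_bilinear_cinner])

lemma continuous_on_bounded_operator:
  assumes "T \<in> bounded_operators" "continuous_on S f"
  shows "continuous_on S (\<lambda>x. T (f x))"
  by (rule bounded_linear.continuous_on[OF bounded_operatorsD(1)[OF assms(1)] assms(2)])

lemma continuous_on_scaleC [continuous_intros]:
  fixes f :: "'b::topological_space \<Rightarrow> 'h::complex_hilbert_space"
  shows "continuous_on S f \<Longrightarrow> continuous_on S (\<lambda>x. c *\<^sub>C f x)"
  by (rule continuous_on_bounded_operator[OF bounded_operators_scale[OF bounded_operators_id]])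

locale gns = tracial_algebra A tr
  for A :: "'a::cstar_algebra set" and tr :: "'a \<Rightarrow> complex" +
  fixes \<pi> :: "'a \<Rightarrow> 'h::complex_hilbert_space \<Rightarrow> 'h" and \<Omega> :: 'h
  assumes gns: "gns_representation A tr \<pi> \<Omega>"
begin

lemma \<pi>: "x \<in> A \<Longrightarrow> \<pi> x \<in> bounded_operators"
    "x \<in> A \<Longrightarrow> y \<in> A \<Longrightarrow> \<pi> (x + y) \<xi> = \<pi> x \<xi> + \<pi> y \<xi>"
    "x \<in> A \<Longrightarrow> \<pi> (c *\<^sub>C x) \<xi> = c *\<^sub>C \<pi> x \<xi>"
    "x \<in> A \<Longrightarrow> y \<in> A \<Longrightarrow> \<pi> (x * y) \<xi> = \<pi> x (\<pi> y \<xi>)"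
    "x \<in> A \<Longrightarrow> adjoint_op (\<pi> x) = \<pi> (star x)"
    "\<pi> 1 \<xi> = \<xi>"
    "closure ((\<lambda>x. \<pi> x \<Omega>) ` A) = UNIV"
    "x \<in> A \<Longrightarrow> tr x = cinner \<Omega> (\<pi> x \<Omega>)"
  using gns unfolding gns_representation_def by (auto simp: fun_eq_iff)

lemma \<pi>_diff: "x \<in> A \<Longrightarrow> y \<in> A \<Longrightarrow> \<pi> (x - y) \<xi> = \<pi> x \<xi> - \<pi> y \<xi>"
  using \<pi>(2)[of "x - y" y] closed(7) by (simp add: algebra_simps)

lemma \<pi>_adjoint: "x \<in> A \<Longrightarrow> cinner (\<pi> x \<xi>) \<eta> = cinner \<xi> (\<pi> (star x) \<eta>)"
  using adjoint_op(1)[OF \<pi>(1)] \<pi>(5) by simp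

lemma cinner_\<pi>: "x \<in> A \<Longrightarrow> y \<in> A \<Longrightarrow> cinner (\<pi> x \<Omega>) (\<pi> y \<Omega>) = tr (star x * y)"
  using closed(4,5) by (simp add: \<pi>_adjoint \<pi>(4,8))

lemma norm_\<pi>: "x \<in> A \<Longrightarrow> (norm (\<pi> x \<Omega>))\<^sup>2 = Re (tr (star x * x))"
  by (simp add: cinner_\<pi>[symmetric] cinner_self)

lemma dense_ext:
  assumes "continuous_on UNIV F" "continuous_on UNIV G" "\<And>x. x \<in> A \<Longrightarrow> F (\<pi> x \<Omega>) = G (\<pi> x \<Omega>)"
  shows "F \<xi> = (G \<xi> :: 'c::t2_space)"
  by (rule continuous_eq_on_dense[OF assms(1,2) \<pi>(7)]) (use assms(3) in auto)

lemma dense_ext2: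
  assumes "\<And>x. continuous_on UNIV (F x)" "\<And>x. continuous_on UNIV (G x)"
    "\<And>y. continuous_on UNIV (\<lambda>x. F x y)" "\<And>y. continuous_on UNIV (\<lambda>x. G x y)"
    and "\<And>x y. x \<in> A \<Longrightarrow> y \<in> A \<Longrightarrow> F (\<pi> x \<Omega>) (\<pi> y \<Omega>) = G (\<pi> x \<Omega>) (\<pi> y \<Omega>)"
  shows "F \<xi> \<eta> = (G \<xi> \<eta> :: 'c::t2_space)"
  by (rule continuous_eq_on_dense2[OF assms(1-4) \<pi>(7)]) (use assms(5) in auto)

lemma image_bounded: "\<pi> ` A \<subseteq> bounded_operators"
  using \<pi>(1) by blast

lemma image_adjoint: "S \<in> \<pi> ` A \<Longrightarrow> adjoint_op S \<in> \<pi> ` A"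
  using \<pi>(5) closed(5) by auto

text \<open>The modular conjugation \<open>J\<close> turns the left action of \<open>x\<close> into the right action of \<open>x\<^sup>*\<close>,
  which lies in the commutant. Moreover \<open>J T \<Omega> = T\<^sup>* \<Omega>\<close> on all of \<open>\<pi>(A)''\<close>.\<close>

sublocale tracial_vn "commutant (\<pi> ` A)" \<Omega>
proof
  show "commutant (\<pi> ` A) \<subseteq> bounded_operators" by (rule commutant_bounded)
  show adj: "adjoint_op T \<in> commutant (commutant (\<pi> ` A))" if "T \<in> commutant (commutant (\<pi> ` A))" for T
    by (rule commutant_adjoint[OF commutant_bounded commutant_adjoint[OF image_bounded image_adjoint] that])
  have iso: "norm (\<pi> (star a) \<Omega> - \<pi> (star b) \<Omega>) = norm (\<pi> a \<Omega> - \<pi> b \<Omega>)" if "a \<in> A" "b \<in> A" for a b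
  proof -
    have d: "a - b \<in> A" using that closed(7) by simp
    have "(norm (\<pi> (star (a - b)) \<Omega>))\<^sup>2 = (norm (\<pi> (a - b) \<Omega>))\<^sup>2"
      using norm_\<pi>[OF d] norm_\<pi>[OF closed(5)[OF d]] tr_comm[OF d closed(5)[OF d]] by (simp add: star_star)
    then have "norm (\<pi> (star (a - b)) \<Omega>) = norm (\<pi> (a - b) \<Omega>)" by simp
    then show ?thesis using that closed(5) by (simp add: \<pi>_diff)
  qed
  obtain J where J: "\<And>a. a \<in> A \<Longrightarrow> J (\<pi> a \<Omega>) = \<pi> (star a) \<Omega>" "\<And>x y. norm (J x - J y) = norm (x - y)"
    using isometric_extension[where f = "\<lambda>a. \<pi> a \<Omega>" and g = "\<lambda>a. \<pi> (star a) \<Omega>", OF \<pi>(7) iso] by blast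
  have contJ: "continuous_on UNIV (\<lambda>x. J (f x))" if "continuous_on UNIV f" for f :: "'h \<Rightarrow> 'h"
    using continuous_on_compose2[OF continuous_on_isometry[OF J(2)] that] by blast
  have J_add: "J (x + y) = J x + J y" for x y
    by (rule dense_ext2[where F = "\<lambda>x y. J (x + y)" and G = "\<lambda>x y. J x + J y"])
      (intro continuous_intros contJ | simp add: \<pi>(2)[symmetric] J(1) closed(5,6) star_add)+
  have J_scale: "J (c *\<^sub>C x) = cnj c *\<^sub>C J x" for c x
    by (rule dense_ext[where F = "\<lambda>x. J (c *\<^sub>C x)" and G = "\<lambda>x. cnj c *\<^sub>C J x"])
      (intro continuous_intros contJ | simp add: \<pi>(3)[symmetric] J(1) closed(5,8) star_scaleC)+
  have JJ: "J (J x) = x" for x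
    by (rule dense_ext[where F = "\<lambda>x. J (J x)" and G = "\<lambda>x. x"])
      (intro continuous_intros contJ | simp add: J(1) closed(5) star_star)+
  have J0: "J 0 = 0" using J_add[of 0 0] by simp
  have J_norm: "norm (J x) = norm x" for x using J(2)[of x 0] J0 by simp
  have J_inner: "cinner (J x) (J y) = cinner y x" for x y
  proof (rule dense_ext2[where F = "\<lambda>x y. cinner (J x) (J y)" and G = "\<lambda>x y. cinner y x"])
    show "cinner (J (\<pi> a \<Omega>)) (J (\<pi> b \<Omega>)) = cinner (\<pi> b \<Omega>) (\<pi> a \<Omega>)" if "a \<in> A" "b \<in> A" for a b
      using that closed(5) tr_comm[of a "star b"] by (simp add: J(1) cinner_\<pi> star_star)
  qed (intro continuous_intros contJ)+
  define \<rho> where "\<rho> = (\<lambda>x \<xi>. J (\<pi> (star x) (J \<xi>)))"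
  have \<rho>: "\<rho> x \<in> commutant (\<pi> ` A)" if x: "x \<in> A" for x
  proof (rule commutantI)
    note D = bounded_operatorsD[OF \<pi>(1)[OF closed(5)[OF x]]]
    obtain K where K: "K > 0" "\<And>\<eta>. norm (\<pi> (star x) \<eta>) \<le> K * norm \<eta>"
      using bounded_operators_bound[OF \<pi>(1)[OF closed(5)[OF x]]] by blast
    show \<rho>B: "\<rho> x \<in> bounded_operators"
    proof (rule bounded_operatorsI)
      show "\<rho> x (\<xi> + \<eta>) = \<rho> x \<xi> + \<rho> x \<eta>" for \<xi> \<eta> by (simp add: \<rho>_def J_add D)
      show "\<rho> x (c *\<^sub>C \<xi>) = c *\<^sub>C \<rho> x \<xi>" for c \<xi> by (simp add: \<rho>_def J_scale D)
      show "norm (\<rho> x \<xi>) \<le> K * norm \<xi>" for \<xi> using K(2)[of "J \<xi>"] by (simp add: \<rho>_def J_norm)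
    qed
    have \<rho>_app: "\<rho> x (\<pi> b \<Omega>) = \<pi> (b * x) \<Omega>" if b: "b \<in> A" for b
      using b x closed(4,5) by (simp add: \<rho>_def J(1) \<pi>(4)[symmetric] star_mult star_star)
    fix S \<xi> assume "S \<in> \<pi> ` A"
    then obtain a where a: "a \<in> A" "S = \<pi> a" by blast
    show "\<rho> x (S \<xi>) = S (\<rho> x \<xi>)"
    proof (rule dense_ext[where F = "\<lambda>\<xi>. \<rho> x (S \<xi>)" and G = "\<lambda>\<xi>. S (\<rho> x \<xi>)"])
      show "\<rho> x (S (\<pi> b \<Omega>)) = S (\<rho> x (\<pi> b \<Omega>))" if b: "b \<in> A" for b
      proof -
        have "\<rho> x (S (\<pi> b \<Omega>)) = \<rho> x (\<pi> (a * b) \<Omega>)" using a b by (simp add: \<pi>(4))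
        also have "\<dots> = \<pi> (a * (b * x)) \<Omega>" using a b closed(4) by (simp add: \<rho>_app mult.assoc)
        also have "\<dots> = S (\<pi> (b * x) \<Omega>)" using a b x closed(4) by (simp add: \<pi>(4))
        finally show ?thesis by (simp add: \<rho>_app b)
      qed
      show "continuous_on UNIV (\<lambda>\<xi>. \<rho> x (S \<xi>))" "continuous_on UNIV (\<lambda>\<xi>. S (\<rho> x \<xi>))"
        unfolding a(2)
        by (intro continuous_on_bounded_operator[OF \<rho>B] continuous_on_bounded_operator[OF \<pi>(1)[OF a(1)]]
            continuous_on_id)+
    qed
  qed
  have J\<Omega>: "J \<Omega> = \<Omega>" using J(1)[OF closed(3)] by (simp add: \<pi>(6))
  have T_app: "T (\<pi> x \<Omega>) = J (\<pi> (star x) (J (T \<Omega>)))"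
    if T: "T \<in> commutant (commutant (\<pi> ` A))" and x: "x \<in> A" for T x
  proof -
    have "T (\<rho> x \<Omega>) = \<rho> x (T \<Omega>)" by (rule commutantD(2)[OF T \<rho>[OF x]])
    moreover have "\<rho> x \<Omega> = \<pi> x \<Omega>" using x closed(5) by (simp add: \<rho>_def J\<Omega> J(1) star_star)
    ultimately show ?thesis by (simp add: \<rho>_def)
  qed
  show "norm (adjoint_op T \<Omega>) = norm (T \<Omega>)" if T: "T \<in> commutant (commutant (\<pi> ` A))" for T
  proof -
    have TB: "T \<in> bounded_operators" by (rule commutantD(1)[OF T])
    have "cinner (adjoint_op T \<Omega>) (\<pi> x \<Omega>) = cinner (J (T \<Omega>)) (\<pi> x \<Omega>)" if x: "x \<in> A" for x
    proof -
      have "cinner (adjoint_op T \<Omega>) (\<pi> x \<Omega>) = cinner \<Omega> (T (\<pi> x \<Omega>))"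
        by (simp add: adjoint_op_right[OF TB])
      also have "\<dots> = cinner (J \<Omega>) (J (\<pi> (star x) (J (T \<Omega>))))" by (simp add: T_app[OF T x] J\<Omega>)
      also have "\<dots> = cinner (\<pi> (star x) (J (T \<Omega>))) \<Omega>" by (rule J_inner)
      also have "\<dots> = cinner (J (T \<Omega>)) (\<pi> x \<Omega>)" using \<pi>_adjoint[OF closed(5)[OF x]] by (simp add: star_star)
      finally show ?thesis .
    qed
    then have inner_eq: "cinner (adjoint_op T \<Omega>) \<xi> = cinner (J (T \<Omega>)) \<xi>" for \<xi>
      by (rule dense_ext[OF continuous_on_cinner[OF continuous_on_const continuous_on_id]
            continuous_on_cinner[OF continuous_on_const continuous_on_id]])
    have "adjoint_op T \<Omega> = J (T \<Omega>)"
    proof (rule cinner_ext)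
      show "cinner \<xi> (adjoint_op T \<Omega>) = cinner \<xi> (J (T \<Omega>))" for \<xi>
        using inner_eq[of \<xi>] cinner_commute[of \<xi>] by simp
    qed
    then show ?thesis by (simp add: J_norm)
  qed
  show "T \<xi> = 0" if T: "T \<in> commutant (commutant (\<pi> ` A))" and "T \<Omega> = 0" for T \<xi>
  proof (rule dense_ext[where F = T and G = "\<lambda>_. 0"])
    have "\<pi> (star x) 0 = 0" if "x \<in> A" for x using bounded_operatorsD(6)[OF \<pi>(1)] closed(5) that by blast
    then show "T (\<pi> x \<Omega>) = 0" if "x \<in> A" for x
      using T_app[OF T that] \<open>T \<Omega> = 0\<close> that by (simp add: J0)
    show "continuous_on UNIV T"
      using continuous_on_bounded_operator[OF commutantD(1)[OF T] continuous_on_id] by simp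
  qed simp
qed

lemma generated_eq: "generated_von_neumann_algebra (\<pi> ` A) = R"
  by (rule generated_von_neumann_algebra_eq[OF image_bounded image_adjoint])

lemma image_in_R: "x \<in> A \<Longrightarrow> \<pi> x \<in> R"
  using double_commutant_superset[OF image_bounded] by blast

text \<open>The inverse conjugation preserves the commutant of the image of \<open>\<pi>\<close>, hence the conjugation preserves
  its double commutant.\<close>

lemma conj_in_R:
  assumes V: "V \<in> bounded_operators" "V' \<in> bounded_operators" "\<And>\<xi>. V' (V \<xi>) = \<xi>" "\<And>\<xi>. V (V' \<xi>) = \<xi>"
    and img: "\<And>a. a \<in> A \<Longrightarrow> \<exists>b\<in>A. \<forall>\<xi>. V (\<pi> a \<xi>) = \<pi> b (V \<xi>)" and T: "T \<in> R"
  shows "V \<circ> T \<circ> V' \<in> R"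
proof (rule commutantI)
  show "V \<circ> T \<circ> V' \<in> bounded_operators"
    by (intro bounded_operators_comp V R_bounded T)
  fix S \<xi> assume S: "S \<in> commutant (\<pi> ` A)"
  have "V' \<circ> S \<circ> V \<in> commutant (\<pi> ` A)"
  proof (rule commutantI)
    show "V' \<circ> S \<circ> V \<in> bounded_operators"
      by (intro bounded_operators_comp V commutantD(1)[OF S])
    fix Q \<eta> assume "Q \<in> \<pi> ` A"
    then obtain a where a: "a \<in> A" "Q = \<pi> a" by blast
    obtain b where b: "b \<in> A" "\<And>\<xi>. V (\<pi> a \<xi>) = \<pi> b (V \<xi>)" using img[OF a(1)] by blast
    have "V' (\<pi> b \<zeta>) = \<pi> a (V' \<zeta>)" for \<zeta> using b(2)[of "V' \<zeta>"] V(3)[of "\<pi> a (V' \<zeta>)"] V(4) by simp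
    then show "(V' \<circ> S \<circ> V) (Q \<eta>) = Q ((V' \<circ> S \<circ> V) \<eta>)"
      using b(1) by (simp add: a(2) b(2) commutantD(2)[OF S])
  qed
  from commutantD(2)[OF T this, of "V' \<xi>"]
  have "T (V' (S \<xi>)) = V' (S (V (T (V' \<xi>))))" by (simp add: V(4))
  then show "(V \<circ> T \<circ> V') (S \<xi>) = S ((V \<circ> T \<circ> V') \<xi>)" by (simp add: V(4))
qed

text \<open>A trace preserving automorphism is implemented by the unitary \<open>\<pi>(x) \<Omega> \<mapsto> \<pi>(\<alpha>(x)) \<Omega>\<close>.\<close>

theorem trace_preserving_automorphism_extends:
  assumes \<alpha>: "star_automorphism A \<alpha>" and tr\<alpha>: "\<And>x. x \<in> A \<Longrightarrow> tr (\<alpha> x) = tr x"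
  obtains \<alpha>' where "vn_automorphism R \<alpha>'" "\<And>x. x \<in> A \<Longrightarrow> \<alpha>' (\<pi> x) = \<pi> (\<alpha> x)"
    "\<And>T. T \<in> R \<Longrightarrow> vector_trace \<Omega> (\<alpha>' T) = vector_trace \<Omega> T"
proof -
  define \<beta> where "\<beta> = the_inv_into A \<alpha>"
  note D = star_automorphismD[OF \<alpha>]
  have \<beta>_aut: "star_automorphism A \<beta>"
    unfolding \<beta>_def by (rule star_automorphism_inverse[OF \<alpha> subalgebra])
  have \<alpha>\<beta>: "\<alpha> (\<beta> y) = y" if "y \<in> A" for y
    unfolding \<beta>_def using star_automorphism_the_inv_into(1)[OF \<alpha> that] .
  have \<beta>\<alpha>: "\<beta> (\<alpha> y) = y" if "y \<in> A" for y
    unfolding \<beta>_def using star_automorphism_the_inv_into(2)[OF \<alpha> that] .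
  have \<beta>A: "\<beta> x \<in> A" if "x \<in> A" for x using star_automorphismD(2)[OF \<beta>_aut that] .
  have tr\<beta>: "tr (\<beta> x) = tr x" if "x \<in> A" for x using tr\<alpha>[OF \<beta>A[OF that]] \<alpha>\<beta>[OF that] by simp
  have unitary: "\<exists>V\<in>bounded_operators. (\<forall>a\<in>A. V (\<pi> a \<Omega>) = \<pi> (\<sigma> a) \<Omega>)
      \<and> (\<forall>a\<in>A. \<forall>\<xi>. V (\<pi> a \<xi>) = \<pi> (\<sigma> a) (V \<xi>)) \<and> (\<forall>\<xi> \<eta>. cinner (V \<xi>) (V \<eta>) = cinner \<xi> \<eta>)"
    if \<sigma>: "star_automorphism A \<sigma>" and tr\<sigma>: "\<And>x. x \<in> A \<Longrightarrow> tr (\<sigma> x) = tr x" for \<sigma>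
  proof -
    note S = star_automorphismD[OF \<sigma>]
    have inner: "cinner (\<pi> (\<sigma> a) \<Omega>) (\<pi> (\<sigma> b) \<Omega>) = cinner (\<pi> a \<Omega>) (\<pi> b \<Omega>)" if "a \<in> A" "b \<in> A" for a b
    proof -
      have "star (\<sigma> a) * \<sigma> b = \<sigma> (star a * b)" using that S(5,6) closed(5) by simp
      then show ?thesis using that S(2) closed(4,5) tr\<sigma> by (simp add: cinner_\<pi>)
    qed
    have iso: "norm (\<pi> (\<sigma> a) \<Omega> - \<pi> (\<sigma> b) \<Omega>) = norm (\<pi> a \<Omega> - \<pi> b \<Omega>)" if "a \<in> A" "b \<in> A" for a b
    proof -
      have "(norm (\<pi> (\<sigma> a) \<Omega> - \<pi> (\<sigma> b) \<Omega>))\<^sup>2 = (norm (\<pi> a \<Omega> - \<pi> b \<Omega>))\<^sup>2"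
        unfolding Re_cinner_self[symmetric] using that by (simp add: cinner_simps inner)
      then show ?thesis by simp
    qed
    obtain V where V: "\<And>a. a \<in> A \<Longrightarrow> V (\<pi> a \<Omega>) = \<pi> (\<sigma> a) \<Omega>" "\<And>x y. norm (V x - V y) = norm (x - y)"
      using isometric_extension[where f = "\<lambda>a. \<pi> a \<Omega>" and g = "\<lambda>a. \<pi> (\<sigma> a) \<Omega>", OF \<pi>(7) iso] by blast
    have contV: "continuous_on UNIV (\<lambda>x. V (f x))" if "continuous_on UNIV f" for f :: "'h \<Rightarrow> 'h"
      using continuous_on_compose2[OF continuous_on_isometry[OF V(2)] that] by blast
    have V_add: "V (x + y) = V x + V y" for x y
      by (rule dense_ext2[where F = "\<lambda>x y. V (x + y)" and G = "\<lambda>x y. V x + V y"])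
        (intro continuous_intros contV | simp add: \<pi>(2)[symmetric] V(1) closed(6) S(2,3))+
    have V_scale: "V (c *\<^sub>C x) = c *\<^sub>C V x" for c x
      by (rule dense_ext[where F = "\<lambda>x. V (c *\<^sub>C x)" and G = "\<lambda>x. c *\<^sub>C V x"])
        (intro continuous_intros contV | simp add: \<pi>(3)[symmetric] V(1) closed(8) S(2,4))+
    have V_inner: "cinner (V x) (V y) = cinner x y" for x y
      by (rule dense_ext2[where F = "\<lambda>x y. cinner (V x) (V y)" and G = cinner])
        (intro continuous_intros contV | simp add: V(1) inner)+
    have V0: "V 0 = 0" using V_add[of 0 0] by simp
    have VB: "V \<in> bounded_operators"
      by (rule bounded_operatorsI[where K = 1]) (use V_add V_scale V(2)[of _ 0] V0 in auto)
    have "V (\<pi> a \<xi>) = \<pi> (\<sigma> a) (V \<xi>)" if a: "a \<in> A" for a \<xi>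
    proof (rule dense_ext[where F = "\<lambda>\<xi>. V (\<pi> a \<xi>)" and G = "\<lambda>\<xi>. \<pi> (\<sigma> a) (V \<xi>)"])
      show "V (\<pi> a (\<pi> b \<Omega>)) = \<pi> (\<sigma> a) (V (\<pi> b \<Omega>))" if b: "b \<in> A" for b
        using a b S(2,5) closed(4) by (simp add: V(1) \<pi>(4)[symmetric])
    qed (intro contV continuous_on_bounded_operator[OF \<pi>(1)[OF a]]
        continuous_on_bounded_operator[OF \<pi>(1)[OF S(2)[OF a]]] continuous_on_id)+
    then show ?thesis using VB V(1) V_inner by blast
  qed
  obtain V where V: "V \<in> bounded_operators" "\<And>a. a \<in> A \<Longrightarrow> V (\<pi> a \<Omega>) = \<pi> (\<alpha> a) \<Omega>"
      "\<And>a \<xi>. a \<in> A \<Longrightarrow> V (\<pi> a \<xi>) = \<pi> (\<alpha> a) (V \<xi>)" "\<And>\<xi> \<eta>. cinner (V \<xi>) (V \<eta>) = cinner \<xi> \<eta>"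
    using unitary[OF \<alpha> tr\<alpha>] by blast
  obtain V' where V': "V' \<in> bounded_operators" "\<And>a. a \<in> A \<Longrightarrow> V' (\<pi> a \<Omega>) = \<pi> (\<beta> a) \<Omega>"
      "\<And>a \<xi>. a \<in> A \<Longrightarrow> V' (\<pi> a \<xi>) = \<pi> (\<beta> a) (V' \<xi>)" "\<And>\<xi> \<eta>. cinner (V' \<xi>) (V' \<eta>) = cinner \<xi> \<eta>"
    using unitary[OF \<beta>_aut tr\<beta>] by blast
  have V'V: "V' (V \<xi>) = \<xi>" for \<xi>
    by (rule dense_ext[where F = "\<lambda>\<xi>. V' (V \<xi>)" and G = "\<lambda>\<xi>. \<xi>"])
      (intro continuous_on_bounded_operator[OF V'(1)] continuous_on_bounded_operator[OF V(1)]
        continuous_on_id | simp add: V(2) V'(2) D(2) \<beta>\<alpha>)+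
  have VV': "V (V' \<xi>) = \<xi>" for \<xi>
    by (rule dense_ext[where F = "\<lambda>\<xi>. V (V' \<xi>)" and G = "\<lambda>\<xi>. \<xi>"])
      (intro continuous_on_bounded_operator[OF V'(1)] continuous_on_bounded_operator[OF V(1)]
        continuous_on_id | simp add: V(2) V'(2) \<beta>A \<alpha>\<beta>)+
  have V_adj: "cinner (V \<xi>) \<eta> = cinner \<xi> (V' \<eta>)" for \<xi> \<eta>
    using V(4)[of \<xi> "V' \<eta>"] by (simp add: VV')
  have V'_adj: "cinner (V' \<xi>) \<eta> = cinner \<xi> (V \<eta>)" for \<xi> \<eta>
    using V'(4)[of \<xi> "V \<eta>"] by (simp add: V'V)
  note VD = bounded_operatorsD[OF V(1)]
  define \<alpha>' where "\<alpha>' = (\<lambda>T. V \<circ> T \<circ> V')"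
  define \<beta>' where "\<beta>' = (\<lambda>T. V' \<circ> T \<circ> V)"
  have \<alpha>'R: "\<alpha>' T \<in> R" if "T \<in> R" for T
    unfolding \<alpha>'_def
    by (rule conj_in_R[OF V(1) V'(1) V'V VV' _ that]) (use V(3) D(2) in blast)
  have \<beta>'R: "\<beta>' T \<in> R" if "T \<in> R" for T
    unfolding \<beta>'_def
    by (rule conj_in_R[OF V'(1) V(1) VV' V'V _ that]) (use V'(3) \<beta>A in blast)
  have "vn_automorphism R \<alpha>'"
    unfolding vn_automorphism_def
  proof (intro conjI ballI allI)
    show "bij_betw \<alpha>' R R"
      by (rule bij_betw_byWitness[of _ \<beta>'])
        (use \<alpha>'R \<beta>'R in \<open>auto simp: \<alpha>'_def \<beta>'_def fun_eq_iff V'V VV'\<close>)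
    show "\<alpha>' (\<lambda>\<xi>. S \<xi> + T \<xi>) = (\<lambda>\<xi>. \<alpha>' S \<xi> + \<alpha>' T \<xi>)" for S T
      by (simp add: \<alpha>'_def fun_eq_iff VD)
    show "\<alpha>' (\<lambda>\<xi>. c *\<^sub>C T \<xi>) = (\<lambda>\<xi>. c *\<^sub>C \<alpha>' T \<xi>)" for c T
      by (simp add: \<alpha>'_def fun_eq_iff VD)
    show "\<alpha>' (S \<circ> T) = \<alpha>' S \<circ> \<alpha>' T" for S T
      by (simp add: \<alpha>'_def fun_eq_iff V'V)
    show "\<alpha>' (adjoint_op T) = adjoint_op (\<alpha>' T)" if T: "T \<in> R" for T
      by (rule adjoint_op(2)[OF R_bounded[OF \<alpha>'R[OF T]], symmetric])
        (simp add: \<alpha>'_def V_adj V'_adj adjoint_op(1)[OF R_bounded[OF T]])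
  qed
  moreover have "\<alpha>' (\<pi> x) = \<pi> (\<alpha> x)" if "x \<in> A" for x
    using that by (simp add: \<alpha>'_def fun_eq_iff V(3) VV')
  moreover have "vector_trace \<Omega> (\<alpha>' T) = vector_trace \<Omega> T" for T
  proof -
    have "V' \<Omega> = \<Omega>" using V'(2)[OF closed(3)] star_automorphism_1[OF \<beta>_aut subalgebra] by (simp add: \<pi>(6))
    then show ?thesis
      using V_adj[of "\<Omega>" "\<Omega>"] V'_adj[of \<Omega> "T \<Omega>"] by (simp add: vector_trace_def \<alpha>'_def)
  qed
  ultimately show thesis using that by blast
qed

text \<open>If two automorphisms of \<open>R\<close> agree on the dense subalgebra, then the inverse of one composed
  with the other fixes it.\<close>

theorem automorphism_unique:
  assumes \<alpha>: "vn_automorphism R \<alpha>" and \<beta>: "vn_automorphism R \<beta>"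
    and eq: "\<And>x. x \<in> A \<Longrightarrow> \<beta> (\<pi> x) = \<alpha> (\<pi> x)" and T: "T \<in> R"
  shows "\<beta> T = \<alpha> T"
proof -
  define \<gamma> where "\<gamma> = (\<lambda>T. the_inv_into R \<alpha> (\<beta> T))"
  have inj: "inj_on \<alpha> R" and onto: "\<alpha> ` R = R"
    using vn_automorphismD(1)[OF \<alpha>] by (auto simp: bij_betw_def)
  have "\<gamma> T = T"
  proof (rule automorphism_fixing_dense_is_identity[of \<gamma> "\<pi> ` A"])
    show "vn_automorphism R \<gamma>"
      unfolding \<gamma>_def by (rule vn_automorphism_comp[OF vn_automorphism_inverse[OF \<alpha>] \<beta>])
    show "\<pi> ` A \<subseteq> R" using image_in_R by blast
    show "\<gamma> x = x" if "x \<in> \<pi> ` A" for x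
      using that eq image_in_R the_inv_into_f_f[OF inj] by (auto simp: \<gamma>_def)
    show "closure ((\<lambda>x. x \<Omega>) ` \<pi> ` A) = UNIV" using \<pi>(7) by (simp add: image_image)
  qed (rule T)
  then have "\<alpha> (the_inv_into R \<alpha> (\<beta> T)) = \<alpha> T" by (simp add: \<gamma>_def)
  then show ?thesis
    using f_the_inv_into_f[OF inj] vn_automorphismD(2)[OF \<beta> T] onto by simp
qed

end

section \<open>The Jones tower\<close>

lemma faithful_tracial_state_subset:
  assumes "faithful_tracial_state A tr" "B \<subseteq> A"
  shows "faithful_tracial_state B tr"
  using assms unfolding faithful_tracial_state_def subset_iff by simp

lemma jones_tower_extension:
  assumes tower: "jones_tower N M tr \<tau> e Ms" and fdN: "fd_cstar_algebra N" and NM: "N \<subseteq> M"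
  shows "jones_extension (below N Ms n) (Ms n) (Ms (Suc n)) tr (e (Suc n)) \<tau>"
proof -
  have bc: "is_basic_construction (below N Ms n) (Ms n) tr (e (Suc n)) (Ms (Suc n))" for n
    using tower by (simp add: jones_tower_def)
  have fd: "fd_cstar_algebra (Ms n)" for n using tower by (simp add: jones_tower_def)
  have "faithful_tracial_state (Ms (Suc n)) tr"
    by (rule faithful_tracial_state_subset[of "\<Union>n. Ms n"])
      (use tower in \<open>auto simp: jones_tower_def\<close>)
  moreover have "fd_cstar_algebra (below N Ms n)" using fd fdN by (cases n) (simp_all add: below_def)
  moreover have "below N Ms n \<subseteq> Ms n"
  proof (cases n)
    case 0
    then show ?thesis using NM tower by (simp add: below_def jones_tower_def)
  next
    case (Suc k)
    then show ?thesis using bc[of k] by (simp add: below_def is_basic_construction_def)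
  qed
  moreover have "tr (x * e (Suc n)) = complex_of_real \<tau> * tr x" if "x \<in> Ms n" for x
    using tower that by (simp add: jones_tower_def)
  ultimately show ?thesis using bc fd by unfold_locales
qed

lemma tower_mono:
  assumes "\<And>n. Ms n \<subseteq> Ms (Suc n)" "m \<le> n"
  shows "Ms m \<subseteq> Ms n"
  using assms by (rule lift_Suc_mono_le)

lemma tower_common_level:
  assumes mono: "\<And>n. Ms n \<subseteq> Ms (Suc n)" and xy: "x \<in> (\<Union>n. Ms n)" "y \<in> (\<Union>n. Ms n)"
  obtains n where "x \<in> Ms n" "y \<in> Ms n"
proof -
  obtain m n where "x \<in> Ms m" "y \<in> Ms n" using xy by blast
  then have "x \<in> Ms (max m n) \<and> y \<in> Ms (max m n)"
    using tower_mono[of Ms m "max m n", OF mono] tower_mono[of Ms n "max m n", OF mono] by auto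
  then show thesis using that by blast
qed

lemma unital_star_subalgebra_union:
  fixes Ms :: "nat \<Rightarrow> 'a::cstar_algebra set"
  assumes sub: "\<And>n. unital_star_subalgebra (Ms n)" and mono: "\<And>n. Ms n \<subseteq> Ms (Suc n)"
  shows "unital_star_subalgebra (\<Union>n. Ms n)"
proof -
  note C = unital_star_subalgebra_closed[OF sub]
  have "x + y \<in> (\<Union>n. Ms n)" "x * y \<in> (\<Union>n. Ms n)" if xy: "x \<in> (\<Union>n. Ms n)" "y \<in> (\<Union>n. Ms n)" for x y
  proof -
    obtain n where n: "x \<in> Ms n" "y \<in> Ms n" by (rule tower_common_level[of Ms, OF mono xy])
    show "x + y \<in> (\<Union>n. Ms n)" "x * y \<in> (\<Union>n. Ms n)"
      using C(4)[OF n] C(6)[OF n] by auto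
  qed
  moreover have "c *\<^sub>C x \<in> (\<Union>n. Ms n)" "star x \<in> (\<Union>n. Ms n)" if x: "x \<in> (\<Union>n. Ms n)" for c x
  proof -
    obtain n where n: "x \<in> Ms n" using x by blast
    show "c *\<^sub>C x \<in> (\<Union>n. Ms n)" "star x \<in> (\<Union>n. Ms n)"
      using C(5)[OF n] C(8)[OF n, of c] by auto
  qed
  moreover have "0 \<in> (\<Union>n. Ms n)" "1 \<in> (\<Union>n. Ms n)" using C(2)[of 0] C(3)[of 0] by auto
  ultimately show ?thesis
    unfolding unital_star_subalgebra_def complex_vector.subspace_def by (intro conjI ballI allI)
qed

text \<open>The automorphisms of the levels are chosen one after the other, each extending the previous
  one; on \<open>M\<^sub>0\<close> the invariance of the trace is the uniqueness of the Markov trace.\<close>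

lemma tower_automorphism:
  fixes N M :: "'a::cstar_algebra set"
  assumes fdN: "fd_cstar_algebra N" and NM: "N \<subseteq> M" and conn: "connected_inclusion N M"
    and tower: "jones_tower N M tr \<tau> e Ms"
    and \<alpha>\<^sub>0: "star_automorphism M \<alpha>\<^sub>0" "\<alpha>\<^sub>0 ` N = N"
  obtains \<alpha> where "star_automorphism (\<Union>n. Ms n) \<alpha>" "\<And>n. \<alpha> ` Ms n = Ms n"
    "\<And>n. \<alpha> (e (Suc n)) = e (Suc n)" "\<And>x. x \<in> M \<Longrightarrow> \<alpha> x = \<alpha>\<^sub>0 x"
    "\<And>x. x \<in> (\<Union>n. Ms n) \<Longrightarrow> tr (\<alpha> x) = tr x"
proof -
  note ext = jones_tower_extension[OF tower fdN NM]
  have M0: "Ms 0 = M" using tower by (simp add: jones_tower_def)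
  have mono: "Ms n \<subseteq> Ms (Suc n)" for n by (rule jones_extension.BC[OF ext])
  note mono_le = tower_mono[of Ms, OF mono]
  have sub: "unital_star_subalgebra (Ms n)" for n
    using tower by (simp add: jones_tower_def fd_cstar_algebra_def)
  define P where "P = (\<lambda>n \<alpha>. star_automorphism (Ms n) \<alpha> \<and> \<alpha> ` below N Ms n = below N Ms n
      \<and> (\<forall>x\<in>Ms n. tr (\<alpha> x) = tr x) \<and> (n = 0 \<longrightarrow> \<alpha> = \<alpha>\<^sub>0))"
  define Q where "Q = (\<lambda>n (\<alpha>::'a \<Rightarrow> 'a) \<alpha>'. (\<forall>x\<in>Ms n. \<alpha>' x = \<alpha> x) \<and> \<alpha>' (e (Suc n)) = e (Suc n))"
  have "\<exists>a. \<forall>n. P n (a n) \<and> Q n (a n) (a (Suc n))"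
  proof (rule dependent_nat_choice)
    have "tr (\<alpha>\<^sub>0 x) = tr x" if "x \<in> M" for x
      using jones_extension.markov_trace_invariant[OF ext[of 0], of \<alpha>\<^sub>0 x] conn \<alpha>\<^sub>0 that
      by (simp add: M0 below_def)
    then show "\<exists>\<alpha>. P 0 \<alpha>" using \<alpha>\<^sub>0 by (auto simp: P_def M0 below_def)
    fix \<alpha> n assume p: "P n \<alpha>"
    then have p: "star_automorphism (Ms n) \<alpha>" "\<alpha> ` below N Ms n = below N Ms n"
      "\<And>x. x \<in> Ms n \<Longrightarrow> tr (\<alpha> x) = tr x" by (auto simp: P_def)
    obtain \<alpha>' where a: "star_automorphism (Ms (Suc n)) \<alpha>'" "\<And>x. x \<in> Ms n \<Longrightarrow> \<alpha>' x = \<alpha> x"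
      "\<alpha>' (e (Suc n)) = e (Suc n)" "\<And>x. x \<in> Ms (Suc n) \<Longrightarrow> tr (\<alpha>' x) = tr x"
      using jones_extension.automorphism_extends[OF ext p] by blast
    have "\<alpha>' ` Ms n = \<alpha> ` Ms n" using a(2) by (intro image_cong) auto
    then have "\<alpha>' ` Ms n = Ms n" using star_automorphismD(1)[OF p(1)] by (simp add: bij_betw_def)
    then have "P (Suc n) \<alpha>'" using a by (simp add: P_def below_def)
    then show "\<exists>\<alpha>'. P (Suc n) \<alpha>' \<and> Q n \<alpha> \<alpha>'" using a by (auto simp: Q_def)
  qed
  then obtain a where "\<And>n. P n (a n)" "\<And>n. Q n (a n) (a (Suc n))" by blast
  then have aut: "\<And>n. star_automorphism (Ms n) (a n)" and tr_a: "\<And>n x. x \<in> Ms n \<Longrightarrow> tr (a n x) = tr x"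
    and a0: "a 0 = \<alpha>\<^sub>0" and step: "\<And>n x. x \<in> Ms n \<Longrightarrow> a (Suc n) x = a n x"
    and a_e: "\<And>n. a (Suc n) (e (Suc n)) = e (Suc n)"
    unfolding P_def Q_def by auto
  have agree: "a n x = a m x" if "m \<le> n" "x \<in> Ms m" for m n x
    using that
  proof (induction n rule: dec_induct)
    case (step k)
    then show ?case using mono_le[of m k] \<open>\<And>n x. x \<in> Ms n \<Longrightarrow> a (Suc n) x = a n x\<close>[of x k] by auto
  qed simp
  define \<alpha> where "\<alpha> = (\<lambda>x. a (LEAST n. x \<in> Ms n) x)"
  have \<alpha>_eq: "\<alpha> x = a n x" if "x \<in> Ms n" for n x
  proof -
    have "x \<in> Ms (LEAST n. x \<in> Ms n)" using that by (rule LeastI)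
    moreover have "(LEAST n. x \<in> Ms n) \<le> n" using that by (rule Least_le)
    ultimately show ?thesis unfolding \<alpha>_def using agree by metis
  qed
  have image: "\<alpha> ` Ms n = Ms n" for n
  proof -
    have "\<alpha> ` Ms n = a n ` Ms n" using \<alpha>_eq by (intro image_cong) auto
    then show ?thesis using star_automorphismD(1)[OF aut] by (simp add: bij_betw_def)
  qed
  have "star_automorphism (\<Union>n. Ms n) \<alpha>"
    unfolding star_automorphism_def
  proof (intro conjI ballI allI)
    have "inj_on \<alpha> (\<Union>n. Ms n)"
    proof (rule inj_onI)
      fix x y assume xy: "x \<in> (\<Union>n. Ms n)" "y \<in> (\<Union>n. Ms n)" "\<alpha> x = \<alpha> y"
      obtain n where n: "x \<in> Ms n" "y \<in> Ms n" by (rule tower_common_level[of Ms, OF mono xy(1,2)])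
      then have "a n x = a n y" using xy(3) \<alpha>_eq by simp
      then show "x = y" using star_automorphismD(1)[OF aut[of n]] n by (auto simp: bij_betw_def inj_on_def)
    qed
    moreover have "\<alpha> ` (\<Union>n. Ms n) = (\<Union>n. Ms n)" using image by (simp add: image_UN)
    ultimately show "bij_betw \<alpha> (\<Union>n. Ms n) (\<Union>n. Ms n)" by (simp add: bij_betw_def)
  next
    fix x y assume xy: "x \<in> (\<Union>n. Ms n)" "y \<in> (\<Union>n. Ms n)"
    obtain n where n: "x \<in> Ms n" "y \<in> Ms n" by (rule tower_common_level[of Ms, OF mono xy])
    note C = unital_star_subalgebra_closed[OF sub[of n]] and S = star_automorphismD[OF aut[of n]]
    show "\<alpha> (x + y) = \<alpha> x + \<alpha> y" using n C(6) S(3) by (simp add: \<alpha>_eq[of _ n])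
    show "\<alpha> (x * y) = \<alpha> x * \<alpha> y" using n C(4) S(5) by (simp add: \<alpha>_eq[of _ n])
  next
    fix x assume "x \<in> (\<Union>n. Ms n)"
    then obtain n where n: "x \<in> Ms n" by blast
    note C = unital_star_subalgebra_closed[OF sub[of n]] and S = star_automorphismD[OF aut[of n]]
    show "\<alpha> (c *\<^sub>C x) = c *\<^sub>C \<alpha> x" for c using n C(8) S(4) by (simp add: \<alpha>_eq[of _ n])
    show "\<alpha> (star x) = star (\<alpha> x)" using n C(5) S(6) by (simp add: \<alpha>_eq[of _ n])
  qed
  moreover have "\<alpha> (e (Suc n)) = e (Suc n)" for n
    using \<alpha>_eq[OF jones_extension.eC[OF ext[of n]]] a_e by simp
  moreover have "\<alpha> x = \<alpha>\<^sub>0 x" if "x \<in> M" for x using \<alpha>_eq[of x 0] that by (simp add: M0 a0)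
  moreover have "tr (\<alpha> x) = tr x" if "x \<in> (\<Union>n. Ms n)" for x using that tr_a \<alpha>_eq by auto
  ultimately show thesis using that image by blast
qed

theorem corollary3p3:
  fixes N M :: "'a::cstar_algebra set"
    and tr :: "'a \<Rightarrow> complex"
    and \<tau> :: real
    and e :: "nat \<Rightarrow> 'a"
    and Ms :: "nat \<Rightarrow> 'a set"
    and \<pi> :: "'a \<Rightarrow> 'h::complex_hilbert_space \<Rightarrow> 'h"
    and \<Omega> :: 'h
    and R :: "('h \<Rightarrow> 'h) set"
    and \<alpha>\<^sub>0 :: "'a \<Rightarrow> 'a"
  assumes "fd_cstar_algebra N" and "fd_cstar_algebra M" and "N \<subseteq> M"
    and "connected_inclusion N M"
    and "markov_trace N M tr \<tau>"
    and "jones_tower N M tr \<tau> e Ms"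
    and "gns_representation (\<Union>n. Ms n) tr \<pi> \<Omega>"
    and "R = generated_von_neumann_algebra (\<pi> ` (\<Union>n. Ms n))"
    and "star_automorphism M \<alpha>\<^sub>0" and "\<alpha>\<^sub>0 ` N = N"
  shows "\<exists>\<alpha>. extends_along_tower R \<pi> M e Ms \<alpha>\<^sub>0 \<alpha> \<and>
             (\<forall>T\<in>R. vector_trace \<Omega> (\<alpha> T) = vector_trace \<Omega> T) \<and>
             (\<forall>\<beta>. extends_along_tower R \<pi> M e Ms \<alpha>\<^sub>0 \<beta> \<longrightarrow> (\<forall>T\<in>R. \<beta> T = \<alpha> T))"
proof -
  let ?A = "\<Union>n. Ms n"
  note tower = assms(6)
  note step = jones_tower_extension[OF tower assms(1,3)]
  have M0: "Ms 0 = M" using tower by (simp add: jones_tower_def)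
  interpret G: gns ?A tr \<pi> \<Omega>
  proof
    show "unital_star_subalgebra ?A"
      using tower jones_extension.BC[OF step]
      by (intro unital_star_subalgebra_union) (auto simp: jones_tower_def fd_cstar_algebra_def)
    show "faithful_tracial_state ?A tr" using tower by (simp add: jones_tower_def)
  qed (rule assms(7))
  have R: "R = commutant (commutant (\<pi> ` ?A))"
    unfolding assms(8) by (rule G.generated_eq)
  obtain \<sigma> where \<sigma>: "star_automorphism ?A \<sigma>" "\<And>n. \<sigma> ` Ms n = Ms n" "\<And>n. \<sigma> (e (Suc n)) = e (Suc n)"
    "\<And>x. x \<in> M \<Longrightarrow> \<sigma> x = \<alpha>\<^sub>0 x" "\<And>x. x \<in> ?A \<Longrightarrow> tr (\<sigma> x) = tr x"
    using tower_automorphism[OF assms(1,3,4,6,9,10)] by blast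
  obtain \<alpha> where \<alpha>: "vn_automorphism R \<alpha>" "\<And>x. x \<in> ?A \<Longrightarrow> \<alpha> (\<pi> x) = \<pi> (\<sigma> x)"
    "\<And>T. T \<in> R \<Longrightarrow> vector_trace \<Omega> (\<alpha> T) = vector_trace \<Omega> T"
    using G.trace_preserving_automorphism_extends[OF \<sigma>(1,5)] unfolding R by metis
  have MA: "x \<in> ?A" if "x \<in> Ms n" for x n using that by blast
  have eA: "e (Suc n) \<in> Ms (Suc n)" for n by (rule jones_extension.eC[OF step])
  have "extends_along_tower R \<pi> M e Ms \<alpha>\<^sub>0 \<alpha>"
    unfolding extends_along_tower_def
  proof (intro conjI allI impI ballI \<alpha>(1))
    show "\<alpha> (\<pi> (e i)) = \<pi> (e i)" if "i \<ge> 1" for i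
      using that \<alpha>(2)[OF MA[OF eA[of "i - 1"]]] \<sigma>(3)[of "i - 1"] by simp
    show "\<alpha> ` \<pi> ` Ms i = \<pi> ` Ms i" for i
    proof -
      have "\<alpha> ` \<pi> ` Ms i = \<pi> ` \<sigma> ` Ms i"
        unfolding image_image using \<alpha>(2) by (intro image_cong) auto
      then show ?thesis by (simp add: \<sigma>(2))
    qed
    show "\<alpha> (\<pi> x) = \<pi> (\<alpha>\<^sub>0 x)" if "x \<in> M" for x
      using \<alpha>(2)[OF MA[of x 0]] \<sigma>(4) that by (simp add: M0)
  qed
  moreover have "\<beta> T = \<alpha> T" if \<beta>: "extends_along_tower R \<pi> M e Ms \<alpha>\<^sub>0 \<beta>" and T: "T \<in> R" for \<beta> T
  proof -
    have \<beta>_vn: "vn_automorphism R \<beta>" using \<beta> by (simp add: extends_along_tower_def)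
    note \<beta>D = vn_automorphismD[OF \<beta>_vn]
    have \<pi>R: "\<pi> x \<in> R" if "x \<in> ?A" for x unfolding R by (rule G.image_in_R[OF that])
    have \<pi>_add: "\<pi> (x + y) = (\<lambda>\<xi>. \<pi> x \<xi> + \<pi> y \<xi>)" if "x \<in> ?A" "y \<in> ?A" for x y
      by (rule ext) (rule G.\<pi>(2)[OF that])
    have \<pi>_mult: "\<pi> (x * y) = \<pi> x \<circ> \<pi> y" if "x \<in> ?A" "y \<in> ?A" for x y
      unfolding o_def by (rule ext) (rule G.\<pi>(4)[OF that])
    have \<pi>_scale: "\<pi> (c *\<^sub>C x) = (\<lambda>\<xi>. c *\<^sub>C \<pi> x \<xi>)" if "x \<in> ?A" for x c
      by (rule ext) (rule G.\<pi>(3)[OF that])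
    note \<sigma>D = star_automorphismD[OF \<sigma>(1)]
    have level: "\<beta> (\<pi> x) = \<pi> (\<sigma> x)" if "x \<in> Ms n" for n x
      using that
    proof (induction n arbitrary: x)
      case 0
      then show ?case using \<beta> \<sigma>(4) by (simp add: M0 extends_along_tower_def)
    next
      case (Suc n)
      interpret L: jones_extension "below N Ms n" "Ms n" "Ms (Suc n)" tr "e (Suc n)" \<tau> by (rule step)
      have fix_e: "\<beta> (\<pi> (e (Suc n))) = \<pi> (\<sigma> (e (Suc n)))"
        using \<beta> \<sigma>(3) by (simp add: extends_along_tower_def)
      have "x \<in> L.ideal_e" using Suc.prems L.generated by simp
      then show ?case
      proof (induction rule: L.ideal_e_induct)
        case zero
        have z: "0 \<in> Ms n" by (rule L.B.closed(2))
        show ?case by (rule Suc.IH[OF z])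
      next
        case (step c a b y)
        have A: "a \<in> ?A" "b \<in> ?A" "e (Suc n) \<in> ?A" "y \<in> ?A"
          using step(1,2) L.eC subsetD[OF L.ideal_e_sub step(3)] by blast+
        define w where "w = a * e (Suc n) * b"
        have ae: "a * e (Suc n) \<in> ?A" by (rule G.closed(4)[OF A(1,3)])
        have w: "w \<in> ?A" unfolding w_def by (rule G.closed(4)[OF ae A(2)])
        have cw: "c *\<^sub>C w \<in> ?A" by (rule G.closed(8)[OF w])
        have "\<beta> (\<pi> w) = \<beta> (\<pi> a) \<circ> \<beta> (\<pi> (e (Suc n))) \<circ> \<beta> (\<pi> b)"
          unfolding w_def \<pi>_mult[OF ae A(2)] \<beta>D(5)[OF \<pi>R[OF ae] \<pi>R[OF A(2)]]
          unfolding \<pi>_mult[OF A(1,3)] \<beta>D(5)[OF \<pi>R[OF A(1)] \<pi>R[OF A(3)]] ..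
        also have "\<dots> = \<pi> (\<sigma> a) \<circ> \<pi> (\<sigma> (e (Suc n))) \<circ> \<pi> (\<sigma> b)"
          by (simp only: fix_e Suc.IH[OF step(1)] Suc.IH[OF step(2)])
        also have "\<dots> = \<pi> (\<sigma> w)"
          unfolding w_def \<sigma>D(5)[OF ae A(2)] \<sigma>D(5)[OF A(1,3)]
            \<pi>_mult[OF G.closed(4)[OF \<sigma>D(2)[OF A(1)] \<sigma>D(2)[OF A(3)]] \<sigma>D(2)[OF A(2)]]
            \<pi>_mult[OF \<sigma>D(2)[OF A(1)] \<sigma>D(2)[OF A(3)]] ..
        finally have \<beta>w: "\<beta> (\<pi> w) = \<pi> (\<sigma> w)" .
        have "\<beta> (\<pi> (c *\<^sub>C w + y)) = (\<lambda>\<xi>. \<beta> (\<pi> (c *\<^sub>C w)) \<xi> + \<beta> (\<pi> y) \<xi>)"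
          unfolding \<pi>_add[OF cw A(4)] by (rule \<beta>D(3)[OF \<pi>R[OF cw] \<pi>R[OF A(4)]])
        also have "\<beta> (\<pi> (c *\<^sub>C w)) = (\<lambda>\<xi>. c *\<^sub>C \<beta> (\<pi> w) \<xi>)"
          unfolding \<pi>_scale[OF w] by (rule \<beta>D(4)[OF \<pi>R[OF w]])
        also have "(\<lambda>\<xi>. (c *\<^sub>C \<beta> (\<pi> w) \<xi>) + \<beta> (\<pi> y) \<xi>) = \<pi> (\<sigma> (c *\<^sub>C w + y))"
          unfolding \<sigma>D(3)[OF cw A(4)] \<sigma>D(4)[OF w] \<beta>w step.IH
            \<pi>_add[OF G.closed(8)[OF \<sigma>D(2)[OF w]] \<sigma>D(2)[OF A(4)]] \<pi>_scale[OF \<sigma>D(2)[OF w]] ..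
        finally show ?case unfolding w_def .
      qed
    qed
    have "\<beta> (\<pi> x) = \<alpha> (\<pi> x)" if "x \<in> ?A" for x using that level \<alpha>(2) by auto
    then show ?thesis
      using G.automorphism_unique[OF \<alpha>(1)[unfolded R] \<beta>_vn[unfolded R]] T[unfolded R] by blast
  qed
  ultimately show ?thesis using \<alpha>(3) by blast
qed

end
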